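(* If the Orlicz function $\Psi$ satisfies $\Delta^2$, then there exists an analytic self-map $\phi$ of $\mathbb D$ such that $C_\phi\colon H^\Psi\to H^\Psi$ is order bounded into $M^\Psi(\mathbb T)$ (hence compact) but is $p$-summing for no $p\ge1$.
   Context: An Orlicz function is a continuous, strictly convex, increasing $\Psi\colon[0,\infty)\to[0,\infty)$ with $\Psi(0)=0$ and $\Psi(x)/x\to\infty$. $L^\Psi,M^\Psi$, Luxemburg norm: $\|f\|_\Psi=\inf\{C>0:\int\Psi(|f|/C)\le1\}$; $M^\Psi$ = functions with $\int\Psi(|f|/C)<\infty$ for all $C>0$. $H^\Psi$ = analytic $f$ on $\mathbb D$ with $\sup_{r<1}\|f(re^{i\cdot})\|_{L^\Psi(\mathbb T)}<\infty$, normed by the $L^\Psi(\mathbb T)$-norm of its boundary values $f^*$. $C_\phi f=f\circ\phi$. Order bounded into $M^\Psi(\mathbb T)$: there is $g\in M^\Psi(\mathbb T)$ with $|(f\circ\phi)^*|\le g$ a.e. for all $f$ in the unit ball of $H^\Psi$. $\Delta^2$: $\exists\alpha>1$, $\Psi(x)^2\le\Psi(\alpha x)$ for large $x$. An operator $T\colon X\to Y$ is $p$-summing if there is $C$ with $\sum_k\|Tx_k\|^p\le C^p\sup_{\|x^*\|\le1}\sum_k|x^*(x_k)|^p$ for all finite families $(x_k)$ in $X$. *)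

theory Defs
  imports "HOL-Analysis.Analysis"
begin

definition strictly_convex_on :: "real set \<Rightarrow> (real \<Rightarrow> real) \<Rightarrow> bool" where
  "strictly_convex_on S f \<longleftrightarrow>
     (\<forall>x\<in>S. \<forall>y\<in>S. \<forall>u::real. x \<noteq> y \<and> 0 < u \<and> u < 1 \<longrightarrow>
        f (u * x + (1 - u) * y) < u * f x + (1 - u) * f y)"

definition orlicz_function :: "(real \<Rightarrow> real) \<Rightarrow> bool" where
  "orlicz_function \<Psi> \<longleftrightarrow>
     continuous_on {0..} \<Psi> \<and>
     strictly_convex_on {0..} \<Psi> \<and>
     mono_on {0..} \<Psi> \<and>
     (\<forall>x\<ge>0. \<Psi> x \<ge> 0) \<and>
     \<Psi> 0 = 0 \<and>
     filterlim (\<lambda>x. \<Psi> x / x) at_top at_top"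

definition delta2 :: "(real \<Rightarrow> real) \<Rightarrow> bool" where
  "delta2 \<Psi> \<longleftrightarrow> (\<exists>\<alpha>>1. \<exists>x0. \<forall>x\<ge>x0. (\<Psi> x)^2 \<le> \<Psi> (\<alpha> * x))"

text \<open>The circle T is parametrised by the angle t in [0, 2 pi]; the measure is
  (completed) Lebesgue measure normalised by 1/(2 pi).\<close>

definition circ :: "real measure" where
  "circ = lebesgue_on {0..2*pi}"

definition circ_modular :: "(real \<Rightarrow> real) \<Rightarrow> (real \<Rightarrow> 'b::real_normed_vector) \<Rightarrow> ennreal" where
  "circ_modular \<Psi> f = (\<integral>\<^sup>+ t. ennreal (\<Psi> (norm (f t))) \<partial>circ) / ennreal (2*pi)"

definition lux_norm :: "(real \<Rightarrow> real) \<Rightarrow> (real \<Rightarrow> 'b::real_normed_vector) \<Rightarrow> real" where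
  "lux_norm \<Psi> f = Inf {C. 0 < C \<and> circ_modular \<Psi> (\<lambda>t. inverse C *\<^sub>R f t) \<le> 1}"

definition orlicz_L :: "(real \<Rightarrow> real) \<Rightarrow> (real \<Rightarrow> 'b::{real_normed_vector,second_countable_topology}) set" where
  "orlicz_L \<Psi> = {f. f \<in> borel_measurable circ \<and>
                      (\<exists>C>0. circ_modular \<Psi> (\<lambda>t. inverse C *\<^sub>R f t) < \<infinity>)}"

definition orlicz_M :: "(real \<Rightarrow> real) \<Rightarrow> (real \<Rightarrow> 'b::{real_normed_vector,second_countable_topology}) set" where
  "orlicz_M \<Psi> = {f. f \<in> borel_measurable circ \<and>
                      (\<forall>C>0. circ_modular \<Psi> (\<lambda>t. inverse C *\<^sub>R f t) < \<infinity>)}"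

definition circle_restr :: "(complex \<Rightarrow> complex) \<Rightarrow> real \<Rightarrow> real \<Rightarrow> complex" where
  "circle_restr f r t = f (of_real r * cis t)"

text \<open>Radial boundary values f*(e^{it}) = lim_{r -> 1-} f(r e^{it}) (exist a.e. for f in H^Psi).\<close>
definition bdry :: "(complex \<Rightarrow> complex) \<Rightarrow> real \<Rightarrow> complex" where
  "bdry f t = Lim (at_left 1) (\<lambda>r. f (of_real r * cis t))"

definition hardy_orlicz :: "(real \<Rightarrow> real) \<Rightarrow> (complex \<Rightarrow> complex) set" where
  "hardy_orlicz \<Psi> = {f. f holomorphic_on ball 0 1 \<and>
      (\<exists>B. \<forall>r. 0 \<le> r \<and> r < 1 \<longrightarrow>
              circle_restr f r \<in> orlicz_L \<Psi> \<and> lux_norm \<Psi> (circle_restr f r) \<le> B)}"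

definition hnorm :: "(real \<Rightarrow> real) \<Rightarrow> (complex \<Rightarrow> complex) \<Rightarrow> real" where
  "hnorm \<Psi> f = lux_norm \<Psi> (bdry f)"

definition hardy_dual_ball :: "(real \<Rightarrow> real) \<Rightarrow> ((complex \<Rightarrow> complex) \<Rightarrow> complex) set" where
  "hardy_dual_ball \<Psi> = {L.
      (\<forall>f\<in>hardy_orlicz \<Psi>. \<forall>g\<in>hardy_orlicz \<Psi>. L (\<lambda>z. f z + g z) = L f + L g) \<and>
      (\<forall>f\<in>hardy_orlicz \<Psi>. \<forall>c. L (\<lambda>z. c * f z) = c * L f) \<and>
      (\<forall>f\<in>hardy_orlicz \<Psi>. cmod (L f) \<le> hnorm \<Psi> f)}"

definition order_bounded_M :: "(real \<Rightarrow> real) \<Rightarrow> (complex \<Rightarrow> complex) \<Rightarrow> bool" where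
  "order_bounded_M \<Psi> \<phi> \<longleftrightarrow>
     (\<exists>g::real \<Rightarrow> real. g \<in> orlicz_M \<Psi> \<and>
        (\<forall>f\<in>hardy_orlicz \<Psi>. hnorm \<Psi> f \<le> 1 \<longrightarrow>
            (AE t in circ. cmod (bdry (f \<circ> \<phi>) t) \<le> g t)))"

text \<open>Compactness of C_phi on H^Psi: the image of the unit ball is relatively compact
  (sequential formulation; H^Psi is a Banach space).\<close>
definition comp_compact :: "(real \<Rightarrow> real) \<Rightarrow> (complex \<Rightarrow> complex) \<Rightarrow> bool" where
  "comp_compact \<Psi> \<phi> \<longleftrightarrow>
     (\<forall>F::nat \<Rightarrow> complex \<Rightarrow> complex.
        (\<forall>n. F n \<in> hardy_orlicz \<Psi> \<and> hnorm \<Psi> (F n) \<le> 1) \<longrightarrow>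
        (\<exists>\<sigma> g. strict_mono \<sigma> \<and> g \<in> hardy_orlicz \<Psi> \<and>
           (\<lambda>n. lux_norm \<Psi> (\<lambda>t. bdry (F (\<sigma> n) \<circ> \<phi>) t - bdry g t)) \<longlonglongrightarrow> 0))"

definition comp_p_summing :: "(real \<Rightarrow> real) \<Rightarrow> real \<Rightarrow> (complex \<Rightarrow> complex) \<Rightarrow> bool" where
  "comp_p_summing \<Psi> p \<phi> \<longleftrightarrow>
     (\<exists>C\<ge>0. \<forall>xs::(complex \<Rightarrow> complex) list. set xs \<subseteq> hardy_orlicz \<Psi> \<longrightarrow>
        (\<Sum>f\<leftarrow>xs. hnorm \<Psi> (f \<circ> \<phi>) powr p)
          \<le> C powr p * Sup {(\<Sum>f\<leftarrow>xs. cmod (L f) powr p) | L. L \<in> hardy_dual_ball \<Psi>})"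

end

(* The symbol is phi = exp (- (w + S w)), where w = (1+z)/(1-z) is the half-plane variable and
   S w = sum_n 2^(-n-1) R_n / (R_n + w).  On the boundary w = iy we have |phi| = exp (- Re S (iy)), with
   Re S (iy) comparable to 2^(-n) as long as y lies between 2^n R_n and R_(n+1), while the argument of phi
   turns at unit speed in y.  So |phi| is close to 1 only near z = 1, on sets whose measure is controlled by R.

   Functions in the unit ball of H^Psi satisfy |f z| <= 2 G(n) for |z| <= 1 - 2^(-n), where G grows more slowly
   than every power of 2^n.  This needs Fatou's theorem on radial limits, since the norm is defined through
   boundary values.  With R_n = 2^n Psi(x1 + n G(n+5)) the functions f o phi are dominated on all radii by one
   function in M^Psi; order boundedness, boundedness and (with Montel's theorem) compactness follow.

   Against p-summability: the squared Dirichlet means centred at the 2^n-th roots of unity have bounded absolute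
   sum on the disc, hence are weakly 1-summable, but the norms of their compositions with phi are
   at least 2^(-n/(2p)) / 2, because Delta^2 makes Psi(2^(n/(2p))) exceed every fixed power of 2^n R_n. *)
theory Submission
  imports Defs "HOL-Complex_Analysis.Complex_Analysis" "HOL-Real_Asymp.Real_Asymp"
begin

section \<open>Orlicz functions and the Luxemburg norm\<close>

text \<open>The two demands on the symbol conflict. Order boundedness needs the boundary set where
  |phi| > 1 - 2^(-n-4) to have measure at most a constant over R_n, with R_n so large that every
  dilate of the majorant has finite modular. Failure of summability needs phi to come close to all
  2^n-th roots of unity on arcs that are not too short; the arcs found have length of order 2^(-m)
  (2^m R_m)^(-2) with m = n + 4. Psi(X) has to beat the reciprocal of that length, and R_m involves
  Psi at an argument that grows more slowly than every power of 2^m. This is the gap that Delta^2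
  closes, for every p at once because R does not depend on p. The other obstacle is the norm.
  Membership in H^Psi bounds f on circles by a constant that depends on f, while the unit ball is
  described by boundary values alone. Passing from these to interior bounds requires uniform
  integrability of |f|^k over the circles; it comes from higher moments, which exist because Delta^2
  makes Psi dominate every power.\<close>

lemma circ_space [simp]: "space circ = {0..2*pi}"
  by (simp add: circ_def)

lemma emeasure_circ: "emeasure circ {0..2*pi} = ennreal (2*pi)"
  by (simp add: circ_def emeasure_restrict_space)

lemma borel_measurable_circ:
  assumes "f \<in> borel_measurable borel"
  shows "f \<in> borel_measurable circ"
proof -
  have "f \<in> borel_measurable lebesgue" 
    using assms by (simp add: measurable_completion)
  then show ?thesis unfolding circ_def by (rule measurable_restrict_space1)
qed

lemma continuous_on_measurable_circ:
  fixes f :: "real \<Rightarrow> 'b::{metric_space, second_countable_topology}"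
  assumes "continuous_on UNIV f"
  shows "f \<in> borel_measurable circ"
  by (rule borel_measurable_circ[OF borel_measurable_continuous_onI[OF assms]])

lemma AE_circ_interior: "AE t in circ. 0 < t \<and> t < 2*pi"
proof -
  have "negligible {0, 2*pi}" by simp
  then have "{0,2*pi} \<in> null_sets (lebesgue :: real measure)" by (simp add: negligible_iff_null_sets)
  then have "AE t in (lebesgue :: real measure). t \<notin> {0,2*pi}" by (rule AE_not_in)
  then have "AE t in (lebesgue :: real measure). t \<in> {0..2*pi} \<longrightarrow> 0 < t \<and> t < 2*pi" 
    by eventually_elim auto
  then show ?thesis unfolding circ_def by (subst AE_restrict_space_iff) auto
qed

locale orlicz =
  fixes \<Psi> :: "real \<Rightarrow> real"
  assumes orl: "orlicz_function \<Psi>"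
begin

lemma cont: "continuous_on {0..} \<Psi>" using orl by (simp add: orlicz_function_def)
lemma zero [simp]: "\<Psi> 0 = 0" using orl by (simp add: orlicz_function_def)
lemma nonneg: "x \<ge> 0 \<Longrightarrow> \<Psi> x \<ge> 0" using orl by (simp add: orlicz_function_def)
lemma mono: "0 \<le> x \<Longrightarrow> x \<le> y \<Longrightarrow> \<Psi> x \<le> \<Psi> y"
  using orl by (auto simp add: orlicz_function_def mono_on_def)

lemma scale_le:
  assumes "0 \<le> x" "0 \<le> u" "u \<le> 1"
  shows "\<Psi> (u * x) \<le> u * \<Psi> x"
proof (cases "x = 0 \<or> u = 0 \<or> u = 1")
  case False
  have "strictly_convex_on {0..} \<Psi>" using orl by (simp add: orlicz_function_def)
  from this[unfolded strictly_convex_on_def, rule_format, of x 0 u] assms False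
  show ?thesis by simp
qed auto

lemma eventually_ge_linear: "\<exists>X\<ge>1. \<forall>x\<ge>X. \<Psi> x \<ge> c * x"
proof -
  have "filterlim (\<lambda>x. \<Psi> x / x) at_top at_top" using orl by (simp add: orlicz_function_def)
  then have "eventually (\<lambda>x. \<Psi> x / x \<ge> c) at_top" by (simp add: filterlim_at_top)
  then obtain X where X: "\<And>x. x \<ge> X \<Longrightarrow> \<Psi> x / x \<ge> c" by (auto simp: eventually_at_top_linorder)
  show ?thesis
  proof (intro exI[of _ "max 1 X"] conjI allI impI)
    fix x assume "max 1 X \<le> x"
    with X[of x] show "c * x \<le> \<Psi> x" by (simp add: field_simps)
  qed simp
qed

text \<open>Continuity is only assumed on the half-line, so measurability and limits go through this
  extension, which agrees with \<open>\<Psi>\<close> at every norm.\<close>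

lemma cont_ext: "continuous_on UNIV (\<lambda>x. \<Psi> (max 0 x))"
  by (rule continuous_on_compose2[OF cont]) (auto intro!: continuous_intros)

lemma measurable_norm [measurable]:
  assumes [measurable]: "f \<in> borel_measurable M"
  shows "(\<lambda>t. \<Psi> (norm (f t :: 'b::{real_normed_vector,second_countable_topology}))) \<in> borel_measurable M"
proof -
  have [measurable]: "(\<lambda>x. \<Psi> (max 0 x)) \<in> borel_measurable borel"
    using cont_ext by (rule borel_measurable_continuous_onI)
  have "(\<lambda>t. \<Psi> (max 0 (norm (f t)))) \<in> borel_measurable M" by measurable
  then show ?thesis by (simp add: max_def)
qed

lemma tendsto_norm:
  fixes f :: "'c \<Rightarrow> 'b::real_normed_vector"
  assumes "(f \<longlongrightarrow> l) F"
  shows "((\<lambda>x. \<Psi> (norm (f x))) \<longlongrightarrow> \<Psi> (norm l)) F"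
proof -
  have "((\<lambda>x. \<Psi> (max 0 (norm (f x)))) \<longlongrightarrow> \<Psi> (max 0 (norm l))) F"
    by (rule continuous_on_tendsto_compose[OF cont_ext]) (auto intro!: assms tendsto_norm)
  then show ?thesis by (simp add: max_def)
qed

text \<open>Turns sup-norm bounds into Luxemburg bounds: a function bounded by K has norm at most K
  / \<kappa>.\<close>

lemma small_value: "\<exists>\<kappa>. 0 < \<kappa> \<and> \<Psi> \<kappa> \<le> 1"
proof (intro exI conjI)
  let ?k = "1 / max 1 (\<Psi> 1)"
  show "0 < ?k" by simp
  have "\<Psi> (?k * 1) \<le> ?k * \<Psi> 1" by (rule scale_le) auto
  also have "\<dots> \<le> 1" by (auto simp: field_simps)
  finally show "\<Psi> ?k \<le> 1" by simp
qed

lemma modular_mono_AE: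
  fixes f :: "real \<Rightarrow> 'b::real_normed_vector" and g :: "real \<Rightarrow> 'c::real_normed_vector"
  assumes "AE t in circ. norm (f t) \<le> norm (g t)"
  shows "circ_modular \<Psi> f \<le> circ_modular \<Psi> g"
  unfolding circ_modular_def
proof (rule divide_right_mono_ennreal, rule nn_integral_mono_AE)
  show "AE t in circ. ennreal (\<Psi> (norm (f t))) \<le> ennreal (\<Psi> (norm (g t)))"
    using assms by eventually_elim (intro ennreal_leI mono, auto)
qed

lemma modular_scale:
  fixes f :: "real \<Rightarrow> 'b::{real_normed_vector,second_countable_topology}"
  assumes "f \<in> borel_measurable circ" "0 \<le> u" "u \<le> 1"
  shows "circ_modular \<Psi> (\<lambda>t. u *\<^sub>R f t) \<le> ennreal u * circ_modular \<Psi> f"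
proof -
  have [measurable]: "f \<in> borel_measurable circ" by fact
  have "(\<integral>\<^sup>+ t. ennreal (\<Psi> (norm (u *\<^sub>R f t))) \<partial>circ) \<le> (\<integral>\<^sup>+ t. ennreal u * ennreal (\<Psi> (norm (f t))) \<partial>circ)"
    using assms by (intro nn_integral_mono) 
      (auto simp flip: ennreal_mult intro!: ennreal_leI simp: scale_le nonneg)
  also have "\<dots> = ennreal u * (\<integral>\<^sup>+ t. ennreal (\<Psi> (norm (f t))) \<partial>circ)"
    by (rule nn_integral_cmult) measurable
  finally show ?thesis unfolding circ_modular_def
    using divide_right_mono_ennreal by (simp add: ennreal_times_divide)
qed

lemma lux_norm_le:
  assumes "0 < C" "circ_modular \<Psi> (\<lambda>t. inverse C *\<^sub>R f t) \<le> 1"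
  shows "lux_norm \<Psi> f \<le> C"
  unfolding lux_norm_def using assms by (intro cInf_lower bdd_belowI[of _ 0]) auto

text \<open>By convexity and \<open>\<Psi> 0 = 0\<close>, shrinking the argument by u = 1 / max 1 K
  brings a finite modular K down to at most 1.\<close>

lemma orlicz_L_ex_modular_le_1:
  fixes f :: "real \<Rightarrow> 'b::{real_normed_vector,second_countable_topology}"
  assumes "f \<in> orlicz_L \<Psi>"
  shows "\<exists>C>0. circ_modular \<Psi> (\<lambda>t. inverse C *\<^sub>R f t) \<le> 1"
proof -
  from assms obtain C where C: "C > 0" "circ_modular \<Psi> (\<lambda>t. inverse C *\<^sub>R f t) < \<infinity>"
    and [measurable]: "f \<in> borel_measurable circ"
    by (auto simp: orlicz_L_def)
  from C(2) obtain K where K: "K \<ge> 0" "circ_modular \<Psi> (\<lambda>t. inverse C *\<^sub>R f t) = ennreal K"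
    by (metis ennreal_cases infinity_ennreal_def less_irrefl)
  define u where "u = 1 / max 1 K"
  have u: "0 < u" "u \<le> 1" "u * K \<le> 1" by (auto simp: u_def field_simps)
  have "circ_modular \<Psi> (\<lambda>t. u *\<^sub>R (inverse C *\<^sub>R f t)) \<le> ennreal u * ennreal K"
    using modular_scale[of "\<lambda>t. inverse C *\<^sub>R f t" u] u K(2) by simp
  also have "\<dots> = ennreal (u * K)" using u K by (simp add: ennreal_mult)
  also have "\<dots> \<le> 1" using u by simp
  finally have "circ_modular \<Psi> (\<lambda>t. inverse (C / u) *\<^sub>R f t) \<le> 1" 
    by (simp add: field_simps)
  then show ?thesis using C(1) u(1) by (intro exI[of _ "C/u"]) auto
qed

text \<open>The strict inequality yields an admissible C' below C without knowing that the infimum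
  is attained. The hypothesis \<open>ex\<close> guards against the real \<open>Inf\<close> of the
  empty set, which carries no information.\<close>

lemma modular_le_1_of_lux_norm_less:
  fixes f :: "real \<Rightarrow> 'b::real_normed_vector"
  assumes ex: "\<exists>C>0. circ_modular \<Psi> (\<lambda>t. inverse C *\<^sub>R f t) \<le> 1" and less: "lux_norm \<Psi> f < C"
  shows "circ_modular \<Psi> (\<lambda>t. inverse C *\<^sub>R f t) \<le> 1"
proof -
  have "\<exists>C'\<in>{C. 0 < C \<and> circ_modular \<Psi> (\<lambda>t. inverse C *\<^sub>R f t) \<le> 1}. C' < C"
    using less ex unfolding lux_norm_def by (subst (asm) cInf_less_iff) (auto intro!: bdd_belowI[of _ 0])
  then obtain C' where C': "0 < C'" "C' < C" "circ_modular \<Psi> (\<lambda>t. inverse C' *\<^sub>R f t) \<le> 1" by auto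
  have "circ_modular \<Psi> (\<lambda>t. inverse C *\<^sub>R f t) \<le> circ_modular \<Psi> (\<lambda>t. inverse C' *\<^sub>R f t)"
    using C'(1,2) by (intro modular_mono_AE AE_I2) (auto intro!: mult_right_mono)
  with C'(3) show ?thesis by simp
qed

lemma lux_norm_nonneg:
  fixes f :: "real \<Rightarrow> 'b::real_normed_vector"
  assumes ex: "\<exists>C>0. circ_modular \<Psi> (\<lambda>t. inverse C *\<^sub>R f t) \<le> 1"
  shows "lux_norm \<Psi> f \<ge> 0"
  unfolding lux_norm_def using ex by (intro cInf_greatest) auto

lemma modular_le_1_of_bounded:
  fixes f :: "real \<Rightarrow> 'b::real_normed_vector"
  assumes "\<And>t. 0 < t \<Longrightarrow> t < 2*pi \<Longrightarrow> norm (f t) \<le> K" "0 < K" "0 < \<kappa>" "\<Psi> \<kappa> \<le> 1"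
  shows "circ_modular \<Psi> (\<lambda>t. inverse (K/\<kappa>) *\<^sub>R f t) \<le> 1"
proof -
  have "(\<integral>\<^sup>+ t. ennreal (\<Psi> (norm (inverse (K/\<kappa>) *\<^sub>R f t))) \<partial>circ) \<le> (\<integral>\<^sup>+ t. 1 \<partial>circ)"
  proof (rule nn_integral_mono_AE)
    show "AE t in circ. ennreal (\<Psi> (norm (inverse (K/\<kappa>) *\<^sub>R f t))) \<le> 1"
      using AE_circ_interior
    proof eventually_elim
      case (elim t)
      have "norm (inverse (K/\<kappa>) *\<^sub>R f t) \<le> \<kappa>"
        using assms(1)[of t] elim assms(2,3) by (simp add: field_simps)
      then have "\<Psi> (norm (inverse (K/\<kappa>) *\<^sub>R f t)) \<le> 1"
        using mono[of "norm (inverse (K/\<kappa>) *\<^sub>R f t)" \<kappa>] assms(4) by simp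
      then show ?case by simp
    qed
  qed
  also have "\<dots> = ennreal (2*pi)" using emeasure_circ by simp
  finally show ?thesis unfolding circ_modular_def
    by (intro divide_le_posI_ennreal) simp_all
qed

end

section \<open>Growth forced by Delta^2\<close>

locale orlicz_delta2 = orlicz +
  assumes d2: "delta2 \<Psi>"
begin

text \<open>Each use of Delta^2 squares the lower bound and so doubles the exponent; the dilation by
  \<alpha> is absorbed into the constant.\<close>

lemma ge_power2:
  "\<exists>c>0. \<exists>X\<ge>1. \<forall>x\<ge>X. \<Psi> x \<ge> c * x ^ (2 ^ j)"
proof (induction j)
  case 0
  from eventually_ge_linear[of 1] show ?case by (intro exI[of _ 1]) auto
next
  case (Suc j)
  then obtain c X where cX: "c > 0" "X \<ge> 1" "\<And>x. x \<ge> X \<Longrightarrow> \<Psi> x \<ge> c * x ^ (2 ^ j)" by blast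
  from d2 obtain \<alpha> x0 where a: "\<alpha> > 1" "\<And>x. x \<ge> x0 \<Longrightarrow> (\<Psi> x)^2 \<le> \<Psi> (\<alpha> * x)"
    by (auto simp: delta2_def)
  show ?case
  proof (intro exI conjI allI impI)
    show "0 < c^2 / \<alpha> ^ (2 ^ Suc j)" using cX a by simp
    show "1 \<le> \<alpha> * max X x0" using cX a(1) mult_mono[of 1 \<alpha> 1 "max X x0"] by simp
    fix x assume x: "\<alpha> * max X x0 \<le> x"
    then have y: "max X x0 \<le> x / \<alpha>" using a(1) by (subst pos_le_divide_eq) (simp_all add: mult.commute)
    then have "(c * (x/\<alpha>) ^ (2 ^ j))^2 \<le> (\<Psi> (x/\<alpha>))^2"
      using cX by (intro power_mono) auto
    also have "\<dots> \<le> \<Psi> (\<alpha> * (x/\<alpha>))" using y by (intro a(2)) auto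
    also have "\<dots> = \<Psi> x" using a(1) by simp
    finally show "c^2 / \<alpha> ^ (2 ^ Suc j) * x ^ (2 ^ Suc j) \<le> \<Psi> x"
      unfolding power_Suc2 power_mult by (simp add: power_mult_distrib power_divide)
  qed
qed

lemma power_le_ex: "\<exists>A\<ge>0. \<exists>B\<ge>0. \<forall>x\<ge>0. x ^ k \<le> A + B * \<Psi> x"
proof -
  obtain c X where cX: "c > 0" "X \<ge> 1" "\<And>x. x \<ge> X \<Longrightarrow> \<Psi> x \<ge> c * x ^ (2 ^ k)" using ge_power2[of k] by blast
  show ?thesis
  proof (intro exI conjI allI impI)
    show "0 \<le> X^k" "0 \<le> 1/c" using cX by auto
    fix x :: real assume x: "0 \<le> x"
    show "x ^ k \<le> X ^ k + 1/c * \<Psi> x"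
    proof (cases "x \<le> X")
      case True
      then have "x^k \<le> X^k" using x by (intro power_mono) auto
      moreover have "0 \<le> 1/c * \<Psi> x" using nonneg[OF x] cX by auto
      ultimately show ?thesis by linarith
    next
      case False
      have "x ^ k \<le> x ^ (2^k)" using False cX(2) by (intro power_increasing) (auto intro: less_imp_le)
      also have "\<dots> \<le> 1/c * \<Psi> x" using cX(3)[of x] False cX(1) by (simp add: field_simps)
      also have "\<dots> \<le> X ^ k + 1/c * \<Psi> x" using cX(2) by simp
      finally show ?thesis .
    qed
  qed
qed

text \<open>Constants for all exponents are fixed at once, since the growth function later takes an
  infimum over the exponent.\<close>

lemma power_dominated: "\<exists>A B. \<forall>k. 0 \<le> A k \<and> 0 \<le> B k \<and> (\<forall>x\<ge>0. x ^ k \<le> A k + B k * \<Psi> x)"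
proof -
  have "\<forall>k. \<exists>A. 0 \<le> A \<and> (\<exists>B. 0 \<le> B \<and> (\<forall>x\<ge>0. x ^ k \<le> A + B * \<Psi> x))"
    using power_le_ex by blast
  then obtain A where A: "\<And>k. 0 \<le> A k \<and> (\<exists>B. 0 \<le> B \<and> (\<forall>x\<ge>0. x ^ k \<le> A k + B * \<Psi> x))"
    by metis
  then obtain B where "\<And>k. 0 \<le> B k \<and> (\<forall>x\<ge>0. x ^ k \<le> A k + B k * \<Psi> x)" by metis
  with A show ?thesis by blast
qed

end

section \<open>The radial maximal inequality\<close>

text \<open>Cauchy's formula is applied to f multiplied by (1 - |z|^2) / (1 - cnj z w), a
  holomorphic factor equal to 1 at w = z. On the unit circle this factor turns the Cauchy kernel
  into the Poisson kernel.\<close>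

lemma Poisson_formula_holomorphic:
  fixes f :: "complex \<Rightarrow> complex"
  assumes contf: "continuous_on (cball 0 1) f" and holf: "f holomorphic_on ball 0 1" and z: "norm z < 1"
  shows "((\<lambda>s. f (cis s) * of_real ((1 - (norm z)\<^sup>2) / (norm (1 - cnj z * cis s))\<^sup>2)) 
            has_integral (2 * pi * f z)) {0..2*pi}"
proof -
  have nz: "1 - cnj z * w \<noteq> 0" if "w \<in> cball 0 1" for w
  proof
    assume "1 - cnj z * w = 0"
    then have "cnj z * w = 1" by simp
    then have "norm z * norm w = 1" by (metis complex_mod_cnj norm_mult norm_one)
    moreover have "norm z * norm w \<le> norm z * 1" using that by (intro mult_left_mono) auto
    ultimately show False using z by simp
  qed
  define g where "g w = f w * of_real (1 - (norm z)\<^sup>2) / (1 - cnj z * w)" for w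
  have "continuous_on (cball 0 1) g" unfolding g_def
    using nz by (intro continuous_intros contf) auto
  moreover have "g holomorphic_on ball 0 1" unfolding g_def
    using nz by (intro holomorphic_intros holf) auto
  ultimately have "((\<lambda>u. g u/(u-z)) has_contour_integral (2 * of_real pi * \<i> * g z)) (circlepath 0 1)"
    by (rule Cauchy_integral_circlepath) (use z in simp)
  then have *: "((\<lambda>t. g (cis t) / (cis t - z) * \<i> * cis t) has_integral (2 * of_real pi * \<i> * g z)) {0..2*pi}"
    unfolding circlepath_def by (subst (asm) has_contour_integral_part_circlepath_iff) auto
  have gz: "g z = f z"
  proof -
    have "1 - cnj z * z = of_real (1 - (norm z)\<^sup>2)"
      using complex_norm_square[of z] by (simp add: mult.commute)
    moreover have "1 - cnj z * z \<noteq> 0" using nz[of z] z by simp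
    ultimately show ?thesis by (simp add: g_def)
  qed
  have "((\<lambda>t. -\<i> * (g (cis t) / (cis t - z) * \<i> * cis t)) has_integral (-\<i> * (2 * of_real pi * \<i> * g z))) {0..2*pi}"
    by (rule has_integral_mult_right[OF *])
  moreover have "-\<i> * (g (cis t) / (cis t - z) * \<i> * cis t) = 
      f (cis t) * of_real ((1 - (norm z)\<^sup>2) / (norm (1 - cnj z * cis t))\<^sup>2)" for t
  proof -
    let ?w = "cis t" and ?d = "1 - cnj z * cis t"
    have d: "?d \<noteq> 0" using nz[of ?w] by simp
    have "?w - z = ?w * cnj ?d" by (simp add: algebra_simps cis_cnj cis_mult flip: cis_inverse)
    moreover have "of_real ((norm ?d)\<^sup>2) = ?d * cnj ?d" by (rule complex_norm_square)
    ultimately show ?thesis using d cis_neq_zero[of t]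
      by (simp add: g_def divide_simps) (simp add: algebra_simps)
  qed
  ultimately show ?thesis by (simp add: gz algebra_simps)
qed

definition Poisson_kernel :: "real \<Rightarrow> real \<Rightarrow> real" where
  "Poisson_kernel r x = (1 - r\<^sup>2) / (1 - 2 * r * cos x + r\<^sup>2)"

lemma Poisson_kernel_denom_pos:
  fixes r x :: real
  assumes "0 \<le> r" "r < 1"
  shows "1 - 2 * r * cos x + r\<^sup>2 > 0"
proof -
  have "(1 - r)\<^sup>2 \<le> 1 - 2 * r * cos x + r\<^sup>2"
    using assms cos_le_one[of x] mult_left_mono[of "cos x" 1 r] by (simp add: power2_eq_square algebra_simps)
  moreover have "(1-r)\<^sup>2 > 0" using assms by simp
  ultimately show ?thesis by linarith
qed

lemma Poisson_kernel_nonneg: "0 \<le> r \<Longrightarrow> r < 1 \<Longrightarrow> Poisson_kernel r x \<ge> 0"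
  unfolding Poisson_kernel_def
  by (intro divide_nonneg_pos Poisson_kernel_denom_pos) (simp_all add: power_le_one)

lemma Poisson_formula_centered:
  fixes f :: "complex \<Rightarrow> complex"
  assumes contf: "continuous_on (cball 0 1) f" and holf: "f holomorphic_on ball 0 1" and r: "0 \<le> r" "r < 1"
  shows "((\<lambda>x. f (cis (t + x)) * of_real (Poisson_kernel r x)) 
            has_integral (2 * pi * f (of_real r * cis t))) {-pi..pi}"
proof -
  \<comment> \<open>The rotation by t - pi and the evaluation point -r put the peak of the kernel at
    pi, so that shifting [0, 2 pi] by pi centres it at 0.\<close>
  let ?F = "\<lambda>w. f (w * cis (t - pi))"
  have "continuous_on (cball 0 1) ?F" 
    by (intro continuous_on_compose2[OF contf] continuous_intros) (auto simp: norm_mult)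
  moreover have "?F holomorphic_on ball 0 1"
    by (rule holomorphic_on_compose_gen[OF _ holf, unfolded o_def]) (auto simp: norm_mult intro!: holomorphic_intros)
  ultimately have "((\<lambda>s. ?F (cis s) * of_real ((1 - (norm (-of_real r::complex))\<^sup>2) / (norm (1 - cnj (-of_real r) * cis s))\<^sup>2)) 
            has_integral (2 * pi * ?F (-of_real r))) {0..2*pi}"
    by (rule Poisson_formula_holomorphic) (use r in simp)
  from has_integral_shift_real_ivl[OF this, of pi]
  have "((\<lambda>x. ?F (cis (x + pi)) * of_real ((1 - r\<^sup>2) / (norm (1 + of_real r * cis (x + pi)))\<^sup>2)) 
            has_integral (2 * pi * ?F (-of_real r))) {-pi..pi}" by simp
  moreover have "(norm (1 + of_real r * cis (x + pi)))\<^sup>2 = 1 - 2 * r * cos x + r\<^sup>2" for x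
  proof -
    have "(norm (1 + of_real r * cis (x + pi)))\<^sup>2 = (1 - r * cos x)\<^sup>2 + (r * sin x)\<^sup>2"
      unfolding cmod_power2 by simp
    also have "\<dots> = 1 - 2 * r * cos x + r\<^sup>2 * ((sin x)\<^sup>2 + (cos x)\<^sup>2)"
      unfolding power2_eq_square by algebra
    finally show ?thesis by simp
  qed
  moreover have "cis (x + pi) * cis (t - pi) = cis (t + x)" for x by (simp add: cis_mult add.commute)
  moreover have "-of_real r * cis (t - pi) = of_real r * cis t"
  proof -
    have "cis (t - pi) = - cis t" by (simp add: complex_eq_iff)
    then show ?thesis by simp
  qed
  ultimately show ?thesis by (simp add: Poisson_kernel_def)
qed

lemma Poisson_kernel_has_integral:
  assumes "0 \<le> r" "r < 1"
  shows "(Poisson_kernel r has_integral 2 * pi) {-pi..pi}"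
proof -
  have "((\<lambda>x. 1 * complex_of_real (Poisson_kernel r x)) has_integral of_real (2 * pi)) {-pi..pi}"
    using Poisson_formula_centered[of "\<lambda>_. 1" r 0] assms by simp
  then have "((\<lambda>x. Re (complex_of_real (Poisson_kernel r x))) has_integral Re (of_real (2 * pi))) {-pi..pi}"
    by (intro has_integral_Re) simp
  then show ?thesis by (simp del: of_real_mult)
qed

lemma Poisson_kernel_deriv:
  assumes "0 \<le> r" "r < 1"
  shows "(Poisson_kernel r has_real_derivative 
    - (1 - r\<^sup>2) * (2 * r * sin x) / (1 - 2 * r * cos x + r\<^sup>2)\<^sup>2) (at x within S)"
proof -
  note [simp] = Poisson_kernel_denom_pos[OF assms, of x, THEN less_imp_neq, symmetric]
  show ?thesis unfolding Poisson_kernel_def[abs_def]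
    by (rule derivative_eq_intros refl | simp)+ (simp add: power2_eq_square[of "1 - 2 * r * cos x + r\<^sup>2"] minus_divide_left left_diff_distrib)
qed

lemma continuous_Poisson_kernel [continuous_intros]:
  assumes "0 \<le> r" "r < 1"
  shows "continuous_on S (Poisson_kernel r)"
proof -
  have "1 - 2 * r * cos x + r\<^sup>2 \<noteq> 0" for x using Poisson_kernel_denom_pos[OF assms, of x] by linarith
  then show ?thesis unfolding Poisson_kernel_def[abs_def]
    by (intro continuous_on_divide continuous_on_add continuous_on_diff continuous_on_mult 
        continuous_on_const continuous_on_cos continuous_on_id) blast
qed

text \<open>The kernel decreases on \<open>[0, pi]\<close>, so integrating by parts against
  \<open>W x = c x - (U (t + x) - U (t - x)) \<ge> 0\<close> only produces terms of one sign.\<close>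

lemma Poisson_integral_le_of_averages:
  fixes u :: "real \<Rightarrow> real"
  assumes u: "continuous_on UNIV u" and r: "0 \<le> r" "r < 1"
    and av: "\<And>x. 0 < x \<Longrightarrow> x \<le> pi \<Longrightarrow> integral {t-x..t+x} u \<le> c * x"
  shows "integral {-pi..pi} (\<lambda>x. u (t + x) * Poisson_kernel r x) \<le> pi * c"
proof -
  let ?K = "Poisson_kernel r"
  let ?K' = "\<lambda>x. - (1 - r\<^sup>2) * (2 * r * sin x) / (1 - 2 * r * cos x + r\<^sup>2)\<^sup>2"
  have contu: "continuous_on S u" for S using u continuous_on_subset by blast
  \<comment> \<open>The interval is wider than [t - pi, t + pi], so U has two-sided derivatives on
    the latter.\<close>
  obtain U where U0: "\<And>x. x \<in> {t-4..t+4} \<Longrightarrow> (U has_vector_derivative u x) (at x within {t-4..t+4})"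
    using antiderivative_continuous[OF contu[of "{t-4..t+4}"]] by blast
  have U: "(U has_real_derivative u x) (at x)" if "x \<in> {t-pi..t+pi}" for x
  proof -
    have x: "x \<in> {t-4<..<t+4}" "x \<in> {t-4..t+4}" using that pi_less_4 by auto
    then have "at x within {t-4..t+4} = at x" by (intro at_within_interior) simp
    with U0[OF x(2)] show ?thesis 
      unfolding has_real_derivative_iff_has_vector_derivative by metis
  qed
  have int_u: "integral {t-x..t+x} u = U (t+x) - U (t-x)" if "0 \<le> x" "x \<le> pi" for x
  proof (rule integral_unique, rule fundamental_theorem_of_calculus)
    fix y assume "y \<in> {t-x..t+x}"
    then have "(U has_real_derivative u y) (at y)" using that by (intro U) auto
    then show "(U has_vector_derivative u y) (at y within {t-x..t+x})"
      by (simp add: has_field_derivative_at_within has_real_derivative_iff_has_vector_derivative[symmetric])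
  qed (use that in auto)
  define W where "W x = c * x - (U (t+x) - U (t-x))" for x
  have W_nonneg: "W x \<ge> 0" if "0 \<le> x" "x \<le> pi" for x
    using av[of x] int_u[of x] that by (cases "x = 0") (auto simp: W_def)
  have W_deriv: "(W has_real_derivative c - (u (t+x) + u (t-x))) (at x within {0..pi})" if "x \<in> {0..pi}" for x
  proof -
    have 1: "((\<lambda>x. U (t+x)) has_real_derivative u (t+x) * 1) (at x within {0..pi})"
      by (rule DERIV_chain2[where f = U]) (use that in \<open>auto intro!: U derivative_eq_intros\<close>)
    have 2: "((\<lambda>x. U (t-x)) has_real_derivative u (t-x) * (-1)) (at x within {0..pi})"
      by (rule DERIV_chain2[where f = U]) (use that in \<open>auto intro!: U derivative_eq_intros\<close>)
    show ?thesis unfolding W_def[abs_def]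
      by (rule derivative_eq_intros 1 2 refl)+ simp
  qed
  have KW: "((\<lambda>x. ?K' x * W x + ?K x * (c - (u (t+x) + u (t-x)))) has_integral (?K pi * W pi - ?K 0 * W 0)) {0..pi}"
  proof (rule fundamental_theorem_of_calculus)
    fix x assume x: "x \<in> {0..pi}"
    show "((\<lambda>x. ?K x * W x) has_vector_derivative (?K' x * W x + ?K x * (c - (u (t+x) + u (t-x))))) (at x within {0..pi})"
      unfolding has_real_derivative_iff_has_vector_derivative[symmetric]
      by (rule derivative_eq_intros W_deriv[OF x] Poisson_kernel_deriv[OF r] refl)+ (simp add: algebra_simps)
  qed simp
  have contK: "continuous_on S ?K" for S by (rule continuous_Poisson_kernel[OF r])
  have contut: "continuous_on S (\<lambda>x. u (t + x))" "continuous_on S (\<lambda>x. u (t - x))" for S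
    by (auto intro!: continuous_on_compose2[OF u] continuous_intros)
  have int1: "(\<lambda>x. ?K x * (c - (u (t+x) + u (t-x)))) integrable_on {0..pi}"
    by (intro integrable_continuous_interval continuous_intros contK contut)
  \<comment> \<open>\<open>W 0\<close> vanishes, which removes the boundary term at 0, where the
    kernel is largest.\<close>
  have "0 \<le> ?K pi * W pi - ?K 0 * W 0"
    using W_nonneg[of pi] Poisson_kernel_nonneg[OF r] by (simp add: W_def)
  also have "\<dots> \<le> integral {0..pi} (\<lambda>x. ?K x * (c - (u (t+x) + u (t-x))))"
  proof (rule has_integral_le[OF KW integrable_integral[OF int1]])
    fix x assume x: "x \<in> {0..pi}"
    have "0 \<le> (1 - r\<^sup>2) * (2 * r * sin x)"
      using r x sin_ge_zero[of x] by (intro mult_nonneg_nonneg) (auto simp: power_le_one)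
    then have "?K' x \<le> 0" by (intro divide_nonpos_nonneg) (simp_all only: mult_minus_left neg_le_0_iff_le zero_le_power2)
    then have "?K' x * W x \<le> 0" using W_nonneg[of x] x by (intro mult_nonpos_nonneg) (simp_all only: atLeastAtMost_iff)
    then show "?K' x * W x + ?K x * (c - (u (t+x) + u (t-x))) \<le> ?K x * (c - (u (t+x) + u (t-x)))" by simp
  qed
  finally have pos: "0 \<le> integral {0..pi} (\<lambda>x. ?K x * (c - (u (t+x) + u (t-x))))" .
  have sym: "integral {-pi..pi} (\<lambda>x. v x * ?K x) = integral {0..pi} (\<lambda>x. ?K x * (v x + v (-x)))"
    if v: "continuous_on UNIV v" for v :: "real \<Rightarrow> real"
  proof -
    have cv: "continuous_on S v" for S using v continuous_on_subset by blast
    have cv': "continuous_on S (\<lambda>x. v (-x))" for S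
      by (intro continuous_on_compose2[OF v] continuous_intros) auto
    have "integral {-pi..pi} (\<lambda>x. v x * ?K x) 
        = integral {-pi..0} (\<lambda>x. v x * ?K x) + integral {0..pi} (\<lambda>x. v x * ?K x)"
      by (rule Henstock_Kurzweil_Integration.integral_combine[symmetric]) (auto intro!: integrable_continuous_interval continuous_intros contK cv)
    also have "integral {-pi..0} (\<lambda>x. v x * ?K x) = integral {0..pi} (\<lambda>x. v (-x) * ?K x)"
      using Henstock_Kurzweil_Integration.integral_reflect_real[of pi 0 "\<lambda>x. v (-x) * ?K x"]
      by (simp add: Poisson_kernel_def)
    also have "\<dots> + integral {0..pi} (\<lambda>x. v x * ?K x) = integral {0..pi} (\<lambda>x. v (-x) * ?K x + v x * ?K x)"
      by (rule Henstock_Kurzweil_Integration.integral_add[symmetric]) (auto intro!: integrable_continuous_interval continuous_intros contK cv cv')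
    finally show ?thesis by (simp add: algebra_simps)
  qed
  \<comment> \<open>c is split as c/2 + c/2 so that \<open>sym\<close> also applies to the constant
    function c/2.\<close>
  have eq: "integral {0..pi} (\<lambda>x. ?K x * (c - (u (t+x) + u (t-x)))) 
      = integral {0..pi} (\<lambda>x. ?K x * (c/2 + c/2)) - integral {0..pi} (\<lambda>x. ?K x * (u (t+x) + u (t + - x)))"
  proof -
    have "(\<lambda>x. ?K x * (c/2 + c/2)) integrable_on {0..pi}" 
      by (intro integrable_continuous_interval continuous_intros contK)
    moreover have "(\<lambda>x. ?K x * (u (t+x) + u (t + - x))) integrable_on {0..pi}" 
      using contut by (intro integrable_continuous_interval continuous_intros contK) auto
    ultimately show ?thesis
      by (subst Henstock_Kurzweil_Integration.integral_diff[symmetric]) (auto simp: algebra_simps)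
  qed
  have "integral {0..pi} (\<lambda>x. ?K x * (c/2 + c/2)) = integral {-pi..pi} (\<lambda>x. c/2 * ?K x)"
    by (rule sym[symmetric, of "\<lambda>_. c/2"]) simp
  also have "\<dots> = pi * c" using integral_unique[OF Poisson_kernel_has_integral[OF r]] by simp
  finally have 1: "integral {0..pi} (\<lambda>x. ?K x * (c/2 + c/2)) = pi * c" .
  have 2: "integral {0..pi} (\<lambda>x. ?K x * (u (t+x) + u (t + - x))) = integral {-pi..pi} (\<lambda>x. u (t+x) * ?K x)"
    by (rule sym[symmetric, of "\<lambda>x. u (t + x)"]) (rule contut)
  show ?thesis using pos eq 1 2 by linarith
qed

text \<open>Vitali covering: disjoint intervals of half-length x and mass above c x have total
  half-length at most the whole mass over c, and their fivefold enlargements, of length 10 x, cover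
  the bad set. As x is at most pi, the disjoint intervals lie in [-pi, 3 pi]. The bad set is
  enclosed in a measurable T rather than shown to be measurable.\<close>

lemma maximal_inequality:
  fixes u :: "real \<Rightarrow> real"
  assumes u: "continuous_on UNIV u" "\<And>x. u x \<ge> 0" and c: "c > 0"
  shows "\<exists>T \<in> lmeasurable. {t. 0 < t \<and> t < 2*pi \<and> (\<exists>x>0. x \<le> pi \<and> integral {t-x..t+x} u > c * x)} \<subseteq> T
     \<and> measure lebesgue T \<le> 10 / c * integral {-pi..3*pi} u"
proof -
  define Bad where "Bad = {t. 0 < t \<and> t < 2*pi \<and> (\<exists>x>0. x \<le> pi \<and> integral {t-x..t+x} u > c * x)}"
  have contu: "continuous_on S u" for S using u(1) continuous_on_subset by blast
  have "\<forall>t\<in>Bad. \<exists>x. 0 < x \<and> x \<le> pi \<and> integral {t-x..t+x} u > c * x" by (auto simp: Bad_def)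
  then obtain x where x: "\<And>t. t \<in> Bad \<Longrightarrow> 0 < x t \<and> x t \<le> pi \<and> integral {t - x t..t + x t} u > c * x t" 
    by metis
  have "Bad \<subseteq> (\<Union>i\<in>Bad. cball i (x i))" using x by force
  then obtain C where C: "countable C" "C \<subseteq> Bad"
     "pairwise (\<lambda>i j. disjnt (cball i (x i)) (cball j (x j))) C" "Bad \<subseteq> (\<Union>i\<in>C. cball i (5 * x i))"
    by (rule Vitali_covering_lemma_cballs[where a = "\<lambda>i. i" and r = x and B = pi]) (simp_all add: x)
  \<comment> \<open>The bound for finite subfamilies, with a constant independent of the subfamily,
    passes to the countable union.\<close>
  have fin: "measure lebesgue (\<Union>i\<in>I. cball i (5 * x i)) \<le> 10 / c * integral {-pi..3*pi} u" 
    if I: "I \<subseteq> C" "finite I" for I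
  proof -
    have IB: "i \<in> Bad" if "i \<in> I" for i using that I C by auto
    have hi: "(u has_integral (\<Sum>i\<in>I. integral {i - x i..i + x i} u)) (\<Union>i\<in>I. {i - x i..i + x i})"
    proof (rule has_integral_UN[OF I(2)])
      show "(u has_integral integral {i - x i..i + x i} u) {i - x i..i + x i}" for i
        by (intro integrable_integral integrable_continuous_interval contu)
      show "pairwise (\<lambda>i i'. negligible ({i - x i..i + x i} \<inter> {i' - x i'..i' + x i'})) I"
      proof (rule pairwiseI)
        fix i j assume "i \<in> I" "j \<in> I" "i \<noteq> j"
        with C(3) I(1) have "disjnt (cball i (x i)) (cball j (x j))" by (auto simp: pairwise_def)
        then show "negligible ({i - x i..i + x i} \<inter> {j - x j..j + x j})"
          by (simp only: cball_eq_atLeastAtMost disjnt_def negligible_empty)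
      qed
    qed
    have "(\<Sum>i\<in>I. integral {i - x i..i + x i} u) \<le> integral {-pi..3*pi} u"
    proof (rule has_integral_subset_le[OF _ hi])
      show "(\<Union>i\<in>I. {i - x i..i + x i}) \<subseteq> {-pi..3*pi}"
        using x[OF IB] IB by (force simp: Bad_def)
      show "(u has_integral integral {-pi..3*pi} u) {-pi..3*pi}"
        by (intro integrable_integral integrable_continuous_interval contu)
    qed (use u in auto)
    moreover have "(\<Sum>i\<in>I. c * x i) \<le> (\<Sum>i\<in>I. integral {i - x i..i + x i} u)"
      using x[OF IB] by (intro sum_mono) force
    ultimately have "c * (\<Sum>i\<in>I. x i) \<le> integral {-pi..3*pi} u" by (simp add: sum_distrib_left)
    then have s: "(\<Sum>i\<in>I. x i) \<le> integral {-pi..3*pi} u / c" using c by (simp add: field_simps)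
    have "measure lebesgue (\<Union>i\<in>I. cball i (5 * x i)) \<le> (\<Sum>i\<in>I. measure lebesgue (cball i (5 * x i)))"
      by (rule measure_UNION_le[OF I(2)]) simp
    also have "\<dots> = (\<Sum>i\<in>I. 10 * x i)"
      using x[OF IB] by (intro sum.cong) (simp_all add: cball_eq_atLeastAtMost less_imp_le)
    also have "\<dots> \<le> 10 / c * integral {-pi..3*pi} u" using s by (simp flip: sum_distrib_left)
    finally show ?thesis .
  qed
  show ?thesis
  proof (intro bexI conjI)
    show "{t. 0 < t \<and> t < 2*pi \<and> (\<exists>x>0. x \<le> pi \<and> integral {t-x..t+x} u > c * x)} \<subseteq> (\<Union>i\<in>C. cball i (5 * x i))"
      using C(4) by (simp add: Bad_def)
    show "measure lebesgue (\<Union>i\<in>C. cball i (5 * x i)) \<le> 10 / c * integral {-pi..3*pi} u"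
      by (rule measure_UN_bound[OF C(1) _ fin]) auto
    show "(\<Union>i\<in>C. cball i (5 * x i)) \<in> lmeasurable"
      by (rule fmeasurable_UN_bound[OF C(1) _ fin]) auto
  qed
qed

text \<open>If no average around t is large, \<open>Poisson_integral_le_of_averages\<close> gives 2
  pi |f| \<le> pi c along the radius, contradicting |f| > c.\<close>

lemma radial_maximal_inequality:
  fixes f :: "complex \<Rightarrow> complex"
  assumes contf: "continuous_on (cball 0 1) f" and holf: "f holomorphic_on ball 0 1" and c: "c > 0"
  shows "\<exists>T \<in> lmeasurable. {t. 0 < t \<and> t < 2*pi \<and> (\<exists>r\<ge>0. r < 1 \<and> cmod (f (of_real r * cis t)) > c)} \<subseteq> T
     \<and> measure lebesgue T \<le> 10 / c * integral {-pi..3*pi} (\<lambda>t. cmod (f (cis t)))"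
proof -
  let ?u = "\<lambda>t. cmod (f (cis t))"
  have cu: "continuous_on UNIV ?u"
    by (intro continuous_intros continuous_on_compose2[OF contf]) auto
  have "{t. 0 < t \<and> t < 2*pi \<and> (\<exists>r\<ge>0. r < 1 \<and> cmod (f (of_real r * cis t)) > c)}
    \<subseteq> {t. 0 < t \<and> t < 2*pi \<and> (\<exists>x>0. x \<le> pi \<and> integral {t-x..t+x} ?u > c * x)}"
  proof clarify
    fix t r assume t: "0 < t" "t < 2*pi" and r: "0 \<le> r" "r < 1" and big: "cmod (f (of_real r * cis t)) > c"
    show "\<exists>x>0. x \<le> pi \<and> integral {t-x..t+x} ?u > c * x"
    proof (rule ccontr)
      assume "\<not> ?thesis"
      then have "\<And>x. 0 < x \<Longrightarrow> x \<le> pi \<Longrightarrow> integral {t-x..t+x} ?u \<le> c * x" by force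
      from Poisson_integral_le_of_averages[OF cu r this]
      have "integral {-pi..pi} (\<lambda>x. ?u (t + x) * Poisson_kernel r x) \<le> pi * c" .
      moreover have "cmod (2 * pi * f (of_real r * cis t)) \<le> integral {-pi..pi} (\<lambda>x. ?u (t + x) * Poisson_kernel r x)"
      proof -
        note P = Poisson_formula_centered[OF contf holf r, of t]
        show ?thesis unfolding integral_unique[OF P, symmetric]
        proof (rule integral_norm_bound_integral)
          show "(\<lambda>x. f (cis (t + x)) * complex_of_real (Poisson_kernel r x)) integrable_on {- pi..pi}"
            using P by blast
          show "(\<lambda>x. ?u (t + x) * Poisson_kernel r x) integrable_on {- pi..pi}"
            by (intro integrable_continuous_interval continuous_intros r continuous_on_compose2[OF cu]) auto
        qed (use Poisson_kernel_nonneg[OF r] in \<open>simp add: norm_mult\<close>)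
      qed
      moreover have "cmod (2 * pi * f (of_real r * cis t)) = 2 * pi * cmod (f (of_real r * cis t))"
        by (simp add: norm_mult)
      moreover have "pi * c < 2 * pi * cmod (f (of_real r * cis t))" using big c by simp
      ultimately show False by linarith
    qed
  qed
  moreover obtain T where "T \<in> lmeasurable" 
    "{t. 0 < t \<and> t < 2*pi \<and> (\<exists>x>0. x \<le> pi \<and> integral {t-x..t+x} ?u > c * x)} \<subseteq> T"
    "measure lebesgue T \<le> 10 / c * integral {-pi..3*pi} ?u"
    using maximal_inequality[OF cu norm_ge_zero c] by (elim bexE conjE)
  ultimately show ?thesis by (metis (no_types, lifting) subset_trans)
qed

section \<open>Fatou's theorem for the Hardy space of exponent 2\<close>

lemma cis_has_integral_0:
  fixes k :: real
  assumes k: "k \<in> \<int>" "k \<noteq> 0"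
  shows "((\<lambda>t. cis (k * t)) has_integral 0) {a..a+2*pi}"
proof -
  let ?F = "\<lambda>z. exp (\<i> * of_real k * z) / (\<i> * of_real k)"
  have F: "((\<lambda>t. ?F (of_real t)) has_vector_derivative cis (k * t)) (at t within S)" for t S
  proof (rule has_vector_derivative_real_field)
    have "((\<lambda>z. exp (\<i> * of_real k * z)) has_field_derivative exp (\<i> * of_real k * of_real t) * (\<i> * of_real k)) (at (of_real t))"
      by (auto intro!: derivative_eq_intros)
    from DERIV_cdivide[OF this, of "\<i> * of_real k"]
    show "(?F has_field_derivative cis (k * t)) (at (of_real t))"
      using k by (simp add: cis_conv_exp mult_ac)
  qed
  have "((\<lambda>t. cis (k * t)) has_integral (?F (of_real (a+2*pi)) - ?F (of_real a))) {a..a+2*pi}"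
    by (rule fundamental_theorem_of_calculus) (auto intro: F)
  moreover have "?F (of_real (a+2*pi)) = ?F (of_real a)"
  proof -
    have "exp (\<i> * of_real k * of_real (a+2*pi)) = cis (k * a + 2 * pi * k)"
      by (simp add: cis_conv_exp algebra_simps)
    also have "\<dots> = cis (k * a) * cis (2 * pi * k)" by (rule cis_mult[symmetric])
    also have "cis (2 * pi * k) = 1" using k(1) by (rule cis_multiple_2pi)
    finally show ?thesis by (simp add: cis_conv_exp mult_ac)
  qed
  ultimately show ?thesis by (simp only: diff_self)
qed

lemma Parseval_trigonometric_polynomial:
  fixes b :: "nat \<Rightarrow> complex"
  shows "((\<lambda>t. (cmod (\<Sum>n<N. b n * cis (real n * t)))\<^sup>2) has_integral (2 * pi * (\<Sum>n<N. (cmod (b n))\<^sup>2))) {a..a+2*pi}"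
proof (induction N)
  case (Suc N)
  let ?S = "\<lambda>t. \<Sum>n<N. b n * cis (real n * t)"
  have "((\<lambda>t. \<Sum>n<N. b n * cnj (b N) * cis ((real n - real N) * t)) has_integral (\<Sum>n<N. b n * cnj (b N) * 0)) {a..a+2*pi}"
    by (intro has_integral_sum has_integral_mult_right cis_has_integral_0) auto
  moreover have "(\<Sum>n<N. b n * cnj (b N) * cis ((real n - real N) * t)) = ?S t * cnj (b N * cis (real N * t))" for t
  proof -
    have "cis ((real n - real N) * t) = cis (real n * t) * cnj (cis (real N * t))" for n
      unfolding cis_cnj cis_mult by (simp add: left_diff_distrib)
    then show ?thesis by (simp add: sum_distrib_right sum_distrib_left mult_ac)
  qed
  ultimately have "((\<lambda>t. ?S t * cnj (b N * cis (real N * t))) has_integral 0) {a..a+2*pi}" by simp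
  then have "((\<lambda>t. 2 * Re (?S t * cnj (b N * cis (real N * t)))) has_integral (2 * Re 0)) {a..a+2*pi}"
    by (intro has_integral_mult_right has_integral_Re)
  moreover have "((\<lambda>t. (cmod (b N))\<^sup>2) has_integral (2 * pi * (cmod (b N))\<^sup>2)) {a..a+2*pi}"
    using has_integral_const_real[of "(cmod (b N))\<^sup>2" a "a+2*pi"] by simp
  ultimately have "((\<lambda>t. (cmod (?S t))\<^sup>2 + (2 * Re (?S t * cnj (b N * cis (real N * t))) + (cmod (b N))\<^sup>2)) 
      has_integral (2 * pi * (\<Sum>n<N. (cmod (b n))\<^sup>2) + (2 * Re 0 + 2 * pi * (cmod (b N))\<^sup>2))) {a..a+2*pi}"
    by (intro has_integral_add Suc.IH)
  moreover have "(cmod (?S t))\<^sup>2 + (2 * Re (?S t * cnj (b N * cis (real N * t))) + (cmod (b N))\<^sup>2) 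
      = (cmod (\<Sum>n<Suc N. b n * cis (real n * t)))\<^sup>2" for t
  proof -
    have "(cmod (x + y))\<^sup>2 = (cmod x)\<^sup>2 + (2 * Re (x * cnj y) + (cmod y)\<^sup>2)" for x y :: complex
      unfolding cmod_power2 by (simp add: power2_eq_square algebra_simps)
    from this[of "?S t" "b N * cis (real N * t)"] show ?thesis by (simp add: norm_mult)
  qed
  ultimately show ?case by (simp add: algebra_simps)
qed simp

text \<open>At radius s < 1 the series converges absolutely, so the partial sums are uniformly
  bounded and the identity for polynomials passes to the limit by dominated convergence.\<close>

lemma Parseval_power_series:
  assumes f: "\<And>z. cmod z < 1 \<Longrightarrow> (\<lambda>n. c n * z ^ n) sums f z" and s: "0 \<le> s" "s < 1"
  shows "(\<lambda>n. (cmod (c n))\<^sup>2 * s ^ (2 * n)) sums (integral {a..a+2*pi} (\<lambda>t. (cmod (f (of_real s * cis t)))\<^sup>2) / (2 * pi))"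
proof -
  define S where "S N t = (\<Sum>n<N. (c n * of_real s ^ n) * cis (real n * t))" for N t
  have "summable (\<lambda>n. c n * (of_real ((1+s)/2)) ^ n)"
    using s by (intro sums_summable[OF f]) (simp only: norm_of_real, simp)
  then have summ: "summable (\<lambda>n. norm (c n * (of_real s) ^ n))"
    by (rule powser_insidea) (use s in \<open>simp only: norm_of_real, simp\<close>)
  define M where "M = (\<Sum>n. norm (c n * (of_real s) ^ n))"
  have S_le: "cmod (S N t) \<le> M" for N t
  proof -
    have "cmod (S N t) \<le> (\<Sum>n<N. norm (c n * (of_real s) ^ n))"
      unfolding S_def by (rule sum_norm_le) (simp add: norm_mult)
    also have "\<dots> \<le> M" unfolding M_def by (rule sum_le_suminf[OF summ]) auto
    finally show ?thesis .
  qed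
  have S_lim: "(\<lambda>N. S N t) \<longlonglongrightarrow> f (of_real s * cis t)" for t
  proof -
    have "(\<lambda>n. c n * (of_real s * cis t) ^ n) sums f (of_real s * cis t)"
      by (rule f) (use s in \<open>simp add: norm_mult\<close>)
    then show ?thesis unfolding sums_def S_def
      by (simp add: power_mult_distrib Complex.DeMoivre mult.assoc)
  qed
  have S_int: "((\<lambda>t. (cmod (S N t))\<^sup>2) has_integral (2 * pi * (\<Sum>n<N. (cmod (c n))\<^sup>2 * s ^ (2 * n)))) {a..a+2*pi}" for N
  proof -
    have "(cmod (c n * of_real s ^ n))\<^sup>2 = (cmod (c n))\<^sup>2 * s ^ (2 * n)" for n
      using s by (simp add: norm_mult norm_power power_mult_distrib power_mult[symmetric] mult.commute)
    then show ?thesis using Parseval_trigonometric_polynomial[where b = "\<lambda>n. c n * of_real s ^ n" and N = N and a = a] by (simp add: S_def)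
  qed
  have "(\<lambda>N. integral {a..a+2*pi} (\<lambda>t. (cmod (S N t))\<^sup>2)) \<longlonglongrightarrow> integral {a..a+2*pi} (\<lambda>t. (cmod (f (of_real s * cis t)))\<^sup>2)"
  proof (rule dominated_convergence(2))
    show "(\<lambda>t. (cmod (S N t))\<^sup>2) integrable_on {a..a+2*pi}" for N using S_int by blast
    show "(\<lambda>_. M\<^sup>2) integrable_on {a..a+2*pi}" by (rule integrable_const_ivl)
    show "norm ((cmod (S N t))\<^sup>2) \<le> M\<^sup>2" for N t using S_le[of N t] by (simp add: power_mono)
    show "(\<lambda>N. (cmod (S N t))\<^sup>2) \<longlonglongrightarrow> (cmod (f (of_real s * cis t)))\<^sup>2" for t
      by (intro tendsto_intros S_lim)
  qed
  then have "(\<lambda>N. 2 * pi * (\<Sum>n<N. (cmod (c n))\<^sup>2 * s ^ (2 * n)) / (2 * pi)) 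
      \<longlonglongrightarrow> integral {a..a+2*pi} (\<lambda>t. (cmod (f (of_real s * cis t)))\<^sup>2) / (2 * pi)"
    unfolding integral_unique[OF S_int] by (intro tendsto_intros) auto
  then show ?thesis unfolding sums_def by simp
qed

text \<open>The square of e is holomorphic with modulus |e|^2, so the weak-type bound for it becomes
  one in mean square. Continuity up to the circle is obtained by dilating with s < 1; the
  exceptional sets are then exhausted as s tends to 1. The factor 20 is twice 10 because [-pi, 3 pi]
  consists of two periods.\<close>

lemma radial_maximal_inequality_L2:
  assumes hol: "e holomorphic_on ball 0 1" and c: "c > 0"
    and K: "\<And>s a. 0 \<le> s \<Longrightarrow> s < 1 \<Longrightarrow> integral {a..a+2*pi} (\<lambda>t. (cmod (e (of_real s * cis t)))\<^sup>2) \<le> K"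
  shows "\<exists>T\<in>lmeasurable. {t. 0 < t \<and> t < 2*pi \<and> (\<exists>r\<ge>0. r < 1 \<and> (cmod (e (of_real r * cis t)))\<^sup>2 > c)} \<subseteq> T
     \<and> measure lebesgue T \<le> 20 / c * K"
proof -
  define B where "B s = {t. 0 < t \<and> t < 2*pi \<and> (\<exists>r\<ge>0. r < 1 \<and> (cmod (e (of_real (s * r) * cis t)))\<^sup>2 > c)}" for s :: real
  have cont_e: "continuous_on (ball 0 1) e" using hol by (rule holomorphic_on_imp_continuous_on)
  have B: "B s \<in> lmeasurable \<and> measure lebesgue (B s) \<le> 20 / c * K" if s: "0 \<le> s" "s < 1" for s
  proof -
    let ?E = "\<lambda>z. (e (of_real s * z))\<^sup>2"
    have sub: "(\<lambda>z. of_real s * z) ` cball 0 1 \<subseteq> ball (0::complex) 1"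
    proof clarsimp
      fix z :: complex assume "cmod z \<le> 1"
      then have "\<bar>s\<bar> * cmod z \<le> s * 1" using s by (intro mult_mono) auto
      then show "cmod (of_real s * z) < 1" using s by (simp add: norm_mult)
    qed
    have sub': "(\<lambda>z. of_real s * z) ` ball 0 1 \<subseteq> ball (0::complex) 1" using sub by (meson ball_subset_cball image_mono order_trans)
    have cE: "continuous_on (cball 0 1) ?E" 
      by (intro continuous_intros continuous_on_compose2[OF cont_e _ sub])
    have "(\<lambda>z. e (of_real s * z)) holomorphic_on ball 0 1"
      by (rule holomorphic_on_compose_gen[OF _ hol sub', unfolded o_def]) (intro holomorphic_intros)
    then have hE: "?E holomorphic_on ball 0 1" by (intro holomorphic_intros)
    obtain T where T: "T \<in> lmeasurable" "{t. 0 < t \<and> t < 2*pi \<and> (\<exists>r\<ge>0. r < 1 \<and> cmod (?E (of_real r * cis t)) > c)} \<subseteq> T"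
      "measure lebesgue T \<le> 10 / c * integral {-pi..3*pi} (\<lambda>t. cmod (?E (cis t)))"
      using radial_maximal_inequality[OF cE hE c] by (elim bexE conjE)
    \<comment> \<open>A union of open sets over uncountably many r is still open, hence
      measurable.\<close>
    have "B s = (\<Union>r\<in>{0..<1}. {0<..<2*pi} \<inter> {t. (cmod (e (of_real (s * r) * cis t)))\<^sup>2 > c})"
      by (auto simp: B_def)
    moreover have "open ({0<..<2*pi} \<inter> {t. (cmod (e (of_real (s * r) * cis t)))\<^sup>2 > c})" if r: "r \<in> {0..<1}" for r
    proof -
      have "s * r < 1" using s r mult_strict_mono'[of s 1 r 1] by simp
      then have "continuous_on UNIV (\<lambda>t. e (of_real (s * r) * cis t))"
        using s r by (intro continuous_on_compose2[OF cont_e] continuous_intros) (auto simp: norm_mult)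
      then show ?thesis by (intro open_Int open_Collect_less continuous_intros) auto
    qed
    ultimately have "open (B s)" by (simp only:) (intro open_UN ballI)
    moreover have "bounded (B s)" by (rule bounded_subset[of "{0..2*pi}"]) (auto simp: B_def)
    ultimately have Bm: "B s \<in> lmeasurable" by (simp add: lmeasurable_open)
    have cont: "continuous_on UNIV (\<lambda>t. cmod (?E (cis t)))"
      by (intro continuous_intros continuous_on_compose2[OF cE]) auto
    have intK: "integral {a..a+2*pi} (\<lambda>t. cmod (?E (cis t))) \<le> K" for a using K[OF s, of a] by (simp add: norm_power)
    have "integral {-pi..3*pi} (\<lambda>t. cmod (?E (cis t))) 
        = integral {-pi..pi} (\<lambda>t. cmod (?E (cis t))) + integral {pi..3*pi} (\<lambda>t. cmod (?E (cis t)))"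
      by (rule Henstock_Kurzweil_Integration.integral_combine[symmetric]) 
        (auto intro!: integrable_continuous_interval continuous_on_subset[OF cont])
    also have "\<dots> \<le> 2 * K" using intK[of "-pi"] intK[of pi] by simp
    finally have "10 / c * integral {-pi..3*pi} (\<lambda>t. cmod (?E (cis t))) \<le> 10 / c * (2 * K)"
      using c by (intro mult_left_mono) auto
    moreover have "B s \<subseteq> T" using T(2) unfolding B_def norm_power by (simp add: mult.assoc)
    then have "measure lebesgue (B s) \<le> measure lebesgue T"
      using Bm T(1) by (intro measure_mono_fmeasurable) auto
    ultimately show ?thesis using T(3) Bm by simp
  qed
  define q where "q n = 1 - inverse (real (Suc n))" for n
  have q: "0 \<le> q n" "q n < 1" for n by (simp_all add: q_def field_simps)
  have B_mono: "B s \<subseteq> B s'" if "0 \<le> s" "s \<le> s'" "s' < 1" "0 < s'" for s s'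
  proof
    fix t assume "t \<in> B s"
    then obtain r where r: "0 < t" "t < 2*pi" "r \<ge> 0" "r < 1" "(cmod (e (of_real (s * r) * cis t)))\<^sup>2 > c"
      by (auto simp: B_def)
    have "s / s' * r \<le> 1 * r" using that r by (intro mult_right_mono) auto
    then have "s / s' * r < 1" using r by linarith
    moreover have "s' * (s / s' * r) = s * r" using that by simp
    ultimately show "t \<in> B s'" unfolding B_def using r that 
      by (intro CollectI conjI exI[of _ "s / s' * r"]) (simp_all only:, auto)
  qed
  have qmono: "q i \<le> q n" if "i \<le> n" for i n using that by (simp add: q_def field_simps)
  \<comment> \<open>The shift to \<open>Suc\<close> avoids q 0 = 0, which \<open>B_mono\<close>
    excludes as the larger radius.\<close>
  have un: "(\<Union>i\<le>n. B (q (Suc i))) = B (q (Suc n))" for n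
  proof -
    have "B (q (Suc i)) \<subseteq> B (q (Suc n))" if "i \<le> n" for i
    proof (rule B_mono)
      show "0 < q (Suc n)" by (simp add: q_def field_simps)
    qed (use q qmono that in auto)
    then show ?thesis by blast
  qed
  show ?thesis
  proof (intro bexI conjI)
    show "{t. 0 < t \<and> t < 2*pi \<and> (\<exists>r\<ge>0. r < 1 \<and> (cmod (e (of_real r * cis t)))\<^sup>2 > c)} \<subseteq> (\<Union>i. B (q (Suc i)))"
    proof clarify
      fix t r assume t: "0 < t" "t < 2*pi" and r: "0 \<le> r" "r < (1::real)" and big: "(cmod (e (of_real r * cis t)))\<^sup>2 > c"
      have "(\<lambda>n. q (Suc n)) \<longlonglongrightarrow> 1 - 0" unfolding q_def
        by (intro tendsto_intros LIMSEQ_Suc[OF LIMSEQ_inverse_real_of_nat])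
      then have "eventually (\<lambda>n. q (Suc n) > r) sequentially" using r by (intro order_tendstoD(1)[of _ "1-0"]) auto
      then obtain n where n: "q (Suc n) > r" by (auto simp: eventually_sequentially)
      have "t \<in> B (q (Suc n))" unfolding B_def
      proof (intro CollectI conjI exI[of _ "r / q (Suc n)"])
        have "q (Suc n) * (r / q (Suc n)) = r" using n r by simp
        then show "c < (cmod (e (of_real (q (Suc n) * (r / q (Suc n))) * cis t)))\<^sup>2" using big by simp
      qed (use t r n in auto)
      then show "t \<in> (\<Union>i. B (q (Suc i)))" by blast
    qed
    show "(\<Union>i. B (q (Suc i))) \<in> lmeasurable"
      by (rule fmeasurable_countable_Union[where B = "20 / c * K"]) (use B[OF q] un in auto)
    show "measure lebesgue (\<Union>i. B (q (Suc i))) \<le> 20 / c * K"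
      by (rule measure_countable_Union_le) (use B[OF q] un in auto)
  qed
qed

text \<open>Parseval bounds each finite partial sum uniformly in s < 1; letting s tend to 1 in the
  finite sum removes the damping factor.\<close>

lemma H2_coefficients_summable:
  assumes f: "\<And>z. cmod z < 1 \<Longrightarrow> (\<lambda>n. c n * z ^ n) sums f z"
    and K: "\<And>s. 0 \<le> s \<Longrightarrow> s < 1 \<Longrightarrow> integral {0..2*pi} (\<lambda>t. (cmod (f (of_real s * cis t)))\<^sup>2) \<le> K"
  shows "summable (\<lambda>n. (cmod (c n))\<^sup>2)"
proof (rule summableI_nonneg_bounded)
  fix N
  have le: "(\<Sum>n<N. (cmod (c n))\<^sup>2 * s ^ (2 * n)) \<le> K / (2*pi)" if s: "0 \<le> s" "s < 1" for s
  proof -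
    note P = Parseval_power_series[OF f s, of 0, simplified]
    have "(\<Sum>n<N. (cmod (c n))\<^sup>2 * s ^ (2 * n)) \<le> (\<Sum>n. (cmod (c n))\<^sup>2 * s ^ (2 * n))"
      using s by (intro sum_le_suminf sums_summable[OF P]) auto
    also have "\<dots> = integral {0..2*pi} (\<lambda>t. (cmod (f (of_real s * cis t)))\<^sup>2) / (2 * pi)"
      using sums_unique[OF P] by simp
    also have "\<dots> \<le> K / (2*pi)" using K[OF s] by (intro divide_right_mono) auto
    finally show ?thesis .
  qed
  have "((\<lambda>s. \<Sum>n<N. (cmod (c n))\<^sup>2 * s ^ (2 * n)) \<longlongrightarrow> (\<Sum>n<N. (cmod (c n))\<^sup>2 * 1 ^ (2 * n))) (at_left (1::real))"
    by (intro tendsto_intros)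
  then have "(\<Sum>n<N. (cmod (c n))\<^sup>2 * 1 ^ (2 * n)) \<le> K / (2*pi)"
  proof (rule tendsto_upperbound)
    show "\<forall>\<^sub>F s in at_left 1. (\<Sum>n<N. (cmod (c n))\<^sup>2 * s ^ (2 * n)) \<le> K / (2*pi)"
      using eventually_at_left_real[of 0 "1::real"] by (auto elim!: eventually_mono intro: le)
  qed auto
  then show "(\<Sum>n<N. (cmod (c n))\<^sup>2) \<le> K / (2*pi)" by simp
qed auto

text \<open>The dilation of f by \<rho> < 1 is continuous across the circle, so the radial
  oscillation of f is controlled by the maximal function of the difference e. The integral of |e|^2
  over each circle is at most 2 pi D(\<rho>), which tends to 0; hence the directions in which the
  oscillation is not eventually below 3 \<epsilon> lie in sets of arbitrarily small measure.\<close>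

lemma Fatou_radial_limits:
  assumes hol: "f holomorphic_on ball 0 1"
    and K: "\<And>s. 0 \<le> s \<Longrightarrow> s < 1 \<Longrightarrow> integral {0..2*pi} (\<lambda>t. (cmod (f (of_real s * cis t)))\<^sup>2) \<le> K"
  shows "AE t in circ. \<exists>l. ((\<lambda>r. f (of_real r * cis t)) \<longlongrightarrow> l) (at_left 1)"
proof -
  define c where "c n = (deriv ^^ n) f 0 / fact n" for n
  have f: "(\<lambda>n. c n * z ^ n) sums f z" if "cmod z < 1" for z
    using holomorphic_power_series[OF hol, of z] that by (simp add: c_def)
  have summ: "summable (\<lambda>n. (cmod (c n))\<^sup>2)" by (rule H2_coefficients_summable[OF f K])
  define D where "D \<rho> = (\<Sum>n. (cmod (c n))\<^sup>2 * (1 - \<rho> ^ n)\<^sup>2)" for \<rho> :: real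
  have Dterm: "(cmod (c n))\<^sup>2 * (1 - \<rho> ^ n)\<^sup>2 \<le> (cmod (c n))\<^sup>2" if "0 \<le> \<rho>" "\<rho> \<le> 1" for n \<rho>
  proof -
    have "(1 - \<rho> ^ n)\<^sup>2 \<le> 1\<^sup>2" using that by (intro power_mono) (auto simp: power_le_one)
    from mult_left_mono[OF this, of "(cmod (c n))\<^sup>2"] show ?thesis by simp
  qed
  have Dsumm: "summable (\<lambda>n. (cmod (c n))\<^sup>2 * (1 - \<rho> ^ n)\<^sup>2)" if "0 \<le> \<rho>" "\<rho> \<le> 1" for \<rho> :: real
    by (rule summable_comparison_test'[OF summ, of 0]) (use Dterm[OF that] in simp)
  \<comment> \<open>Tannery's theorem: each summand tends to 0 as \<rho> tends to 1 and is dominated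
    by |c n|^2.\<close>
  have "(D \<longlongrightarrow> (\<Sum>n. (cmod (c n))\<^sup>2 * (1 - 1 ^ n)\<^sup>2)) (at_left 1)"
    unfolding D_def
  proof (rule conjunct2[OF conjunct2[OF tannerys_theorem]])
    show "((\<lambda>\<rho>. (cmod (c k))\<^sup>2 * (1 - \<rho> ^ k)\<^sup>2) \<longlongrightarrow> (cmod (c k))\<^sup>2 * (1 - 1 ^ k)\<^sup>2) (at_left (1::real))" for k
      by (intro tendsto_intros)
    have "eventually (\<lambda>\<rho>. \<rho> \<in> {0<..<1}) (at_left (1::real))" by (rule eventually_at_left_real) simp
    then show "\<forall>\<^sub>F (k, \<rho>) in sequentially \<times>\<^sub>F at_left 1. norm ((cmod (c k))\<^sup>2 * (1 - \<rho> ^ k)\<^sup>2) \<le> (cmod (c k))\<^sup>2"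
      unfolding eventually_prod_filter
      by (intro exI[of _ "\<lambda>_. True"] exI[of _ "\<lambda>\<rho>. \<rho> \<in> {0<..<1}"]) (auto intro!: Dterm simp: abs_mult)
  qed (use summ in auto)
  then have D0: "(D \<longlongrightarrow> 0) (at_left 1)" by simp
  define N where "N \<epsilon> = {t. 0 < t \<and> t < 2*pi \<and> \<not> (\<exists>r0<1. \<forall>r r'. r0 < r \<and> r < 1 \<and> r0 < r' \<and> r' < 1 \<longrightarrow> 
       dist (f (of_real r * cis t)) (f (of_real r' * cis t)) < 3 * \<epsilon>)}" for \<epsilon> :: real
  have negl: "negligible (N \<epsilon>)" if \<epsilon>: "\<epsilon> > 0" for \<epsilon>
    unfolding negligible_outer_le
  proof (intro allI impI)
    fix \<delta> :: real assume \<delta>: "\<delta> > 0"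
    \<comment> \<open>The threshold is chosen so that the maximal bound, 20 / \<epsilon>^2 times 2
      pi D(\<rho>), becomes at most \<delta>.\<close>
    have "eventually (\<lambda>\<rho>. D \<rho> < \<delta> * \<epsilon>\<^sup>2 / (40 * pi)) (at_left 1)"
      by (rule order_tendstoD(2)[OF D0]) (use \<delta> \<epsilon> in simp)
    moreover have "eventually (\<lambda>\<rho>. \<rho> \<in> {0<..<1}) (at_left (1::real))" by (rule eventually_at_left_real) simp
    ultimately have "eventually (\<lambda>\<rho>. D \<rho> < \<delta> * \<epsilon>\<^sup>2 / (40 * pi) \<and> \<rho> \<in> {0<..<1}) (at_left 1)" by (rule eventually_conj)
    then obtain \<rho> where \<rho>: "D \<rho> < \<delta> * \<epsilon>\<^sup>2 / (40 * pi)" "0 < \<rho>" "\<rho> < 1"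
      using eventually_happens'[of "at_left (1::real)"] by fastforce
    define e where "e z = f z - f (of_real \<rho> * z)" for z
    have sub: "(\<lambda>z. of_real \<rho> * z) ` ball 0 1 \<subseteq> ball (0::complex) 1"
    proof clarsimp
      fix z :: complex assume "cmod z < 1"
      then have "\<bar>\<rho>\<bar> * cmod z < 1 * 1" using \<rho> by (intro mult_strict_mono) auto
      then show "cmod (of_real \<rho> * z) < 1" by (simp add: norm_mult)
    qed
    have "(\<lambda>z. f (of_real \<rho> * z)) holomorphic_on ball 0 1"
      by (rule holomorphic_on_compose_gen[OF _ hol sub, unfolded o_def]) (intro holomorphic_intros)
    then have hole: "e holomorphic_on ball 0 1" unfolding e_def by (intro holomorphic_intros hol)
    have e: "(\<lambda>n. (c n * of_real (1 - \<rho> ^ n)) * z ^ n) sums e z" if "cmod z < 1" for z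
    proof -
      have "of_real \<rho> * z \<in> ball 0 1" by (rule subsetD[OF sub], rule imageI) (use that in simp)
      then have "cmod (of_real \<rho> * z) < 1" by simp
      from sums_diff[OF f[OF that] f[OF this]] show ?thesis by (simp add: e_def algebra_simps power_mult_distrib)
    qed
    have Ke: "integral {a..a+2*pi} (\<lambda>t. (cmod (e (of_real s * cis t)))\<^sup>2) \<le> 2 * pi * D \<rho>" if s: "0 \<le> s" "s < 1" for s a
    proof -
      note P = Parseval_power_series[OF e s, of a]
      have "integral {a..a+2*pi} (\<lambda>t. (cmod (e (of_real s * cis t)))\<^sup>2) / (2 * pi) 
          = (\<Sum>n. (cmod (c n * of_real (1 - \<rho> ^ n)))\<^sup>2 * s ^ (2 * n))"
        by (rule sums_unique[OF P])
      also have "\<dots> \<le> D \<rho>" unfolding D_def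
      proof (rule suminf_le)
        fix n
        have "(cmod (c n * of_real (1 - \<rho> ^ n)))\<^sup>2 * s ^ (2 * n) \<le> (cmod (c n * of_real (1 - \<rho> ^ n)))\<^sup>2 * 1"
          using s by (intro mult_left_mono power_le_one) auto
        then show "(cmod (c n * of_real (1 - \<rho> ^ n)))\<^sup>2 * s ^ (2 * n) \<le> (cmod (c n))\<^sup>2 * (1 - \<rho> ^ n)\<^sup>2"
          unfolding norm_mult norm_of_real power_mult_distrib power2_abs by simp
      qed (use P Dsumm \<rho> in \<open>auto intro: sums_summable\<close>)
      finally show ?thesis by (simp add: field_simps)
    qed
    obtain T where T: "T \<in> lmeasurable" "{t. 0 < t \<and> t < 2*pi \<and> (\<exists>r\<ge>0. r < 1 \<and> (cmod (e (of_real r * cis t)))\<^sup>2 > \<epsilon>\<^sup>2)} \<subseteq> T"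
      "measure lebesgue T \<le> 20 / \<epsilon>\<^sup>2 * (2 * pi * D \<rho>)"
      using radial_maximal_inequality_L2[OF hole _ Ke, of "\<epsilon>\<^sup>2"] \<epsilon> by (auto elim!: bexE conjE)
    have "N \<epsilon> \<subseteq> {t. 0 < t \<and> t < 2*pi \<and> (\<exists>r\<ge>0. r < 1 \<and> (cmod (e (of_real r * cis t)))\<^sup>2 > \<epsilon>\<^sup>2)}"
    proof (rule subsetI, rule ccontr)
      fix t assume tN: "t \<in> N \<epsilon>" and "t \<notin> {t. 0 < t \<and> t < 2*pi \<and> (\<exists>r\<ge>0. r < 1 \<and> (cmod (e (of_real r * cis t)))\<^sup>2 > \<epsilon>\<^sup>2)}"
      then have small2: "(cmod (e (of_real r * cis t)))\<^sup>2 \<le> \<epsilon>\<^sup>2" if "0 \<le> r" "r < 1" for r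
        using that by (force simp: N_def)
      have small: "dist (f (of_real r * cis t)) (f (of_real \<rho> * (of_real r * cis t))) \<le> \<epsilon>" if "0 \<le> r" "r < 1" for r
        using power2_le_imp_le[OF small2[OF that]] \<epsilon> by (simp add: e_def dist_norm)
      have "isCont f (of_real \<rho> * (of_real 1 * cis t))"
        using hol \<rho> by (intro field_differentiable_imp_continuous_at holomorphic_on_imp_differentiable_at[of _ "ball 0 1"]) (auto simp: norm_mult)
      then have "((\<lambda>r. f (of_real \<rho> * (of_real r * cis t))) \<longlongrightarrow> f (of_real \<rho> * (of_real 1 * cis t))) (at_left (1::real))"
        by (rule isCont_tendsto_compose) (intro tendsto_intros)
      then have "eventually (\<lambda>r. dist (f (of_real \<rho> * (of_real r * cis t))) (f (of_real \<rho> * (of_real 1 * cis t))) < \<epsilon> / 2) (at_left (1::real))"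
        using \<epsilon> by (intro tendstoD) auto
      then obtain r0 where r0: "r0 < 1" "\<And>r. r0 < r \<Longrightarrow> r < 1 \<Longrightarrow> 
          dist (f (of_real \<rho> * (of_real r * cis t))) (f (of_real \<rho> * (of_real 1 * cis t))) < \<epsilon> / 2"
        unfolding eventually_at_left_field by blast
      \<comment> \<open>Two passages between f and its dilation cost at most \<epsilon> each, and
        two between the dilation and its boundary value less than \<epsilon>/2 each.\<close>
      have "\<exists>r0<1. \<forall>r r'. r0 < r \<and> r < 1 \<and> r0 < r' \<and> r' < 1 \<longrightarrow> 
          dist (f (of_real r * cis t)) (f (of_real r' * cis t)) < 3 * \<epsilon>"
      proof (intro exI[of _ "max 0 r0"] conjI allI impI)
        fix r r' assume "max 0 r0 < r \<and> r < 1 \<and> max 0 r0 < r' \<and> r' < 1"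
        then have r: "0 \<le> r" "r0 < r" "r < 1" "0 \<le> r'" "r0 < r'" "r' < 1" by auto
        show "dist (f (of_real r * cis t)) (f (of_real r' * cis t)) < 3 * \<epsilon>"
          using small[OF r(1,3)] small[OF r(4,6)] r0(2)[OF r(2,3)] r0(2)[OF r(5,6)]
          by metric
      qed (use r0 in auto)
      with tN show False unfolding N_def mem_Collect_eq by blast
    qed
    moreover have "20 / \<epsilon>\<^sup>2 * (2 * pi * D \<rho>) \<le> \<delta>"
      using \<rho>(1) \<epsilon> by (simp add: field_simps)
    ultimately show "\<exists>T. N \<epsilon> \<subseteq> T \<and> T \<in> lmeasurable \<and> measure lebesgue T \<le> \<delta>"
      using T by (meson order_trans)
  qed
  have "negligible (\<Union>k. N (inverse (real (Suc k))))"
    by (intro negligible_countable_Union) (auto intro!: negl)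
  then have "AE t in lebesgue. t \<notin> (\<Union>k. N (inverse (real (Suc k))))" 
    by (intro AE_not_in) (simp add: negligible_iff_null_sets)
  then have "AE t in circ. t \<notin> (\<Union>k. N (inverse (real (Suc k))))"
    unfolding circ_def by (subst AE_restrict_space_iff) (auto elim!: eventually_mono)
  with AE_circ_interior show ?thesis
  proof eventually_elim
    case (elim t)
    let ?g = "\<lambda>r. f (of_real r * cis t)"
    have "cauchy_filter (filtermap ?g (at_left 1))"
      unfolding cauchy_filter_metric_filtermap
    proof (intro allI impI)
      fix \<eta> :: real assume "\<eta> > 0"
      then obtain k where k: "inverse (real (Suc k)) < \<eta> / 3" using reals_Archimedean[of "\<eta>/3"] by auto
      from elim(2) have "t \<notin> N (inverse (real (Suc k)))" by blast
      then obtain r0 where r0: "r0 < 1" "\<forall>r r'. r0 < r \<and> r < 1 \<and> r0 < r' \<and> r' < 1 \<longrightarrow> 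
          dist (?g r) (?g r') < 3 * inverse (real (Suc k))"
        using elim(1) unfolding N_def mem_Collect_eq by blast
      show "\<exists>P. eventually P (at_left 1) \<and> (\<forall>x y. P x \<and> P y \<longrightarrow> dist (?g x) (?g y) < \<eta>)"
      proof (intro exI conjI allI impI)
        show "eventually (\<lambda>r. r \<in> {r0<..<1}) (at_left 1)" using r0(1) by (rule eventually_at_left_real)
        fix x y assume "x \<in> {r0<..<1} \<and> y \<in> {r0<..<1}"
        then have "dist (?g x) (?g y) < 3 * inverse (real (Suc k))" using r0(2) by auto
        then show "dist (?g x) (?g y) < \<eta>" using k by linarith
      qed
    qed
    then have "\<exists>l. filtermap ?g (at_left 1) \<le> nhds l"
      by (rule cauchy_filter_complete_converges[OF _ complete_UNIV])
        (simp_all add: filtermap_bot_iff flip: top_eq_principal_UNIV)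
    then show ?case by (auto simp: filterlim_def)
  qed
qed

section \<open>Boundary values and pointwise growth in Hardy--Orlicz spaces\<close>

lemma nn_integral_circ_continuous:
  fixes u :: "real \<Rightarrow> real"
  assumes u: "continuous_on UNIV u" "\<And>t. u t \<ge> 0"
  shows "(\<integral>\<^sup>+ t. ennreal (u t) \<partial>circ) = ennreal (integral {0..2*pi} u)"
proof -
  have int: "integrable circ u" unfolding circ_def
    by (rule continuous_imp_integrable_real) (rule continuous_on_subset[OF u(1)], simp)
  have "(\<integral>\<^sup>+ t. ennreal (u t) \<partial>circ) = ennreal (integral\<^sup>L circ u)"
    by (rule nn_integral_eq_integral[OF int]) (use u(2) in simp)
  also have "integral\<^sup>L circ u = integral {0..2*pi} u"
    using int unfolding circ_def by (intro lebesgue_integral_eq_integral) auto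
  finally show ?thesis .
qed

lemma continuous_circle_restr:
  assumes "f holomorphic_on ball 0 1" "0 \<le> r" "r < 1"
  shows "continuous_on UNIV (circle_restr f r)"
  unfolding circle_restr_def using assms
  by (intro continuous_on_compose2[OF holomorphic_on_imp_continuous_on[OF assms(1)]] continuous_intros)
    (auto simp: norm_mult)

lemma circ_modular_le_1_iff:
  "circ_modular \<Psi> f \<le> 1 \<longleftrightarrow> (\<integral>\<^sup>+ t. ennreal (\<Psi> (norm (f t))) \<partial>circ) \<le> ennreal (2*pi)"
  (is "_ \<longleftrightarrow> ?m \<le> _")
proof
  assume "circ_modular \<Psi> f \<le> 1"
  then have "?m / ennreal (2*pi) * ennreal (2*pi) \<le> 1 * ennreal (2*pi)"
    unfolding circ_modular_def by (rule mult_right_mono) simp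
  then show "?m \<le> ennreal (2*pi)"
    by (simp add: ennreal_divide_times mult_divide_eq_ennreal)
next
  assume "?m \<le> ennreal (2*pi)"
  then show "circ_modular \<Psi> f \<le> 1"
    unfolding circ_modular_def by (intro divide_le_posI_ennreal) simp_all
qed

definition radius_seq :: "nat \<Rightarrow> real" where "radius_seq n = 1 - inverse (real (Suc n))"

lemma radius_seq_bounds: "0 \<le> radius_seq n" "radius_seq n < 1"
  by (simp_all add: radius_seq_def inverse_le_1_iff)

lemma radius_seq_tendsto: "radius_seq \<longlonglongrightarrow> 1"
proof -
  have "radius_seq \<longlonglongrightarrow> 1 - 0" unfolding radius_seq_def
    by (intro tendsto_intros LIMSEQ_inverse_real_of_nat)
  then show ?thesis by simp
qed

lemma radius_seq_at_left: "filterlim radius_seq (at_left 1) sequentially"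
  by (rule tendsto_imp_filterlim_at_left[OF radius_seq_tendsto]) (simp add: radius_seq_bounds)

context orlicz_delta2
begin

lemma power_mean_le:
  fixes h :: "real \<Rightarrow> complex"
  assumes h: "h \<in> borel_measurable circ" and C: "C > 0"
    and mod: "circ_modular \<Psi> (\<lambda>t. inverse C *\<^sub>R h t) \<le> 1"
    and AB: "0 \<le> A" "0 \<le> B" "\<And>x. 0 \<le> x \<Longrightarrow> x ^ k \<le> A + B * \<Psi> x"
  shows "(\<integral>\<^sup>+ t. ennreal (cmod (h t) ^ k) \<partial>circ) \<le> ennreal (2 * pi * (A + B) * C ^ k)"
proof -
  note [measurable] = h
  let ?m = "\<integral>\<^sup>+ t. ennreal (\<Psi> (norm (inverse C *\<^sub>R h t))) \<partial>circ"
  have m: "?m \<le> ennreal (2*pi)" using mod by (simp only: circ_modular_le_1_iff)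
  have "(\<integral>\<^sup>+ t. ennreal (cmod (h t) ^ k) \<partial>circ) 
      \<le> (\<integral>\<^sup>+ t. (ennreal (C ^ k * A) + ennreal (C ^ k * B) * ennreal (\<Psi> (norm (inverse C *\<^sub>R h t)))) \<partial>circ)"
  proof (rule nn_integral_mono)
    fix t
    let ?x = "norm (inverse C *\<^sub>R h t)"
    have "cmod (h t) = C * ?x" using C by simp
    then have "cmod (h t) ^ k = C ^ k * ?x ^ k" by (metis power_mult_distrib)
    also have "\<dots> \<le> C ^ k * (A + B * \<Psi> ?x)" using C by (intro mult_left_mono AB) auto
    finally have "ennreal (cmod (h t) ^ k) \<le> ennreal (C ^ k * A + C ^ k * B * \<Psi> ?x)"
      by (intro ennreal_leI) (simp add: algebra_simps)
    then show "ennreal (cmod (h t) ^ k) \<le> ennreal (C ^ k * A) + ennreal (C ^ k * B) * ennreal (\<Psi> ?x)"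
      using C AB nonneg[of ?x] by (simp add: ennreal_plus ennreal_mult)
  qed
  also have "\<dots> = (\<integral>\<^sup>+ t. ennreal (C ^ k * A) \<partial>circ) + ennreal (C ^ k * B) * ?m"
  proof -
    have "(\<lambda>t. ennreal (\<Psi> (norm (inverse C *\<^sub>R h t)))) \<in> borel_measurable circ" by measurable
    then show ?thesis by (simp add: nn_integral_add nn_integral_cmult del: norm_scaleR)
  qed
  also have "\<dots> \<le> ennreal (C ^ k * A) * ennreal (2*pi) + ennreal (C ^ k * B) * ennreal (2*pi)"
    using m by (intro add_mono mult_left_mono) (auto simp: emeasure_circ)
  also have "\<dots> = ennreal (C ^ k * A * (2*pi) + C ^ k * B * (2*pi))"
    using C AB by (simp only: ennreal_plus[symmetric] ennreal_mult[symmetric] mult_nonneg_nonneg zero_le_power less_imp_le pi_ge_zero zero_le_numeral)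
  finally show ?thesis by (simp add: algebra_simps)
qed

lemma hardy_circle_modular:
  assumes "f \<in> hardy_orlicz \<Psi>"
  shows "\<exists>C>0. \<forall>r. 0 \<le> r \<and> r < 1 \<longrightarrow> circ_modular \<Psi> (\<lambda>t. inverse C *\<^sub>R circle_restr f r t) \<le> 1"
proof -
  from assms obtain B where B: "\<And>r. 0 \<le> r \<Longrightarrow> r < 1 \<Longrightarrow> 
      circle_restr f r \<in> orlicz_L \<Psi> \<and> lux_norm \<Psi> (circle_restr f r) \<le> B"
    unfolding hardy_orlicz_def by blast
  show ?thesis
  proof (intro exI conjI allI impI)
    show "0 < max B 0 + 1" by simp
    fix r :: real assume r: "0 \<le> r \<and> r < 1"
    show "circ_modular \<Psi> (\<lambda>t. inverse (max B 0 + 1) *\<^sub>R circle_restr f r t) \<le> 1"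
    proof (rule modular_le_1_of_lux_norm_less)
      show "\<exists>C>0. circ_modular \<Psi> (\<lambda>t. inverse C *\<^sub>R circle_restr f r t) \<le> 1"
        using B r by (intro orlicz_L_ex_modular_le_1) blast
      show "lux_norm \<Psi> (circle_restr f r) < max B 0 + 1" using B[of r] r by linarith
    qed
  qed
qed

lemma hardy_power_mean_bounded:
  assumes f: "f \<in> hardy_orlicz \<Psi>"
  shows "\<exists>K\<ge>0. \<forall>s. 0 \<le> s \<and> s < 1 \<longrightarrow> integral {0..2*pi} (\<lambda>t. cmod (circle_restr f s t) ^ k) \<le> K"
proof -
  have hol: "f holomorphic_on ball 0 1" using f by (simp add: hardy_orlicz_def)
  obtain C where C: "C > 0" "\<And>r. 0 \<le> r \<Longrightarrow> r < 1 \<Longrightarrow> circ_modular \<Psi> (\<lambda>t. inverse C *\<^sub>R circle_restr f r t) \<le> 1"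
    using hardy_circle_modular[OF f] by blast
  obtain A B where AB: "0 \<le> A" "0 \<le> B" "\<And>x. 0 \<le> x \<Longrightarrow> x ^ k \<le> A + B * \<Psi> x"
    using power_le_ex[of k] by blast
  show ?thesis
  proof (intro exI conjI allI impI)
    show K: "0 \<le> 2 * pi * (A + B) * C ^ k" using AB C by simp
    fix s :: real assume s: "0 \<le> s \<and> s < 1"
    have c: "continuous_on UNIV (circle_restr f s)" using continuous_circle_restr[OF hol] s by simp
    have "ennreal (integral {0..2*pi} (\<lambda>t. cmod (circle_restr f s t) ^ k)) = (\<integral>\<^sup>+ t. ennreal (cmod (circle_restr f s t) ^ k) \<partial>circ)"
      by (rule nn_integral_circ_continuous[symmetric]) (intro continuous_intros c, simp)
    also have "\<dots> \<le> ennreal (2 * pi * (A + B) * C ^ k)"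
      using s C by (intro power_mean_le AB continuous_on_measurable_circ c) auto
    finally show "integral {0..2*pi} (\<lambda>t. cmod (circle_restr f s t) ^ k) \<le> 2 * pi * (A + B) * C ^ k"
      using K by simp
  qed
qed

text \<open>\<open>bdry\<close> is a \<open>Lim\<close>, unspecified where no limit exists, so a
  measurable representative is taken from the limit along \<open>radius_seq\<close>. Delta^2 bounds
  the second moments on circles, which is the hypothesis of Fatou's theorem.\<close>

lemma hardy_boundary_function:
  assumes f: "f \<in> hardy_orlicz \<Psi>"
  shows "\<exists>h\<in>borel_measurable circ. AE t in circ. bdry f t = h t \<and> (\<lambda>n. circle_restr f (radius_seq n) t) \<longlonglongrightarrow> h t"
proof -
  have hol: "f holomorphic_on ball 0 1" using f by (simp add: hardy_orlicz_def)
  obtain K where K: "\<And>s. 0 \<le> s \<Longrightarrow> s < 1 \<Longrightarrow> integral {0..2*pi} (\<lambda>t. (cmod (f (of_real s * cis t)))\<^sup>2) \<le> K"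
    using hardy_power_mean_bounded[OF f, of 2] unfolding circle_restr_def by blast
  have lim: "AE t in circ. \<exists>l. ((\<lambda>r. f (of_real r * cis t)) \<longlongrightarrow> l) (at_left 1)"
    using hol K by (rule Fatou_radial_limits)
  let ?u = "\<lambda>n. circle_restr f (radius_seq n)"
  show ?thesis
  proof (rule bexI[of _ "\<lambda>t. lim (\<lambda>n. ?u n t)"])
    show "(\<lambda>t. lim (\<lambda>n. ?u n t)) \<in> borel_measurable circ"
      by (intro borel_measurable_lim_metric continuous_on_measurable_circ continuous_circle_restr hol radius_seq_bounds)
    show "AE t in circ. bdry f t = lim (\<lambda>n. ?u n t) \<and> (\<lambda>n. ?u n t) \<longlonglongrightarrow> lim (\<lambda>n. ?u n t)"
      using lim
    proof eventually_elim
      case (elim t)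
      then obtain l where l: "((\<lambda>r. f (of_real r * cis t)) \<longlongrightarrow> l) (at_left 1)" by (rule exE)
      have 1: "bdry f t = l" unfolding bdry_def by (rule tendsto_Lim[OF _ l]) simp
      have 2: "(\<lambda>n. ?u n t) \<longlonglongrightarrow> l" unfolding circle_restr_def
        by (rule filterlim_compose[OF l radius_seq_at_left])
      show ?case using 1 2 limI[OF 2] by simp
    qed
  qed
qed

text \<open>Fatou's lemma along \<open>radius_seq\<close>. Having one admissible C is what makes
  \<open>hnorm\<close> meaningful for f.\<close>

lemma hardy_boundary_modular:
  assumes f: "f \<in> hardy_orlicz \<Psi>"
  shows "\<exists>C>0. circ_modular \<Psi> (\<lambda>t. inverse C *\<^sub>R bdry f t) \<le> 1"
proof -
  have hol: "f holomorphic_on ball 0 1" using f by (simp add: hardy_orlicz_def)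
  obtain C where C: "C > 0" "\<And>r. 0 \<le> r \<Longrightarrow> r < 1 \<Longrightarrow> circ_modular \<Psi> (\<lambda>t. inverse C *\<^sub>R circle_restr f r t) \<le> 1"
    using hardy_circle_modular[OF f] by blast
  obtain h where h: "AE t in circ. bdry f t = h t \<and> (\<lambda>n. circle_restr f (radius_seq n) t) \<longlonglongrightarrow> h t"
    using hardy_boundary_function[OF f] by blast
  let ?u = "\<lambda>n t. ennreal (\<Psi> (norm (inverse C *\<^sub>R circle_restr f (radius_seq n) t)))"
  have [measurable]: "circle_restr f (radius_seq n) \<in> borel_measurable circ" for n
    by (intro continuous_on_measurable_circ continuous_circle_restr hol radius_seq_bounds)
  have "(\<integral>\<^sup>+ t. ennreal (\<Psi> (norm (inverse C *\<^sub>R bdry f t))) \<partial>circ) = (\<integral>\<^sup>+ t. liminf (\<lambda>n. ?u n t) \<partial>circ)"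
  proof (rule nn_integral_cong_AE)
    show "AE t in circ. ennreal (\<Psi> (norm (inverse C *\<^sub>R bdry f t))) = liminf (\<lambda>n. ?u n t)"
      using h
    proof eventually_elim
      case (elim t)
      then have "(\<lambda>n. ?u n t) \<longlonglongrightarrow> ennreal (\<Psi> (norm (inverse C *\<^sub>R bdry f t)))"
        by (intro tendsto_ennrealI tendsto_norm tendsto_intros) simp
      then show ?case by (simp add: lim_imp_Liminf)
    qed
  qed
  also have "\<dots> \<le> liminf (\<lambda>n. \<integral>\<^sup>+ t. ?u n t \<partial>circ)" by (rule nn_integral_liminf) measurable
  also have "\<dots> \<le> ennreal (2 * pi)"
  proof (rule Liminf_le)
    have "(\<integral>\<^sup>+ t. ?u n t \<partial>circ) \<le> ennreal (2*pi)" for n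
      using C(2)[OF radius_seq_bounds] by (simp only: circ_modular_le_1_iff)
    then show "\<forall>\<^sub>F n in sequentially. (\<integral>\<^sup>+ t. ?u n t \<partial>circ) \<le> ennreal (2 * pi)" by simp
  qed simp
  finally have "circ_modular \<Psi> (\<lambda>t. inverse C *\<^sub>R bdry f t) \<le> 1"
    by (simp only: circ_modular_le_1_iff)
  with C(1) show ?thesis by blast
qed

text \<open>The k-th power of f is holomorphic, and the Poisson kernel at z is at most (1 + |z|) /
  (1 - |z|), hence at most 2 / (1 - |z|). The dilation by s makes f continuous up to the
  circle.\<close>

lemma Poisson_power_bound:
  assumes hol: "f holomorphic_on ball 0 1" and s: "0 \<le> s" "s < 1" and z: "cmod z < 1"
  shows "cmod (f (of_real s * z)) ^ k * (1 - cmod z) * pi \<le> integral {0..2*pi} (\<lambda>t. cmod (circle_restr f s t) ^ k)"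
proof -
  let ?F = "\<lambda>w. f (of_real s * w) ^ k"
  have sub: "(\<lambda>w. of_real s * w) ` cball 0 1 \<subseteq> ball (0::complex) 1"
  proof clarsimp
    fix z :: complex assume "cmod z \<le> 1"
    then have "\<bar>s\<bar> * cmod z \<le> s * 1" using s by (intro mult_mono) auto
    then show "cmod (of_real s * z) < 1" using s by (simp add: norm_mult)
  qed
  have sub': "(\<lambda>w. of_real s * w) ` ball 0 1 \<subseteq> ball (0::complex) 1" using sub by (meson ball_subset_cball image_mono order_trans)
  have cF: "continuous_on (cball 0 1) ?F"
    by (intro continuous_intros continuous_on_compose2[OF holomorphic_on_imp_continuous_on[OF hol] _ sub])
  have "(\<lambda>w. f (of_real s * w)) holomorphic_on ball 0 1"
    by (rule holomorphic_on_compose_gen[OF _ hol sub', unfolded o_def]) (intro holomorphic_intros)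
  then have "?F holomorphic_on ball 0 1" by (intro holomorphic_intros)
  note P = Poisson_formula_holomorphic[OF cF this z]
  have c: "continuous_on S (circle_restr f s)" for S 
    using continuous_circle_restr[OF hol s] continuous_on_subset by blast
  have "cmod (2 * pi * ?F z) \<le> integral {0..2*pi} (\<lambda>t. cmod (circle_restr f s t) ^ k * (2 / (1 - cmod z)))"
    unfolding integral_unique[OF P, symmetric]
  proof (rule integral_norm_bound_integral)
    show "(\<lambda>t. ?F (cis t) * of_real ((1 - (norm z)\<^sup>2) / (norm (1 - cnj z * cis t))\<^sup>2)) integrable_on {0..2*pi}"
      using P by blast
    show "(\<lambda>t. cmod (circle_restr f s t) ^ k * (2 / (1 - cmod z))) integrable_on {0..2*pi}"
      using z by (intro integrable_continuous_interval continuous_intros c) auto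
    fix t
    have "1 - cmod z \<le> cmod (1 - cnj z * cis t)"
      using norm_triangle_ineq2[of 1 "cnj z * cis t"] by (simp add: norm_mult)
    then have "(1 - cmod z)\<^sup>2 \<le> (cmod (1 - cnj z * cis t))\<^sup>2" using z by (intro power_mono) auto
    then have "(1 - (cmod z)\<^sup>2) / (cmod (1 - cnj z * cis t))\<^sup>2 \<le> (1 - (cmod z)\<^sup>2) / (1 - cmod z)\<^sup>2"
      using z by (intro divide_left_mono) (auto simp: power_le_one intro!: mult_pos_pos)
    also have "\<dots> = (1 + cmod z) / (1 - cmod z)" using z by (simp add: power2_eq_square divide_simps) (simp add: algebra_simps)
    also have "\<dots> \<le> 2 / (1 - cmod z)" using z by (intro divide_right_mono) auto
    finally have "\<bar>(1 - (cmod z)\<^sup>2) / (cmod (1 - cnj z * cis t))\<^sup>2\<bar> \<le> 2 / (1 - cmod z)"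
      using z by (simp add: power_le_one)
    then show "norm (?F (cis t) * of_real ((1 - (norm z)\<^sup>2) / (norm (1 - cnj z * cis t))\<^sup>2)) \<le> cmod (circle_restr f s t) ^ k * (2 / (1 - cmod z))"
      unfolding norm_mult norm_of_real norm_power circle_restr_def by (intro mult_left_mono) auto
  qed
  also have "\<dots> = integral {0..2*pi} (\<lambda>t. cmod (circle_restr f s t) ^ k) * (2 / (1 - cmod z))"
    by (rule integral_mult_left)
  finally show ?thesis using z by (simp add: norm_mult norm_power field_simps)
qed

text \<open>The bound has to depend on f through C only. On the circles |f|^k is truncated at T: the
  truncated part converges to an integral over the boundary, and the rest is at most K / T, where K
  bounds the moment of order 2k. K depends on f, but it disappears as T grows.\<close>

lemma pointwise_growth:
  assumes f: "f \<in> hardy_orlicz \<Psi>" and C: "C > 0" and mod: "circ_modular \<Psi> (\<lambda>t. inverse C *\<^sub>R bdry f t) \<le> 1"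
    and AB: "0 \<le> A" "0 \<le> B" "\<And>x. 0 \<le> x \<Longrightarrow> x ^ k \<le> A + B * \<Psi> x" and z: "cmod z < 1"
  shows "cmod (f z) ^ k * (1 - cmod z) \<le> 2 * (A + B) * C ^ k"
proof -
  have hol: "f holomorphic_on ball 0 1" using f by (simp add: hardy_orlicz_def)
  obtain h where hm[measurable]: "h \<in> borel_measurable circ" and 
     h: "AE t in circ. bdry f t = h t \<and> (\<lambda>n. circle_restr f (radius_seq n) t) \<longlonglongrightarrow> h t"
    using hardy_boundary_function[OF f] by blast
  have "circ_modular \<Psi> (\<lambda>t. inverse C *\<^sub>R h t) \<le> circ_modular \<Psi> (\<lambda>t. inverse C *\<^sub>R bdry f t)"
    by (rule modular_mono_AE) (use h in \<open>auto elim!: eventually_mono\<close>)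
  with mod have "circ_modular \<Psi> (\<lambda>t. inverse C *\<^sub>R h t) \<le> 1" by simp
  from power_mean_le[OF hm C this AB]
  have h_le: "(\<integral>\<^sup>+ t. ennreal (cmod (h t) ^ k) \<partial>circ) \<le> ennreal (2 * pi * (A + B) * C ^ k)" by blast
  obtain K where K: "K \<ge> 0" "\<And>s. 0 \<le> s \<Longrightarrow> s < 1 \<Longrightarrow> integral {0..2*pi} (\<lambda>t. cmod (circle_restr f s t) ^ (2*k)) \<le> K"
    using hardy_power_mean_bounded[OF f, of "2*k"] by blast
  let ?u = "\<lambda>n t. cmod (circle_restr f (radius_seq n) t)"
  have cu: "continuous_on UNIV (?u n)" for n
    by (intro continuous_intros continuous_circle_restr hol radius_seq_bounds)
  have [measurable]: "?u n \<in> borel_measurable circ" for n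
    by (intro continuous_on_measurable_circ cu)
  have key: "cmod (f z) ^ k * (1 - cmod z) * pi \<le> 2 * pi * (A + B) * C ^ k + K / T" if T: "T > 0" for T
  proof -
    have bound: "ennreal (cmod (f (of_real (radius_seq n) * z)) ^ k * (1 - cmod z) * pi) 
        \<le> (\<integral>\<^sup>+ t. ennreal (min (?u n t ^ k) T) \<partial>circ) + ennreal (K / T)" for n
    proof -
      have "ennreal (cmod (f (of_real (radius_seq n) * z)) ^ k * (1 - cmod z) * pi) 
         \<le> ennreal (integral {0..2*pi} (\<lambda>t. ?u n t ^ k))"
        by (intro ennreal_leI Poisson_power_bound hol radius_seq_bounds z)
      also have "\<dots> = (\<integral>\<^sup>+ t. ennreal (?u n t ^ k) \<partial>circ)"
        by (rule nn_integral_circ_continuous[symmetric]) (intro continuous_intros cu, simp)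
      also have "\<dots> \<le> (\<integral>\<^sup>+ t. (ennreal (min (?u n t ^ k) T) + ennreal (1 / T) * ennreal (?u n t ^ (2*k))) \<partial>circ)"
      proof (rule nn_integral_mono)
        fix t
        define x where "x = ?u n t ^ k"
        have x: "x \<ge> 0" by (simp add: x_def)
        \<comment> \<open>Above T the value x is at most x^2 / T, so the moment of order 2k pays for
          the truncation.\<close>
        have "x \<le> min x T + 1 / T * x\<^sup>2"
        proof (cases "x \<le> T")
          case False
          then have "x * T \<le> x * x" using x by (intro mult_left_mono) auto
          then have "x \<le> 1 / T * x\<^sup>2" using T by (simp add: field_simps power2_eq_square)
          then show ?thesis using T x by (simp add: min_def)
        qed (use T x in simp)
        moreover have "x\<^sup>2 = ?u n t ^ (2*k)" by (simp add: x_def power_mult[symmetric] mult.commute)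
        ultimately have "ennreal x \<le> ennreal (min x T + 1 / T * ?u n t ^ (2*k))" by (intro ennreal_leI) simp
        also have "\<dots> = ennreal (min x T) + ennreal (1/T) * ennreal (?u n t ^ (2*k))"
        proof -
          have "0 \<le> min x T" "0 \<le> 1 / T * ?u n t ^ (2*k)" "0 \<le> 1 / T" "0 \<le> ?u n t ^ (2*k)" using T x by simp_all
          then show ?thesis by (metis ennreal_plus ennreal_mult)
        qed
        finally show "ennreal (?u n t ^ k) \<le> ennreal (min (?u n t ^ k) T) + ennreal (1 / T) * ennreal (?u n t ^ (2*k))"
          by (simp add: x_def)
      qed
      also have "\<dots> = (\<integral>\<^sup>+ t. ennreal (min (?u n t ^ k) T) \<partial>circ) + ennreal (1 / T) * (\<integral>\<^sup>+ t. ennreal (?u n t ^ (2*k)) \<partial>circ)"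
        by (subst nn_integral_add) (auto simp: nn_integral_cmult)
      also have "(\<integral>\<^sup>+ t. ennreal (?u n t ^ (2*k)) \<partial>circ) = ennreal (integral {0..2*pi} (\<lambda>t. ?u n t ^ (2*k)))"
        by (rule nn_integral_circ_continuous) (intro continuous_intros cu, simp)
      also have "ennreal (1 / T) * \<dots> \<le> ennreal (1/T) * ennreal K"
        by (intro mult_left_mono ennreal_leI K radius_seq_bounds) simp
      also have "\<dots> = ennreal (K / T)" using T K by (simp add: ennreal_mult[symmetric])
      finally show ?thesis by simp
    qed
    have lim1: "(\<lambda>n. \<integral>\<^sup>+ t. ennreal (min (?u n t ^ k) T) \<partial>circ) \<longlonglongrightarrow> (\<integral>\<^sup>+ t. ennreal (min (cmod (h t) ^ k) T) \<partial>circ)"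
    proof (rule nn_integral_dominated_convergence[where w = "\<lambda>_. ennreal T"])
      show "(\<integral>\<^sup>+ t. ennreal T \<partial>circ) < \<infinity>" by (simp add: emeasure_circ ennreal_mult_less_top)
      show "AE t in circ. (\<lambda>n. ennreal (min (?u n t ^ k) T)) \<longlonglongrightarrow> ennreal (min (cmod (h t) ^ k) T)"
        using h by eventually_elim (intro tendsto_ennrealI tendsto_min tendsto_intros, simp)
    qed (auto intro!: ennreal_leI)
    have lim2: "(\<lambda>n. ennreal (cmod (f (of_real (radius_seq n) * z)) ^ k * (1 - cmod z) * pi)) 
       \<longlonglongrightarrow> ennreal (cmod (f z) ^ k * (1 - cmod z) * pi)"
    proof -
      have "isCont f (of_real 1 * z)"
        using hol z by (intro field_differentiable_imp_continuous_at holomorphic_on_imp_differentiable_at[of _ "ball 0 1"]) auto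
      then have "(\<lambda>n. f (of_real (radius_seq n) * z)) \<longlonglongrightarrow> f (of_real 1 * z)"
        by (rule isCont_tendsto_compose) (intro tendsto_intros radius_seq_tendsto)
      then show ?thesis by (intro tendsto_ennrealI tendsto_intros) simp
    qed
    have "ennreal (cmod (f z) ^ k * (1 - cmod z) * pi) \<le> (\<integral>\<^sup>+ t. ennreal (min (cmod (h t) ^ k) T) \<partial>circ) + ennreal (K / T)"
      by (rule LIMSEQ_le[OF lim2 tendsto_add[OF lim1 tendsto_const]]) (use bound in blast)
    also have "\<dots> \<le> ennreal (2 * pi * (A + B) * C ^ k) + ennreal (K / T)"
      by (intro add_right_mono order_trans[OF _ h_le] nn_integral_mono ennreal_leI) simp
    also have "ennreal (2 * pi * (A + B) * C ^ k) + ennreal (K / T) = ennreal (2 * pi * (A + B) * C ^ k + K / T)"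
      using AB C K T by (intro ennreal_plus[symmetric]) auto
    finally show ?thesis using AB C K T by (subst (asm) ennreal_le_iff) auto
  qed
  have "((\<lambda>T. 2 * pi * (A + B) * C ^ k + K / T) \<longlongrightarrow> 2 * pi * (A + B) * C ^ k + 0) at_top"
    by (intro tendsto_intros real_tendsto_divide_at_top[OF tendsto_const] filterlim_ident)
  then have "cmod (f z) ^ k * (1 - cmod z) * pi \<le> 2 * pi * (A + B) * C ^ k + 0"
    by (rule tendsto_lowerbound) (auto intro!: key eventually_mono[OF eventually_gt_at_top[of 0]])
  then have "(cmod (f z) ^ k * (1 - cmod z)) * pi \<le> (2 * (A + B) * C ^ k) * pi" by (simp add: algebra_simps)
  then show ?thesis by (rule mult_right_le_imp_le) simp
qed

end

section \<open>The symbol\<close>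

text \<open>The n-th summand has weight (1/2)^(n+1). It keeps that order for |w| up to R n, and on
  the imaginary axis its real part falls off like (R n / |w|)^2 beyond, so the summands are switched
  off one after another on the way to infinity.\<close>

definition pole_sum :: "(nat \<Rightarrow> real) \<Rightarrow> complex \<Rightarrow> complex" where
  "pole_sum R w = (\<Sum>n. of_real ((1/2) ^ Suc n * R n) / (of_real (R n) + w))"

text \<open>Maps the disc onto the right half-plane. Division by zero gives
  \<open>cayley 1 = 0\<close>, so the bounds below can be stated on the whole closed disc.\<close>

definition cayley :: "complex \<Rightarrow> complex" where
  "cayley z = (1 + z) / (1 - z)"

text \<open>Without \<open>pole_sum\<close> this is the singular inner function with its mass at 1:
  it has modulus 1 on the circle and winds infinitely often near 1. The pole sum pulls the values
  strictly inside the disc.\<close>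

definition symbol :: "(nat \<Rightarrow> real) \<Rightarrow> complex \<Rightarrow> complex" where
  "symbol R z = exp (- (cayley z + pole_sum R (cayley z)))"

lemma Re_cayley:
  assumes "z \<noteq> 1"
  shows "Re (cayley z) = (1 - (cmod z)\<^sup>2) / (cmod (1 - z))\<^sup>2"
proof -
  have "Re (cayley z) = Re ((1 + z) * cnj (1 - z)) / (cmod (1 - z))\<^sup>2"
    unfolding cayley_def by (subst complex_div_cnj) (simp add: Re_divide_of_real flip: of_real_power)
  also have "Re ((1 + z) * cnj (1 - z)) = 1 - (cmod z)\<^sup>2"
    unfolding cmod_power2 by (simp add: algebra_simps power2_eq_square)
  finally show ?thesis .
qed

lemma Re_cayley_nonneg:
  assumes "cmod z \<le> 1"
  shows "Re (cayley z) \<ge> 0"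
proof (cases "z = 1")
  case False
  then show ?thesis using assms by (subst Re_cayley) (auto intro!: divide_nonneg_nonneg simp: power_le_one)
qed (simp add: cayley_def)

lemma cmod_cayley_le:
  assumes "cmod z \<le> 1"
  shows "cmod (cayley z) \<le> 2 / cmod (1 - z)"
  unfolding cayley_def norm_divide
  using norm_triangle_ineq[of 1 z] assms by (intro divide_right_mono) auto

lemma half_series_sums: "(\<lambda>n. (1/2) ^ Suc n * c :: real) sums c"
  using sums_mult2[where c = c, OF power_half_series] by (simp only: mult_1_left)

lemma cayley_cis:
  assumes t: "0 < t" "t < 2 * pi"
  shows "cayley (cis t) = \<i> * of_real (cos (t/2) / sin (t/2))"
proof -
  have s: "sin (t/2) > 0" using t by (intro sin_gt_zero) auto
  have c: "cis t = cis (t/2) * cis (t/2)" by (simp add: cis_mult)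
  have "1 + cis t = cis (t/2) * (cis (- (t/2)) + cis (t/2))" "1 - cis t = cis (t/2) * (cis (-(t/2)) - cis (t/2))"
    by (simp_all add: distrib_left right_diff_distrib cis_mult)
  moreover have "cis (- (t/2)) + cis (t/2) = of_real (2 * cos (t/2))" "cis (-(t/2)) - cis (t/2) = - 2 * \<i> * of_real (sin (t/2))"
    by (simp_all add: complex_eq_iff)
  ultimately have "cayley (cis t) = of_real (2 * cos (t/2)) / (- 2 * \<i> * of_real (sin (t/2)))"
    unfolding cayley_def by simp
  also have "\<dots> = \<i> * of_real (cos (t/2) / sin (t/2))"
    using s by (simp add: divide_simps)
  finally show ?thesis .
qed

section \<open>The pole sum on the closed right half-plane\<close>

locale pole_radii =
  fixes R :: "nat \<Rightarrow> real"
  assumes R_ge: "R n \<ge> 2 ^ n" and R_mono: "mono R"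
begin

abbreviation pole_term :: "nat \<Rightarrow> complex \<Rightarrow> complex" where
  "pole_term n w \<equiv> of_real ((1/2) ^ Suc n * R n) / (of_real (R n) + w)"

lemma R_ge_1: "R n \<ge> 1"
proof -
  have "(1::real) \<le> 2 ^ n" by simp
  with R_ge[of n] show ?thesis by linarith
qed

lemma cmod_denom:
  assumes "Re w \<ge> 0"
  shows "cmod (of_real (R n) + w) \<ge> R n"
  using complex_Re_le_cmod[of "of_real (R n) + w"] assms by simp

lemma denom_nonzero:
  assumes "Re w \<ge> 0"
  shows "of_real (R n) + w \<noteq> 0"
proof -
  have "0 < R n" using R_ge_1[of n] by linarith
  with cmod_denom[OF assms, of n] have "0 < cmod (of_real (R n) + w)" by linarith
  then show ?thesis by simp
qed

lemma cmod_pole_term_le: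
  assumes "Re w \<ge> 0"
  shows "cmod (pole_term n w) \<le> (1/2) ^ Suc n"
proof -
  have p: "0 < R n" using R_ge_1[of n] by linarith
  have "cmod (pole_term n w) = (1/2) ^ Suc n * R n / cmod (of_real (R n) + w)"
    using p unfolding norm_divide norm_of_real by (simp add: abs_mult)
  also have "\<dots> \<le> (1/2) ^ Suc n * R n / R n"
    using p cmod_denom[OF assms, of n] by (intro divide_left_mono mult_pos_pos) auto
  also have "\<dots> = (1/2) ^ Suc n" using p by simp
  finally show ?thesis .
qed

lemma summable_norm_pole_term:
  assumes "Re w \<ge> 0"
  shows "summable (\<lambda>n. cmod (pole_term n w))"
  by (rule summable_comparison_test'[OF sums_summable[OF power_half_series], of 0])
    (use cmod_pole_term_le[OF assms] in simp)

lemma summable_pole_term: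
  assumes "Re w \<ge> 0"
  shows "summable (\<lambda>n. pole_term n w)"
  using summable_norm_pole_term[OF assms] by (rule summable_norm_cancel)

lemma cmod_pole_sum_le:
  assumes "Re w \<ge> 0"
  shows "cmod (pole_sum R w) \<le> 1"
proof -
  have "cmod (pole_sum R w) \<le> (\<Sum>n. cmod (pole_term n w))"
    unfolding pole_sum_def by (rule summable_norm[OF summable_norm_pole_term[OF assms]])
  also have "\<dots> \<le> (\<Sum>n. (1/2) ^ Suc n)"
    by (rule suminf_le[OF cmod_pole_term_le[OF assms] summable_norm_pole_term[OF assms] sums_summable[OF power_half_series]])
  also have "\<dots> = 1" using sums_unique[OF power_half_series] by simp
  finally show ?thesis .
qed

text \<open>As R n \<ge> 1, the n-th summand is Lipschitz with constant (1/2)^(n+1). Holding up to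
  the imaginary axis, this gives boundary continuity and later controls the phase of the symbol on a
  short arc.\<close>

lemma pole_sum_lipschitz:
  assumes w: "Re w \<ge> 0" "Re v \<ge> 0"
  shows "cmod (pole_sum R w - pole_sum R v) \<le> cmod (w - v)"
proof -
  have le: "cmod (pole_term n w - pole_term n v) \<le> (1/2) ^ Suc n * cmod (w - v)" for n
  proof -
    have p: "1 \<le> R n" "0 < R n" using R_ge_1[of n] by linarith+
    have "pole_term n w - pole_term n v = of_real ((1/2) ^ Suc n * R n) * (v - w) / ((of_real (R n) + w) * (of_real (R n) + v))"
      using denom_nonzero[OF w(1), of n] denom_nonzero[OF w(2), of n] by (simp add: divide_simps) (simp add: algebra_simps)
    then have "cmod (pole_term n w - pole_term n v) 
       = (1/2) ^ Suc n * R n * cmod (w - v) / (cmod (of_real (R n) + w) * cmod (of_real (R n) + v))"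
      using p by (simp add: norm_divide norm_mult norm_power norm_minus_commute)
    also have "\<dots> \<le> (1/2) ^ Suc n * R n * cmod (w - v) / (R n * R n)"
      using p cmod_denom[OF w(1), of n] cmod_denom[OF w(2), of n] 
      by (intro divide_left_mono mult_mono mult_pos_pos mult_nonneg_nonneg) auto
    also have "\<dots> = (1/2) ^ Suc n * cmod (w - v) / R n" using p by simp
    also have "\<dots> \<le> (1/2) ^ Suc n * cmod (w - v) / 1" using p by (intro divide_left_mono) auto
    finally show ?thesis by simp
  qed
  have sm: "summable (\<lambda>n. (1/2) ^ Suc n * cmod (w - v))" by (rule sums_summable[OF half_series_sums])
  have sm2: "summable (\<lambda>n. cmod (pole_term n w - pole_term n v))"
    by (rule summable_comparison_test'[OF sm, of 0]) (use le in simp)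
  have "pole_sum R w - pole_sum R v = (\<Sum>n. pole_term n w - pole_term n v)"
    unfolding pole_sum_def by (rule suminf_diff[OF summable_pole_term[OF w(1)] summable_pole_term[OF w(2)]])
  also have "cmod \<dots> \<le> (\<Sum>n. cmod (pole_term n w - pole_term n v))" by (rule summable_norm[OF sm2])
  also have "\<dots> \<le> (\<Sum>n. (1/2) ^ Suc n * cmod (w - v))" by (rule suminf_le[OF le sm2 sm])
  also have "\<dots> = cmod (w - v)" by (rule sums_unique[OF half_series_sums, symmetric])
  finally show ?thesis .
qed

lemma continuous_pole_sum: "continuous_on {w. Re w \<ge> 0} (pole_sum R)"
proof (rule continuous_onI)
  fix w and e :: real assume "w \<in> {w. Re w \<ge> 0}" "e > 0"
  then show "\<exists>d>0. \<forall>v\<in>{w. Re w \<ge> 0}. dist v w < d \<longrightarrow> dist (pole_sum R v) (pole_sum R w) \<le> e"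
    by (intro exI[of _ e]) (auto simp: dist_norm intro!: order_trans[OF pole_sum_lipschitz])
qed

lemma holomorphic_pole_sum: "pole_sum R holomorphic_on {w. Re w > 0}"
proof (rule holomorphic_uniform_sequence)
  show "open {w. Re w > 0}" by (rule open_halfspace_Re_gt)
  show "(\<lambda>w. \<Sum>n<N. pole_term n w) holomorphic_on {w. Re w > 0}" for N
    using denom_nonzero by (intro holomorphic_intros) (auto simp: less_imp_le)
  fix w assume w: "w \<in> {w. Re w > 0}"
  obtain d where d: "d > 0" "cball w d \<subseteq> {w. Re w > 0}"
    using open_contains_cball[of "{w. Re w > 0}"] open_halfspace_Re_gt w by blast
  have "uniform_limit (cball w d) (\<lambda>N w. \<Sum>n<N. pole_term n w) (\<lambda>w. \<Sum>n. pole_term n w) sequentially"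
  proof (rule Weierstrass_m_test)
    show "summable (\<lambda>n. (1/2) ^ Suc n :: real)" by (rule sums_summable[OF power_half_series])
    fix n v assume "v \<in> cball w d"
    then have "Re v \<ge> 0" using d(2) by (auto simp: less_imp_le)
    then show "norm (pole_term n v) \<le> (1/2) ^ Suc n" by (rule cmod_pole_term_le)
  qed
  then show "\<exists>d>0. cball w d \<subseteq> {w. Re w > 0} \<and> uniform_limit (cball w d) (\<lambda>N w. \<Sum>n<N. pole_term n w) (pole_sum R) sequentially"
    using d unfolding pole_sum_def[abs_def] by blast
qed

lemma Re_pole_term:
  assumes "Re w \<ge> 0"
  shows "Re (pole_term n w) = (1/2) ^ Suc n * R n * (R n + Re w) / (cmod (of_real (R n) + w))\<^sup>2"
  by (subst complex_div_cnj) (simp add: Re_divide_of_real flip: of_real_power)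

lemma Re_pole_term_nonneg:
  assumes "Re w \<ge> 0"
  shows "Re (pole_term n w) \<ge> 0"
  unfolding Re_pole_term[OF assms] using assms R_ge_1[of n] by (intro divide_nonneg_nonneg mult_nonneg_nonneg) auto

lemma summable_Re_pole_term:
  assumes "Re w \<ge> 0"
  shows "summable (\<lambda>n. Re (pole_term n w))"
  by (rule summable_Re[OF summable_pole_term[OF assms]])

lemma Re_pole_sum:
  assumes "Re w \<ge> 0"
  shows "Re (pole_sum R w) = (\<Sum>n. Re (pole_term n w))"
  unfolding pole_sum_def by (rule Re_suminf[OF summable_pole_term[OF assms]])

text \<open>All real parts are nonnegative, so the n-th term alone suffices; since |R n + w| \<le> 2
  R n, it contributes at least (1/2)^(n+1) / 4.\<close>

lemma Re_pole_sum_ge: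
  assumes w: "Re w \<ge> 0" "cmod w \<le> R n"
  shows "Re (pole_sum R w) \<ge> (1/2) ^ (n + 3)"
proof -
  have p: "0 < R n" using R_ge_1[of n] by linarith
  have "cmod (of_real (R n) + w) \<le> 2 * R n"
    using norm_triangle_ineq[of "of_real (R n)" w] w p by simp
  then have "(cmod (of_real (R n) + w))\<^sup>2 \<le> (2 * R n)\<^sup>2" by (intro power_mono) auto
  moreover have "0 < (cmod (of_real (R n) + w))\<^sup>2" using denom_nonzero[OF w(1), of n] by simp
  ultimately have "(1/2) ^ Suc n * R n * R n / (2 * R n)\<^sup>2 \<le> (1/2) ^ Suc n * R n * (R n + Re w) / (cmod (of_real (R n) + w))\<^sup>2"
    using w p by (intro frac_le mult_left_mono mult_nonneg_nonneg) auto
  also have "\<dots> = Re (pole_term n w)" by (rule Re_pole_term[OF w(1), symmetric])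
  also have "\<dots> = (\<Sum>i\<in>{n}. Re (pole_term i w))" by simp
  also have "\<dots> \<le> Re (pole_sum R w)"
    unfolding Re_pole_sum[OF w(1)] 
    by (rule sum_le_suminf[OF summable_Re_pole_term[OF w(1)]]) (use Re_pole_term_nonneg[OF w(1)] in auto)
  finally show ?thesis using p by (simp add: power2_eq_square power_add power3_eq_cube)
qed

text \<open>For indices up to m, R n is so far below y that the term gains a factor (R n / y)^2, at
  most 4^(-m); the weights of the later terms sum to (1/2)^(m+1).\<close>

lemma Re_pole_sum_imaginary_le:
  assumes y: "y \<ge> 2 ^ m * R m"
  shows "Re (pole_sum R (\<i> * of_real y)) \<le> 2 * (1/2) ^ m"
proof -
  let ?w = "\<i> * of_real y"
  have w: "Re ?w \<ge> 0" by simp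
  have term_le: "Re (pole_term n ?w) \<le> (1/2) ^ Suc n" for n
    using complex_Re_le_cmod[of "pole_term n ?w"] cmod_pole_term_le[OF w, of n] by linarith
  have term_le': "Re (pole_term n ?w) \<le> (1/2) ^ Suc n * (1/2) ^ m" if n: "n < Suc m" for n
  proof -
    have p: "0 < R n" "0 < R m" using R_ge_1[of n] R_ge_1[of m] by linarith+
    have "R n \<le> R m" using R_mono n by (auto simp: mono_def)
    then have "2 ^ m * R n \<le> 2 ^ m * R m" by simp
    then have Rn: "2 ^ m * R n \<le> y" using y by linarith
    have "(2 ^ m * R n)\<^sup>2 \<le> y\<^sup>2" using Rn p by (intro power_mono) auto
    also have "\<dots> \<le> (cmod (of_real (R n) + ?w))\<^sup>2" unfolding cmod_power2 by simp
    finally have le: "(2 ^ m * R n)\<^sup>2 \<le> (cmod (of_real (R n) + ?w))\<^sup>2" .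
    have "Re (pole_term n ?w) = (1/2) ^ Suc n * R n * R n / (cmod (of_real (R n) + ?w))\<^sup>2"
      by (subst Re_pole_term[OF w]) simp
    also have "\<dots> \<le> (1/2) ^ Suc n * R n * R n / (2 ^ m * R n)\<^sup>2"
    proof (rule divide_left_mono[OF le])
      have q: "0 < (2 ^ m * R n)\<^sup>2" using p by simp
      with le have "0 < (cmod (of_real (R n) + ?w))\<^sup>2" by linarith
      then show "0 < (cmod (of_real (R n) + ?w))\<^sup>2 * (2 ^ m * R n)\<^sup>2" using q by (rule mult_pos_pos)
    qed (use p in auto)
    also have "\<dots> = (1/2) ^ Suc n * ((1/2) ^ m * (1/2) ^ m)"
      using p by (simp add: power2_eq_square field_simps)
    also have "\<dots> \<le> (1/2) ^ Suc n * ((1/2) ^ m * 1)"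
      by (intro mult_left_mono power_le_one) auto
    finally show ?thesis by simp
  qed
  have split: "Re (pole_sum R ?w) = (\<Sum>n. Re (pole_term (n + Suc m) ?w)) + (\<Sum>n<Suc m. Re (pole_term n ?w))"
    unfolding Re_pole_sum[OF w] by (rule suminf_split_initial_segment[OF summable_Re_pole_term[OF w]])
  have "(\<Sum>n. Re (pole_term (n + Suc m) ?w)) \<le> (\<Sum>n. (1/2) ^ Suc n * (1/2) ^ Suc m)"
  proof (rule suminf_le)
    show "Re (pole_term (n + Suc m) ?w) \<le> (1/2) ^ Suc n * (1/2) ^ Suc m" for n
      using term_le[of "n + Suc m"] by (simp only: power_add[symmetric] add_Suc add_Suc_right)
    show "summable (\<lambda>n. Re (pole_term (n + Suc m) ?w))"
      using summable_Re_pole_term[OF w] by (rule summable_ignore_initial_segment)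
    show "summable (\<lambda>n. (1/2) ^ Suc n * (1/2) ^ Suc m :: real)" by (rule sums_summable[OF half_series_sums])
  qed
  also have "\<dots> = (1/2) ^ Suc m"
    by (rule sums_unique[OF half_series_sums, symmetric])
  finally have tail: "(\<Sum>n. Re (pole_term (n + Suc m) ?w)) \<le> (1/2) ^ Suc m" .
  have "(\<Sum>n<Suc m. Re (pole_term n ?w)) \<le> (\<Sum>n<Suc m. (1/2) ^ Suc n * (1/2) ^ m)"
    using term_le' by (intro sum_mono) auto
  also have "\<dots> \<le> (\<Sum>n. (1/2) ^ Suc n * (1/2) ^ m)"
    by (rule sum_le_suminf[OF sums_summable[OF half_series_sums]]) auto
  also have "\<dots> = (1/2) ^ m" by (rule sums_unique[OF half_series_sums, symmetric])
  finally have "(\<Sum>n<Suc m. Re (pole_term n ?w)) \<le> (1/2) ^ m" .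
  with split tail have "Re (pole_sum R ?w) \<le> (1/2) ^ Suc m + (1/2) ^ m" by linarith
  moreover have "(0::real) \<le> (1/2) ^ m" by simp
  ultimately show ?thesis unfolding power_Suc by linarith
qed

section \<open>Modulus, holomorphy and boundary behaviour of the symbol\<close>

lemma cmod_symbol: "cmod (symbol R z) = exp (- (Re (cayley z) + Re (pole_sum R (cayley z))))"
  by (simp add: symbol_def)

text \<open>|cayley z| is at most 2 / |1 - z|, so \<open>Re_pole_sum_ge\<close> applies with x =
  (1/2)^(n+3); then exp (-x) \<le> 1 / (1 + x) \<le> 1 - x/2 leads to the exponent n + 4.\<close>

lemma cmod_symbol_le:
  assumes z: "cmod z \<le> 1" and n: "2 / cmod (1 - z) \<le> R n"
  shows "cmod (symbol R z) \<le> 1 - (1/2) ^ (n + 4)"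
proof -
  define x :: real where "x = (1/2) ^ (n + 3)"
  have x: "0 < x" "x \<le> 1" by (simp_all add: x_def power_le_one)
  have w: "Re (cayley z) \<ge> 0" "cmod (cayley z) \<le> R n"
    using Re_cayley_nonneg[OF z] cmod_cayley_le[OF z] n by auto
  have "cmod (symbol R z) \<le> exp (- x)"
    unfolding cmod_symbol x_def using Re_pole_sum_ge[OF w] w(1) by simp
  also have "\<dots> = 1 / exp x" by (simp add: exp_minus inverse_eq_divide)
  also have "\<dots> \<le> 1 / (1 + x)" using exp_ge_add_one_self[of x] x by (intro divide_left_mono) auto
  also have "\<dots> \<le> 1 - x / 2"
  proof -
    have "x * x \<le> x * 1" using x by (intro mult_left_mono) auto
    then show ?thesis using x by (simp add: divide_simps) (simp add: algebra_simps)
  qed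
  also have "x / 2 = (1/2) ^ (n + 4)" by (simp add: x_def power_add power3_eq_cube power4_eq_xxxx)
  finally show ?thesis .
qed

lemma ex_R_ge: "\<exists>n. x \<le> R n"
proof -
  obtain n where "x < 2 ^ n" using real_arch_pow[of 2 x] by auto
  then show ?thesis using R_ge[of n] by (intro exI[of _ n]) linarith
qed

text \<open>Strictness on the closed disc makes the boundary values of f composed with the symbol
  plain evaluations of f at interior points.\<close>

lemma cmod_symbol_less_1:
  assumes "cmod z \<le> 1"
  shows "cmod (symbol R z) < 1"
proof -
  obtain n where "2 / cmod (1 - z) \<le> R n" using ex_R_ge by blast
  from cmod_symbol_le[OF assms this] show ?thesis by (smt (verit) zero_less_power half_gt_zero_iff zero_less_one)
qed

lemma Re_cayley_pos:
  assumes "cmod z < 1"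
  shows "Re (cayley z) > 0"
proof -
  have "z \<noteq> 1" using assms by auto
  moreover have "(cmod z)\<^sup>2 < 1" using assms by (simp add: power_less_one_iff)
  ultimately show ?thesis by (subst Re_cayley) auto
qed

lemma holomorphic_symbol: "symbol R holomorphic_on ball 0 1"
proof -
  have c: "cayley holomorphic_on ball 0 1" unfolding cayley_def[abs_def]
    by (intro holomorphic_intros) auto
  have "(pole_sum R \<circ> cayley) holomorphic_on ball 0 1"
    by (rule holomorphic_on_compose_gen[OF c holomorphic_pole_sum]) (auto simp: Re_cayley_pos)
  then show ?thesis unfolding symbol_def[abs_def] o_def by (intro holomorphic_intros c)
qed

lemma continuous_symbol: "continuous_on (cball 0 1 - {1}) (symbol R)"
proof -
  have c: "continuous_on (cball 0 1 - {1}) cayley" unfolding cayley_def[abs_def]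
    by (intro continuous_intros) auto
  have "continuous_on (cball 0 1 - {1}) (\<lambda>z. pole_sum R (cayley z))"
    by (rule continuous_on_compose2[OF continuous_pole_sum c]) (auto simp: Re_cayley_nonneg)
  then show ?thesis unfolding symbol_def[abs_def] by (intro continuous_intros c)
qed

lemma cis_neq_1:
  assumes "0 < t" "t < 2 * pi"
  shows "cis t \<noteq> 1"
proof
  assume "cis t = 1"
  then have "cos t = 1" by (simp add: complex_eq_iff)
  moreover have "cos t = 1 - 2 * (sin (t/2))\<^sup>2" using cos_double_sin[of "t/2"] by simp
  moreover have "sin (t/2) > 0" using assms by (intro sin_gt_zero) auto
  ultimately show False by simp
qed

lemma symbol_radial_limit:
  assumes t: "0 < t" "t < 2 * pi"
  shows "((\<lambda>r. symbol R (of_real r * cis t)) \<longlongrightarrow> symbol R (cis t)) (at_left 1)"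
proof -
  have "((\<lambda>r. of_real r * cis t) \<longlongrightarrow> of_real 1 * cis t) (at_left (1::real))" by (intro tendsto_intros)
  then have lim: "((\<lambda>r. of_real r * cis t) \<longlongrightarrow> cis t) (at_left (1::real))" by simp
  have "eventually (\<lambda>r. r \<in> {0<..<1}) (at_left (1::real))" by (rule eventually_at_left_real) simp
  then have "eventually (\<lambda>r. of_real r * cis t \<in> cball 0 1 - {1}) (at_left (1::real))"
  proof eventually_elim
    case (elim r)
    then have "cmod (of_real r * cis t) < 1" by (simp add: norm_mult)
    then show ?case by auto
  qed
  then show ?thesis
    by (intro continuous_on_tendsto_compose[OF continuous_symbol lim]) (use cis_neq_1[OF t] in auto)
qed

end

text \<open>Uniformity in \<open>r\<close> is what lets one majorant serve on every circle.\<close>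

lemma cmod_one_minus_radial_ge:
  assumes t: "0 < t" "t < 2 * pi" and r: "0 \<le> r" "r \<le> 1"
  shows "cmod (1 - of_real r * cis t) \<ge> min t (2*pi - t) / 8"
proof -
  define d where "d = min t (2*pi - t)"
  have d: "0 < d" "d \<le> pi" using t by (auto simp: d_def)
  have cosd: "cos d = cos t" by (simp add: d_def min_def cos_diff)
  have sind: "(sin d)\<^sup>2 = (sin t)\<^sup>2" by (simp add: d_def min_def sin_diff)
  have sq: "(cmod (1 - of_real r * cis t))\<^sup>2 = 1 - 2 * r * cos t + r\<^sup>2"
  proof -
    have "(cmod (1 - of_real r * cis t))\<^sup>2 = (1 - r * cos t)\<^sup>2 + (r * sin t)\<^sup>2" unfolding cmod_power2 by simp
    also have "\<dots> = 1 - 2 * r * cos t + r\<^sup>2 * ((sin t)\<^sup>2 + (cos t)\<^sup>2)" unfolding power2_eq_square by algebra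
    finally show ?thesis by simp
  qed
  have "(d / 8)\<^sup>2 \<le> (cmod (1 - of_real r * cis t))\<^sup>2"
  \<comment> \<open>For angles up to pi/3 the distance from 1 to the radius is at least sin d, and
    sin d \<ge> d/2. For larger angles r cos t \<le> r/2 keeps the squared distance above
    3/4.\<close>
  proof (cases "d \<le> pi / 3")
    case True
    have "sin 0 - 0 / 2 \<le> sin d - d / 2"
    proof (rule DERIV_nonneg_imp_nondecreasing[of 0 d "\<lambda>x. sin x - x / 2"])
      fix x assume x: "0 \<le> x" "x \<le> d"
      have "cos (pi/3) \<le> cos x" using x True by (intro cos_monotone_0_pi_le) auto
      then show "\<exists>y. ((\<lambda>x. sin x - x / 2) has_real_derivative y) (at x) \<and> 0 \<le> y"
        by (intro exI[of _ "cos x - 1/2"]) (auto intro!: derivative_eq_intros simp: cos_60)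
    qed (use d in auto)
    then have "(d/8)\<^sup>2 \<le> (sin d)\<^sup>2" using d by (intro power_mono) auto
    also have "\<dots> \<le> (sin t)\<^sup>2 + (r - cos t)\<^sup>2" using sind by simp
    also have "\<dots> = r\<^sup>2 - 2 * r * cos t + ((sin t)\<^sup>2 + (cos t)\<^sup>2)" unfolding power2_eq_square by algebra
    finally show ?thesis unfolding sq by simp
  next
    case False
    have "cos d \<le> cos (pi/3)" using False d by (intro cos_monotone_0_pi_le) auto
    then have "r * cos t \<le> r * (1/2)" using r cosd by (intro mult_left_mono) (auto simp: cos_60)
    moreover have "0 \<le> (r - 1/2)\<^sup>2" by simp
    ultimately have "3/4 \<le> 1 - 2 * r * cos t + r\<^sup>2" by (simp add: power2_eq_square algebra_simps)
    moreover have "(d / 8)\<^sup>2 \<le> (1/2)\<^sup>2" using d pi_less_4 by (intro power_mono) auto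
    ultimately show ?thesis unfolding sq by (simp add: power2_eq_square)
  qed
  then show ?thesis unfolding d_def[symmetric] by (rule power2_le_imp_le) simp
qed

section \<open>Order boundedness and compactness\<close>

lemma circ_modular_finite_iff:
  "circ_modular \<Psi> f < \<infinity> \<longleftrightarrow> (\<integral>\<^sup>+ t. ennreal (\<Psi> (norm (f t))) \<partial>circ) < \<infinity>"
  unfolding circ_modular_def by (simp add: less_top[symmetric] ennreal_divide_eq_top_iff)

lemma orlicz_M_scaled:
  assumes "D \<in> orlicz_M \<Psi>" "a > 0"
  shows "circ_modular \<Psi> (\<lambda>t. a *\<^sub>R D t) < \<infinity>"
proof -
  have "\<forall>C>0. circ_modular \<Psi> (\<lambda>t. inverse C *\<^sub>R D t) < \<infinity>"
    using assms(1) unfolding orlicz_M_def mem_Collect_eq by (rule conjunct2)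
  from this[rule_format, of "inverse a"] assms(2) show ?thesis by (simp only: inverse_inverse_eq inverse_positive_iff_positive)
qed

context orlicz_delta2
begin

text \<open>Stated with an arbitrary admissible C instead of the norm, so that no infimum has to be
  attained; the unit ball is covered by C = 2. The last clause says that G grows at most like
  2^(n/k), for every k.\<close>

definition growth_bound :: "(nat \<Rightarrow> real) \<Rightarrow> bool" where
  "growth_bound G \<longleftrightarrow> mono G \<and> (\<forall>n. 0 \<le> G n) \<and>
     (\<forall>f C n z. f \<in> hardy_orlicz \<Psi> \<and> 0 < C \<and> circ_modular \<Psi> (\<lambda>t. inverse C *\<^sub>R bdry f t) \<le> 1
        \<and> cmod z \<le> 1 - (1/2) ^ n \<longrightarrow> cmod (f z) \<le> C * G n) \<and>
     (\<forall>k\<ge>1. \<exists>K\<ge>0. \<forall>n. G n ^ k \<le> K * 2 ^ n)"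

text \<open>\<open>pointwise_growth\<close> with 1 - |z| \<ge> 2^(-n) gives, after taking k-th
  roots, one bound for each k. The infimum over k \<ge> 1 satisfies all of them
  simultaneously.\<close>

lemma ex_growth_bound: "\<exists>G. growth_bound G"
proof -
  obtain A B where AB: "\<And>k. 0 \<le> A k" "\<And>k. 0 \<le> B k" "\<And>k x. 0 \<le> x \<Longrightarrow> x ^ k \<le> A k + B k * \<Psi> x"
    using power_dominated by blast
  define K where "K k = 2 * (A k + B k)" for k :: nat
  have K: "0 \<le> K k" for k using AB by (simp add: K_def)
  define G where "G n = Inf ((\<lambda>k. root k (K k * 2 ^ n)) ` {1..})" for n
  have root_nonneg: "0 \<le> root k (K k * 2 ^ n)" for k n using K by (intro real_root_ge_zero) simp
  have bdd: "bdd_below ((\<lambda>k. root k (K k * 2 ^ n)) ` {1..})" for n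
    using root_nonneg by (intro bdd_belowI[of _ 0]) auto
  have G_le: "G n \<le> root k (K k * 2 ^ n)" if "k \<ge> 1" for n k
    unfolding G_def using that by (intro cInf_lower bdd) auto
  have G_nonneg: "0 \<le> G n" for n
    unfolding G_def using root_nonneg by (intro cInf_greatest) auto
  have "mono G"
  proof (rule monoI)
    fix m n :: nat assume mn: "m \<le> n"
    show "G m \<le> G n" unfolding G_def[of n]
    proof (rule cInf_greatest)
      fix x assume "x \<in> (\<lambda>k. root k (K k * 2 ^ n)) ` {1..}"
      then obtain k where k: "k \<ge> 1" "x = root k (K k * 2 ^ n)" by auto
      have "G m \<le> root k (K k * 2 ^ m)" by (rule G_le[OF k(1)])
      also have "\<dots> \<le> root k (K k * 2 ^ n)"
        using k mn K by (intro real_root_le_mono mult_left_mono power_increasing) auto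
      finally show "G m \<le> x" by (simp add: k)
    qed auto
  qed
  moreover have "cmod (f z) \<le> C * G n" 
    if f: "f \<in> hardy_orlicz \<Psi>" and C: "0 < C" and mod: "circ_modular \<Psi> (\<lambda>t. inverse C *\<^sub>R bdry f t) \<le> 1"
      and z: "cmod z \<le> 1 - (1/2) ^ n" for f C n z
  proof -
    have z1: "cmod z < 1" using z zero_less_power[of "1/2::real" n] by linarith
    have "cmod (f z) / C \<le> G n" unfolding G_def
    proof (rule cInf_greatest)
      fix x assume "x \<in> (\<lambda>k. root k (K k * 2 ^ n)) ` {1..}"
      then obtain k where k: "k \<ge> 1" "x = root k (K k * 2 ^ n)" by auto
      have "cmod (f z) ^ k * (1/2) ^ n \<le> cmod (f z) ^ k * (1 - cmod z)"
        using z by (intro mult_left_mono) auto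
      also have "\<dots> \<le> K k * C ^ k"
        unfolding K_def using AB by (intro pointwise_growth[OF f C mod _ _ _ z1]) auto
      finally have "(cmod (f z) / C) ^ k \<le> K k * 2 ^ n"
        using C by (simp add: power_divide field_simps)
      then have "root k ((cmod (f z) / C) ^ k) \<le> root k (K k * 2 ^ n)"
        using k by (intro real_root_le_mono) auto
      then show "cmod (f z) / C \<le> x" using k C by (simp add: real_root_power_cancel)
    qed auto
    then show ?thesis using C by (simp add: field_simps)
  qed
  moreover have "\<exists>K'\<ge>0. \<forall>n. G n ^ k \<le> K' * 2 ^ n" if k: "k \<ge> 1" for k
  proof (intro exI conjI allI)
    fix n
    have "G n ^ k \<le> root k (K k * 2 ^ n) ^ k" by (intro power_mono G_le k G_nonneg)
    also have "\<dots> = K k * 2 ^ n" using k K by (intro real_root_pow_pos2) auto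
    finally show "G n ^ k \<le> K k * 2 ^ n" .
  qed (rule K)
  ultimately have "growth_bound G" unfolding growth_bound_def using G_nonneg by blast
  then show ?thesis by blast
qed

text \<open>Membership is a condition on all circles, so a single majorant valid for every r < 1
  supplies the uniform bound.\<close>

lemma dominated_in_hardy_orlicz:
  assumes hol: "g holomorphic_on ball 0 1" and D: "D \<in> orlicz_M \<Psi>" and C: "C > 0"
    and dom: "\<And>r t. 0 \<le> r \<Longrightarrow> r < 1 \<Longrightarrow> 0 < t \<Longrightarrow> t < 2*pi \<Longrightarrow> cmod (g (of_real r * cis t)) \<le> C * D t"
  shows "g \<in> hardy_orlicz \<Psi>"
proof -
  have "(\<lambda>t. C * D t) \<in> orlicz_L \<Psi>"
    unfolding orlicz_L_def
  proof (intro CollectI conjI exI[of _ C])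
    show "(\<lambda>t. C * D t) \<in> borel_measurable circ" using D by (auto simp: orlicz_M_def)
    have "circ_modular \<Psi> (\<lambda>t. 1 *\<^sub>R D t) < \<infinity>" by (rule orlicz_M_scaled[OF D]) simp
    moreover have "(\<lambda>t. inverse C *\<^sub>R (C * D t)) = (\<lambda>t. 1 *\<^sub>R D t)" using C by (simp add: fun_eq_iff)
    ultimately show "circ_modular \<Psi> (\<lambda>t. inverse C *\<^sub>R (C * D t)) < \<infinity>" by (simp only:)
  qed (rule C)
  then obtain C' where C': "C' > 0" "circ_modular \<Psi> (\<lambda>t. inverse C' *\<^sub>R (C * D t)) \<le> 1"
    using orlicz_L_ex_modular_le_1 by blast
  have mod: "circ_modular \<Psi> (\<lambda>t. inverse C' *\<^sub>R circle_restr g r t) \<le> 1" if r: "0 \<le> r" "r < 1" for r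
  proof -
    have "circ_modular \<Psi> (\<lambda>t. inverse C' *\<^sub>R circle_restr g r t) \<le> circ_modular \<Psi> (\<lambda>t. inverse C' *\<^sub>R (C * D t))"
    proof (rule modular_mono_AE)
      show "AE t in circ. norm (inverse C' *\<^sub>R circle_restr g r t) \<le> norm (inverse C' *\<^sub>R (C * D t))"
        using AE_circ_interior
      proof eventually_elim
        case (elim t)
        have "cmod (circle_restr g r t) \<le> \<bar>C * D t\<bar>"
          using dom[of r t] r elim unfolding circle_restr_def by linarith
        then show ?case unfolding norm_scaleR by (intro mult_left_mono) auto
      qed
    qed
    with C' show ?thesis by simp
  qed
  show ?thesis unfolding hardy_orlicz_def
  proof (intro CollectI conjI exI[of _ C'] allI impI hol)
    fix r :: real assume r: "0 \<le> r \<and> r < 1"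
    show "circle_restr g r \<in> orlicz_L \<Psi>" unfolding orlicz_L_def
    proof (intro CollectI conjI exI[of _ C'])
      show "circle_restr g r \<in> borel_measurable circ"
        using r by (intro continuous_on_measurable_circ continuous_circle_restr hol) auto
      show "circ_modular \<Psi> (\<lambda>t. inverse C' *\<^sub>R circle_restr g r t) < \<infinity>"
        using mod[of r] r by (auto intro: le_less_trans)
    qed (rule C')
    show "lux_norm \<Psi> (circle_restr g r) \<le> C'"
      using r by (intro lux_norm_le C' mod) auto
  qed
qed

text \<open>For each e > 0 the modular of h n / e has to drop to at most 1. Dominated convergence
  achieves this because D lies in M, so that every multiple of D has finite modular.\<close>

lemma lux_norm_tendsto_0:
  fixes h :: "nat \<Rightarrow> real \<Rightarrow> complex"
  assumes cont: "\<And>n. continuous_on {0<..<2*pi} (h n)" and D: "D \<in> orlicz_M \<Psi>" and C: "C > 0"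
    and dom: "\<And>n t. 0 < t \<Longrightarrow> t < 2*pi \<Longrightarrow> cmod (h n t) \<le> C * D t"
    and lim: "\<And>t. 0 < t \<Longrightarrow> t < 2*pi \<Longrightarrow> (\<lambda>n. h n t) \<longlonglongrightarrow> 0"
  shows "(\<lambda>n. lux_norm \<Psi> (h n)) \<longlonglongrightarrow> 0"
proof (rule LIMSEQ_I)
  fix e :: real assume e: "e > 0"
  define e' where "e' = e / 2"
  have e': "e' > 0" "e' < e" using e by (auto simp: e'_def)
  have [measurable]: "D \<in> borel_measurable circ" using D by (auto simp: orlicz_M_def)
  \<comment> \<open>h n is only known to be continuous on the open interval; cutting it off there
    gives Borel measurability and changes no integral.\<close>
  define u where "u n t = indicator {0<..<2*pi} t *\<^sub>R h n t" for n t
  have [measurable]: "u n \<in> borel_measurable circ" for n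
    unfolding u_def[abs_def] by (intro borel_measurable_circ borel_measurable_continuous_on_indicator cont) auto
  have u_eq: "(\<integral>\<^sup>+ t. ennreal (\<Psi> (norm (inverse e' *\<^sub>R h n t))) \<partial>circ) = (\<integral>\<^sup>+ t. ennreal (\<Psi> (norm (inverse e' *\<^sub>R u n t))) \<partial>circ)" for n
  proof (rule nn_integral_cong_AE)
    show "AE t in circ. ennreal (\<Psi> (norm (inverse e' *\<^sub>R h n t))) = ennreal (\<Psi> (norm (inverse e' *\<^sub>R u n t)))"
      using AE_circ_interior by eventually_elim (simp add: u_def)
  qed
  have ae: "AE t in circ. ennreal (\<Psi> (norm (inverse e' *\<^sub>R u n t))) \<le> ennreal (\<Psi> (norm (inverse (e' / C) *\<^sub>R D t)))" for n
    using AE_circ_interior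
  proof eventually_elim
    case (elim t)
    have "cmod (h n t) \<le> C * \<bar>D t\<bar>"
      using dom[of t n] elim C by (smt (verit) mult_left_mono abs_ge_self)
    then have "norm (inverse e' *\<^sub>R u n t) \<le> norm (inverse (e' / C) *\<^sub>R D t)"
      using e' C elim by (simp add: u_def field_simps)
    then show ?case by (intro ennreal_leI mono) auto
  qed
  have fin: "(\<integral>\<^sup>+ t. ennreal (\<Psi> (norm (inverse (e' / C) *\<^sub>R D t))) \<partial>circ) < \<infinity>"
    by (rule circ_modular_finite_iff[THEN iffD1, OF orlicz_M_scaled[OF D]]) (use e' C in simp)
  have "(\<lambda>n. \<integral>\<^sup>+ t. ennreal (\<Psi> (norm (inverse e' *\<^sub>R u n t))) \<partial>circ) \<longlonglongrightarrow> (\<integral>\<^sup>+ t. 0 \<partial>circ)"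
  proof (rule nn_integral_dominated_convergence[OF _ _ _ ae fin])
    show "AE t in circ. (\<lambda>n. ennreal (\<Psi> (norm (inverse e' *\<^sub>R u n t)))) \<longlonglongrightarrow> 0"
      using AE_circ_interior
    proof eventually_elim
      case (elim t)
      then have "(\<lambda>n. \<Psi> (norm (inverse e' *\<^sub>R h n t))) \<longlonglongrightarrow> \<Psi> (norm (inverse e' *\<^sub>R (0::complex)))"
        by (intro tendsto_norm tendsto_intros lim) auto
      then have "(\<lambda>n. \<Psi> (norm (inverse e' *\<^sub>R h n t))) \<longlonglongrightarrow> 0" by simp
      from tendsto_ennrealI[OF this] show ?case using elim by (simp add: u_def)
    qed
  qed measurable
  then have "eventually (\<lambda>n. (\<integral>\<^sup>+ t. ennreal (\<Psi> (norm (inverse e' *\<^sub>R h n t))) \<partial>circ) < ennreal (2*pi)) sequentially"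
    unfolding u_eq by (intro order_tendstoD(2)[of _ 0]) auto
  then obtain N where N: "\<And>n. n \<ge> N \<Longrightarrow> (\<integral>\<^sup>+ t. ennreal (\<Psi> (norm (inverse e' *\<^sub>R h n t))) \<partial>circ) < ennreal (2*pi)"
    by (auto simp: eventually_sequentially)
  show "\<exists>N. \<forall>n\<ge>N. norm (lux_norm \<Psi> (h n) - 0) < e"
  proof (intro exI allI impI)
    fix n assume "n \<ge> N"
    then have m: "circ_modular \<Psi> (\<lambda>t. inverse e' *\<^sub>R h n t) \<le> 1"
      unfolding circ_modular_le_1_iff using N[of n] by simp
    have "lux_norm \<Psi> (h n) \<le> e'" by (rule lux_norm_le[OF e'(1) m])
    moreover have "lux_norm \<Psi> (h n) \<ge> 0" using m e' by (intro lux_norm_nonneg) blast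
    ultimately show "norm (lux_norm \<Psi> (h n) - 0) < e" using e' by simp
  qed
qed

text \<open>The scale 2 leaves the room above the norm that
  \<open>modular_le_1_of_lux_norm_less\<close> asks for.\<close>

lemma hnorm_le_1D:
  assumes f: "f \<in> hardy_orlicz \<Psi>" and n: "hnorm \<Psi> f \<le> 1"
  shows "circ_modular \<Psi> (\<lambda>t. inverse 2 *\<^sub>R bdry f t) \<le> 1"
  using n unfolding hnorm_def by (intro modular_le_1_of_lux_norm_less hardy_boundary_modular f) auto

end

section \<open>The majorant, order boundedness and compactness\<close>

lemma emeasure_circ_near_ends:
  assumes "\<delta> > 0"
  shows "emeasure circ ({0..2*pi} \<inter> ({..\<delta>} \<union> {2*pi-\<delta>..})) \<le> ennreal (2 * \<delta>)"
proof -
  have "emeasure circ ({0..2*pi} \<inter> ({..\<delta>} \<union> {2*pi-\<delta>..})) = emeasure lebesgue ({0..2*pi} \<inter> ({..\<delta>} \<union> {2*pi-\<delta>..}))"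
    unfolding circ_def by (rule emeasure_restrict_space) auto
  also have "\<dots> \<le> emeasure lebesgue ({0..\<delta>} \<union> {2*pi-\<delta>..2*pi})"
    by (rule emeasure_mono) auto
  also have "\<dots> \<le> emeasure lebesgue {0..\<delta>} + emeasure lebesgue {2*pi-\<delta>..2*pi}"
    by (rule emeasure_subadditive) auto
  also have "\<dots> = ennreal \<delta> + ennreal \<delta>" using assms by simp
  also have "\<dots> = ennreal (2 * \<delta>)" using assms by (simp flip: ennreal_plus)
  finally show ?thesis .
qed

text \<open>In \<open>R_large\<close> the factor n eventually exceeds any dilation a, and 2^n makes
  the sum over levels geometric. The shift n + 5 belongs to level n + 1, where the majorant equals G
  (n + 5).\<close>

locale admissible_radii = orlicz_delta2 + pole_radii +
  fixes G :: "nat \<Rightarrow> real"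
  assumes G: "growth_bound G" and R_large: "2 ^ n * \<Psi> (real n * G (n + 5)) \<le> R n"
begin

lemma G_nonneg: "0 \<le> G n" using G by (auto simp: growth_bound_def)
lemma G_bound:
  "f \<in> hardy_orlicz \<Psi> \<Longrightarrow> 0 < C \<Longrightarrow> circ_modular \<Psi> (\<lambda>t. inverse C *\<^sub>R bdry f t) \<le> 1 \<Longrightarrow>
   cmod z \<le> 1 - (1/2) ^ n \<Longrightarrow> cmod (f z) \<le> C * G n"
  using G unfolding growth_bound_def by blast
lemma G_power: "k \<ge> 1 \<Longrightarrow> \<exists>K\<ge>0. \<forall>n. G n ^ k \<le> K * 2 ^ n"
  using G unfolding growth_bound_def by blast

text \<open>16 is 2 times 8, from |cayley z| \<le> 2 / |1 - z| and the distance bound min t (2 pi -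
  t) / 8, which holds on the whole radius; one level therefore serves all r.\<close>

definition level :: "real \<Rightarrow> nat" where
  "level t = (LEAST n. 16 / min t (2*pi - t) \<le> R n)"

text \<open>The shift by 4 is the one in \<open>cmod_symbol_le\<close>.\<close>

definition majorant :: "real \<Rightarrow> real" where
  "majorant t = G (level t + 4)"

lemma majorant_measurable: "majorant \<in> borel_measurable circ"
proof -
  have [measurable]: "level \<in> measurable borel (count_space UNIV)"
    unfolding level_def[abs_def] by measurable
  have "majorant \<in> borel_measurable borel" unfolding majorant_def[abs_def] by measurable
  then show ?thesis by (rule borel_measurable_circ)
qed

lemma level_spec: "16 / min t (2*pi - t) \<le> R (level t)"
  unfolding level_def using ex_R_ge by (rule LeastI_ex)

lemma level_Suc:
  assumes "level t = Suc n"
  shows "R n < 16 / min t (2*pi - t)"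
  using not_less_Least[of n "\<lambda>n. 16 / min t (2*pi - t) \<le> R n"] assms unfolding level_def by simp

text \<open>Level n + 1 forces t to lie within 16 / R n of an end point, a set of measure at most 32
  / R n, and there the integrand equals \<open>b n\<close>. Level 0 costs a constant.\<close>

lemma majorant_modular_finite:
  assumes a: "a \<ge> 0"
  shows "(\<integral>\<^sup>+ t. ennreal (\<Psi> (norm (a *\<^sub>R majorant t))) \<partial>circ) < \<infinity>"
proof -
  define E where "E n = {0..2*pi} \<inter> ({..16 / R n} \<union> {2*pi - 16 / R n..})" for n
  define b where "b n = \<Psi> (a * G (n + 5))" for n
  have R_pos: "R n > 0" for n using R_ge_1[of n] by linarith
  have b_nonneg: "b n \<ge> 0" for n using a G_nonneg by (simp add: b_def nonneg)
  have meas[measurable]: "E n \<in> sets circ" for n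
    unfolding E_def circ_def by (auto simp: sets_restrict_space)
  have "(\<integral>\<^sup>+ t. ennreal (\<Psi> (norm (a *\<^sub>R majorant t))) \<partial>circ) 
      \<le> (\<integral>\<^sup>+ t. ennreal (\<Psi> (a * G 4)) + (\<Sum>n. ennreal (b n) * indicator (E n) t) \<partial>circ)"
  proof (rule nn_integral_mono_AE)
    show "AE t in circ. ennreal (\<Psi> (norm (a *\<^sub>R majorant t))) \<le> ennreal (\<Psi> (a * G 4)) + (\<Sum>n. ennreal (b n) * indicator (E n) t)"
      using AE_circ_interior
    proof eventually_elim
      case (elim t)
      show ?case
      proof (cases "level t")
        case 0
        then show ?thesis using a G_nonneg[of 4] by (simp add: majorant_def)
      next
        case (Suc n)
        have m: "0 < min t (2*pi - t)" using elim by auto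
        have "min t (2*pi - t) < 16 / R n" using level_Suc[OF Suc] m R_pos[of n] by (simp add: field_simps)
        then have tE: "t \<in> E n" using elim by (auto simp: E_def min_def split: if_splits)
        have "ennreal (\<Psi> (norm (a *\<^sub>R majorant t))) = ennreal (b n) * indicator (E n) t"
          using tE a G_nonneg Suc by (simp add: majorant_def b_def add.commute)
        also have "\<dots> \<le> (\<Sum>i. ennreal (b i) * indicator (E i) t)"
          using sum_le_suminf[of "\<lambda>i. ennreal (b i) * indicator (E i) t" "{n}"] 
          by (simp only: sum.insert sum.empty finite.intros empty_iff not_False_eq_True add_0_right summableI zero_le simp_thms)
        also have "\<dots> \<le> ennreal (\<Psi> (a * G 4)) + (\<Sum>i. ennreal (b i) * indicator (E i) t)" by simp
        finally show ?thesis .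
      qed
    qed
  qed
  also have "\<dots> = (\<integral>\<^sup>+ t. ennreal (\<Psi> (a * G 4)) \<partial>circ) + (\<integral>\<^sup>+ t. (\<Sum>n. ennreal (b n) * indicator (E n) t) \<partial>circ)"
    by (rule nn_integral_add) measurable
  also have "(\<integral>\<^sup>+ t. (\<Sum>n. ennreal (b n) * indicator (E n) t) \<partial>circ) = (\<Sum>n. \<integral>\<^sup>+ t. ennreal (b n) * indicator (E n) t \<partial>circ)"
    by (rule nn_integral_suminf) measurable
  also have "\<dots> = (\<Sum>n. ennreal (b n) * emeasure circ (E n))"
    by (simp add: nn_integral_cmult_indicator meas)
  also have "\<dots> \<le> (\<Sum>n. ennreal (b n * (2 * (16 / R n))))"
  proof (intro suminf_le summableI)
    fix n
    have "ennreal (b n) * emeasure circ (E n) \<le> ennreal (b n) * ennreal (2 * (16 / R n))"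
      unfolding E_def using R_pos[of n] by (intro mult_left_mono emeasure_circ_near_ends) auto
    also have "\<dots> = ennreal (b n * (2 * (16 / R n)))"
      using b_nonneg[of n] R_pos[of n] by (intro ennreal_mult[symmetric]) auto
    finally show "ennreal (b n) * emeasure circ (E n) \<le> ennreal (b n * (2 * (16 / R n)))" .
  qed
  also have "(\<integral>\<^sup>+ t. ennreal (\<Psi> (a * G 4)) \<partial>circ) + (\<Sum>n. ennreal (b n * (2 * (16 / R n)))) < \<infinity>"
  proof -
    have "summable (\<lambda>n. b n * (2 * (16 / R n)))"
    \<comment> \<open>From n \<ge> a on, n replaces the dilation a and \<open>R_large\<close>
      applies.\<close>
    proof (rule summable_comparison_test'[where N = "nat \<lceil>a\<rceil>"])
      show "summable (\<lambda>n. 64 * (1/2) ^ Suc n :: real)" by (intro summable_mult sums_summable[OF power_half_series])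
      fix n assume n: "nat \<lceil>a\<rceil> \<le> n"
      then have "a \<le> real n" by linarith
      then have "b n \<le> \<Psi> (real n * G (n + 5))" unfolding b_def
        using a G_nonneg by (intro mono mult_right_mono mult_nonneg_nonneg) auto
      then have "2 ^ n * b n \<le> R n" using R_large[of n] 
        by (meson mult_left_mono order_trans zero_le_numeral zero_le_power)
      then have "b n / R n \<le> (1/2) ^ n" using R_pos[of n] by (simp add: field_simps)
      moreover have "norm (b n * (2 * (16 / R n))) = 32 * (b n / R n)" using b_nonneg[of n] R_pos[of n] by simp
      ultimately show "norm (b n * (2 * (16 / R n))) \<le> 64 * (1/2) ^ Suc n" unfolding power_Suc by linarith
    qed
    then have "(\<Sum>n. ennreal (b n * (2 * (16 / R n)))) \<noteq> top"
      by (rule ennreal_suminf_neq_top) (intro mult_nonneg_nonneg divide_nonneg_nonneg b_nonneg less_imp_le[OF R_pos], auto)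
    then show ?thesis by (simp add: emeasure_circ ennreal_mult_eq_top_iff less_top[symmetric])
  qed
  finally show ?thesis by simp
qed

lemma majorant_in_M: "majorant \<in> orlicz_M \<Psi>"
  unfolding orlicz_M_def
proof (intro CollectI conjI allI impI majorant_measurable)
  fix C :: real assume "C > 0"
  then have "(\<integral>\<^sup>+ t. ennreal (\<Psi> (norm (inverse C *\<^sub>R majorant t))) \<partial>circ) < \<infinity>"
    by (intro majorant_modular_finite) simp
  then show "circ_modular \<Psi> (\<lambda>t. inverse C *\<^sub>R majorant t) < \<infinity>"
    unfolding circ_modular_finite_iff .
qed

lemma majorant_bound:
  assumes t: "0 < t" "t < 2*pi" and r: "0 \<le> r" "r \<le> 1"
  shows "cmod (symbol R (of_real r * cis t)) \<le> 1 - (1/2) ^ (level t + 4)"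
proof (rule cmod_symbol_le)
  show "cmod (of_real r * cis t) \<le> 1" using r by (simp add: norm_mult)
  have m: "0 < min t (2*pi - t)" using t by auto
  have "2 / cmod (1 - of_real r * cis t) \<le> 2 / (min t (2*pi - t) / 8)"
  proof (rule divide_left_mono[OF cmod_one_minus_radial_ge[OF t r]])
    have "0 < min t (2*pi - t) / 8" using m by simp
    also note cmod_one_minus_radial_ge[OF t r]
    finally have "0 < cmod (1 - of_real r * cis t)" .
    then show "0 < cmod (1 - of_real r * cis t) * (min t (2*pi - t) / 8)" using m by (intro mult_pos_pos) auto
  qed simp
  also have "\<dots> = 16 / min t (2*pi - t)" by simp
  also have "\<dots> \<le> R (level t)" by (rule level_spec)
  finally show "2 / cmod (1 - of_real r * cis t) \<le> R (level t)" .
qed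

lemma composition_bound:
  assumes "f \<in> hardy_orlicz \<Psi>" "0 < C" "circ_modular \<Psi> (\<lambda>t. inverse C *\<^sub>R bdry f t) \<le> 1"
    and "0 < t" "t < 2*pi" "0 \<le> r" "r \<le> 1"
  shows "cmod (f (symbol R (of_real r * cis t))) \<le> C * majorant t"
  unfolding majorant_def using assms by (intro G_bound majorant_bound) auto

lemma symbol_maps_disc: "symbol R ` ball 0 1 \<subseteq> ball 0 1"
  by (auto intro!: cmod_symbol_less_1)

lemma holomorphic_composition:
  assumes "f holomorphic_on ball 0 1"
  shows "(f \<circ> symbol R) holomorphic_on ball 0 1"
  by (rule holomorphic_on_compose_gen[OF holomorphic_symbol assms symbol_maps_disc])

text \<open>The symbol sends the boundary point strictly inside the disc, where f is
  continuous.\<close>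

lemma bdry_composition:
  assumes f: "f holomorphic_on ball 0 1" and t: "0 < t" "t < 2*pi"
  shows "bdry (f \<circ> symbol R) t = f (symbol R (cis t))"
proof -
  have "isCont f (symbol R (cis t))"
    using f cmod_symbol_less_1[of "cis t"]
    by (intro field_differentiable_imp_continuous_at holomorphic_on_imp_differentiable_at[of _ "ball 0 1"]) auto
  then have "((\<lambda>r. f (symbol R (of_real r * cis t))) \<longlongrightarrow> f (symbol R (cis t))) (at_left 1)"
    by (rule isCont_tendsto_compose) (rule symbol_radial_limit[OF t])
  then show ?thesis unfolding bdry_def o_def by (intro tendsto_Lim) auto
qed

lemma composition_in_hardy:
  assumes f: "f \<in> hardy_orlicz \<Psi>"
  shows "f \<circ> symbol R \<in> hardy_orlicz \<Psi>"
proof -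
  obtain C where C: "C > 0" "circ_modular \<Psi> (\<lambda>t. inverse C *\<^sub>R bdry f t) \<le> 1"
    using hardy_boundary_modular[OF f] by blast
  have hol: "f holomorphic_on ball 0 1" using f by (simp add: hardy_orlicz_def)
  show ?thesis
    by (rule dominated_in_hardy_orlicz[OF holomorphic_composition[OF hol] majorant_in_M C(1)])
      (use composition_bound[OF f C] in \<open>simp add: less_imp_le\<close>)
qed

lemma order_bounded: "order_bounded_M \<Psi> (symbol R)"
  unfolding order_bounded_M_def
proof (intro exI[of _ "\<lambda>t. 2 * majorant t"] conjI ballI impI)
  show "(\<lambda>t. 2 * majorant t) \<in> orlicz_M \<Psi>" unfolding orlicz_M_def
  proof (intro CollectI conjI allI impI)
    show "(\<lambda>t. 2 * majorant t) \<in> borel_measurable circ" using majorant_measurable by simp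
    fix C :: real assume "C > 0"
    then have "circ_modular \<Psi> (\<lambda>t. (inverse C * 2) *\<^sub>R majorant t) < \<infinity>"
      by (intro orlicz_M_scaled majorant_in_M) simp
    then show "circ_modular \<Psi> (\<lambda>t. inverse C *\<^sub>R (2 * majorant t)) < \<infinity>" by (simp only: real_scaleR_def mult.assoc)
  qed
  fix f assume f: "f \<in> hardy_orlicz \<Psi>" "hnorm \<Psi> f \<le> 1"
  have hol: "f holomorphic_on ball 0 1" using f by (simp add: hardy_orlicz_def)
  show "AE t in circ. cmod (bdry (f \<circ> symbol R) t) \<le> 2 * majorant t"
    using AE_circ_interior
  proof eventually_elim
    case (elim t)
    then show ?case using composition_bound[OF f(1) _ hnorm_le_1D[OF f], of t 1]
      by (simp add: bdry_composition[OF hol])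
  qed
qed

text \<open>Montel's theorem gives a subsequence converging to some g, known only to be holomorphic
  on the disc; the limit in H^Psi is g composed with the symbol, which inherits the majorant.
  Differences are dominated by four times the majorant, so their norms tend to 0.\<close>

lemma compact_composition: "comp_compact \<Psi> (symbol R)"
  unfolding comp_compact_def
proof (intro allI impI)
  fix F :: "nat \<Rightarrow> complex \<Rightarrow> complex"
  assume F: "\<forall>n. F n \<in> hardy_orlicz \<Psi> \<and> hnorm \<Psi> (F n) \<le> 1"
  let ?H = "{f. f \<in> hardy_orlicz \<Psi> \<and> hnorm \<Psi> f \<le> 1}"
  have hol: "f holomorphic_on ball 0 1" if "f \<in> ?H" for f using that by (simp add: hardy_orlicz_def)
  have bound: "cmod (f z) \<le> 2 * G n" if "f \<in> ?H" "cmod z \<le> 1 - (1/2) ^ n" for f z n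
    using that by (intro G_bound hnorm_le_1D) auto
  have "\<exists>B. \<forall>f\<in>?H. \<forall>z\<in>K. cmod (f z) \<le> B" if K: "compact K" "K \<subseteq> ball 0 1" for K
  proof -
    obtain r where r: "r < 1" "K \<subseteq> cball 0 r"
    proof (cases "K = {}")
      case True
      then show ?thesis by (intro that[of 0]) auto
    next
      case False
      obtain x where x: "x \<in> K" "\<And>y. y \<in> K \<Longrightarrow> cmod y \<le> cmod x"
        using continuous_attains_sup[OF K(1) False, of cmod] by (auto intro: continuous_intros)
      show ?thesis by (rule that[of "cmod x"]) (use x K(2) in auto)
    qed
    obtain n where "(1/2) ^ n < 1 - r" using real_arch_pow_inv[of "1 - r" "1/2"] r by auto
    then have "\<forall>f\<in>?H. \<forall>z\<in>K. cmod (f z) \<le> 2 * G n"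
      using bound r(2) by (intro ballI bound) (auto dest!: subsetD)
    then show ?thesis by blast
  qed
  note bounded_H = this
  obtain g \<sigma> where g: "g holomorphic_on ball 0 1" "strict_mono \<sigma>" 
      "\<And>z. z \<in> ball 0 1 \<Longrightarrow> (\<lambda>n. F (\<sigma> n) z) \<longlonglongrightarrow> g z"
    by (rule Montel[of "ball 0 1" ?H F, OF open_ball hol bounded_H]) (use F in auto)
  have g_bound: "cmod (g (symbol R (of_real r * cis t))) \<le> 2 * majorant t" 
    if "0 < t" "t < 2*pi" "0 \<le> r" "r \<le> 1" for r t
  proof (rule tendsto_upperbound)
    have "cmod (of_real r * cis t) \<le> 1" using that by (simp add: norm_mult)
    then have "symbol R (of_real r * cis t) \<in> ball 0 1" using cmod_symbol_less_1 by simp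
    from g(3)[OF this] show "(\<lambda>n. cmod (F (\<sigma> n) (symbol R (of_real r * cis t)))) \<longlonglongrightarrow> cmod (g (symbol R (of_real r * cis t)))"
      by (rule Limits.tendsto_norm)
    show "\<forall>\<^sub>F n in sequentially. cmod (F (\<sigma> n) (symbol R (of_real r * cis t))) \<le> 2 * majorant t"
      using F that by (intro always_eventually allI composition_bound hnorm_le_1D) auto
  qed auto
  have "g \<circ> symbol R \<in> hardy_orlicz \<Psi>"
    by (rule dominated_in_hardy_orlicz[OF holomorphic_composition[OF g(1)] majorant_in_M, of 2])
      (use g_bound in auto)
  moreover have "(\<lambda>n. lux_norm \<Psi> (\<lambda>t. bdry (F (\<sigma> n) \<circ> symbol R) t - bdry (g \<circ> symbol R) t)) \<longlonglongrightarrow> 0"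
  proof (rule lux_norm_tendsto_0[OF _ majorant_in_M])
    have holF: "F n holomorphic_on ball 0 1" for n using F by (simp add: hardy_orlicz_def)
    have circ: "symbol R (cis t) \<in> ball 0 1" for t using cmod_symbol_less_1[of "cis t"] by simp
    have cont: "continuous_on {0<..<2*pi} (bdry (f \<circ> symbol R))" if f: "f holomorphic_on ball 0 1" for f
    proof -
      have "continuous_on {0<..<2*pi} (\<lambda>t. symbol R (cis t))"
        by (intro continuous_on_compose2[OF continuous_symbol] continuous_intros) (auto dest: cis_neq_1)
      then have "continuous_on {0<..<2*pi} (\<lambda>t. f (symbol R (cis t)))"
        by (rule continuous_on_compose2[OF holomorphic_on_imp_continuous_on[OF f]]) (use circ in auto)
      then show ?thesis by (rule continuous_on_eq) (simp add: bdry_composition[OF f])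
    qed
    show "continuous_on {0<..<2*pi} (\<lambda>t. bdry (F (\<sigma> n) \<circ> symbol R) t - bdry (g \<circ> symbol R) t)" for n
      by (intro continuous_intros cont holF g(1))
    show "cmod (bdry (F (\<sigma> n) \<circ> symbol R) t - bdry (g \<circ> symbol R) t) \<le> 4 * majorant t" if t: "0 < t" "t < 2*pi" for n t
    proof -
      have "cmod (F (\<sigma> n) (symbol R (cis t))) \<le> 2 * majorant t"
        using composition_bound[of "F (\<sigma> n)" 2 t 1] F t hnorm_le_1D by simp
      moreover have "cmod (g (symbol R (cis t))) \<le> 2 * majorant t" using g_bound[of t 1] t by simp
      ultimately show ?thesis unfolding bdry_composition[OF holF t] bdry_composition[OF g(1) t]
        using norm_triangle_ineq4[of "F (\<sigma> n) (symbol R (cis t))" "g (symbol R (cis t))"] by linarith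
    qed
    show "(\<lambda>n. bdry (F (\<sigma> n) \<circ> symbol R) t - bdry (g \<circ> symbol R) t) \<longlonglongrightarrow> 0" if t: "0 < t" "t < 2*pi" for t
      unfolding bdry_composition[OF holF t] bdry_composition[OF g(1) t]
      using g(3)[OF circ[of t]] by (rule LIM_zero)
  qed auto
  ultimately show "\<exists>\<sigma> g. strict_mono \<sigma> \<and> g \<in> hardy_orlicz \<Psi> \<and>
     (\<lambda>n. lux_norm \<Psi> (\<lambda>t. bdry (F (\<sigma> n) \<circ> symbol R) t - bdry g t)) \<longlonglongrightarrow> 0"
    using g(2) by blast
qed

end

section \<open>Weakly summable bumps\<close>

definition dirichlet_mean :: "nat \<Rightarrow> complex \<Rightarrow> complex" where
  "dirichlet_mean N z = (\<Sum>k<N. z ^ k) / of_nat N"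

text \<open>On the unit circle its modulus is the Fejer kernel centred at the j-th of the N-th roots
  of unity, divided by N. The square turns the sum of the moduli over j into a Parseval sum.\<close>

definition bump :: "nat \<Rightarrow> nat \<Rightarrow> complex \<Rightarrow> complex" where
  "bump N j z = (dirichlet_mean N (z * cis (- (2 * pi * real j / real N))))\<^sup>2"

text \<open>A geometric sum whose ratio is an N-th root of unity different from 1.\<close>

lemma sum_roots_of_unity_eq_0:
  assumes "k < N" "l < N" "k \<noteq> l"
  shows "(\<Sum>j<N. cis (2 * pi * real j * (real k - real l) / real N)) = 0"
proof -
  let ?x = "cis (2 * pi * (real k - real l) / real N)"
  have N: "real N > 0" using assms by simp
  have "?x \<noteq> 1"
  proof
    assume "?x = 1"
    then have "cos (2 * pi * (real k - real l) / real N) = 1" by (simp add: complex_eq_iff)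
    then obtain i :: int where "2 * pi * (real k - real l) / real N = of_int i * 2 * pi"
      unfolding cos_one_2pi_int by blast
    then have "(2 * pi) * (real k - real l) = (2 * pi) * (of_int i * real N)" using N by (simp add: field_simps)
    then have "real k - real l = of_int i * real N" by (subst (asm) mult_cancel_left) simp
    then have "of_int (int k - int l) = (of_int (i * int N) :: real)" by simp
    then have eq: "int k - int l = i * int N" by (simp only: of_int_eq_iff)
    have "\<bar>int k - int l\<bar> < int N" "int k - int l \<noteq> 0" using assms by auto
    with eq have "\<bar>i\<bar> * int N < 1 * int N" "i \<noteq> 0" by (auto simp: abs_mult)
    then show False using N by (simp only: mult_less_cancel_right) auto
  qed
  moreover have "?x ^ N = 1"
  proof -
    have "?x ^ N = cis (2 * pi * (real k - real l))" using N by (simp add: Complex.DeMoivre)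
    also have "\<dots> = 1" by (rule cis_multiple_2pi) auto
    finally show ?thesis .
  qed
  ultimately have "(\<Sum>j<N. ?x ^ j) = 0" by (simp add: geometric_sum)
  moreover have "?x ^ j = cis (2 * pi * real j * (real k - real l) / real N)" for j
    by (simp add: Complex.DeMoivre mult_ac)
  ultimately show ?thesis by simp
qed

lemma cmod_bump: "cmod (bump N j z) = (cmod (\<Sum>k<N. z ^ k * cis (- (2 * pi * real j / real N * real k))))\<^sup>2 / (real N)\<^sup>2"
proof -
  have "(z * cis (- (2 * pi * real j / real N))) ^ k = z ^ k * cis (- (2 * pi * real j / real N * real k))" for k
    by (simp add: power_mult_distrib Complex.DeMoivre mult_ac)
  then show ?thesis unfolding bump_def dirichlet_mean_def by (simp add: norm_power norm_divide power_divide)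
qed

text \<open>Parseval on the group of \<open>N\<close>-th roots of unity.\<close>

lemma sum_cmod_bump_le_1:
  assumes z: "cmod z \<le> 1" and N: "N > 0"
  shows "(\<Sum>j<N. cmod (bump N j z)) \<le> 1"
proof -
  let ?e = "\<lambda>j k. cis (- (2 * pi * real j / real N * real k))"
  let ?S = "\<lambda>j. \<Sum>k<N. z ^ k * ?e j k"
  have ee: "?e j k * cnj (?e j l) = cis (2 * pi * real j * (real l - real k) / real N)" for j k l
    unfolding cis_cnj cis_mult by (rule arg_cong[of _ _ cis]) (simp add: field_simps diff_divide_distrib)
  have "of_real (\<Sum>j<N. (cmod (?S j))\<^sup>2) = (\<Sum>j<N. ?S j * cnj (?S j))"
    by (simp only: of_real_sum complex_norm_square)
  also have "\<dots> = (\<Sum>j<N. \<Sum>k<N. \<Sum>l<N. (z ^ k * cnj (z ^ l)) * cis (2 * pi * real j * (real l - real k) / real N))"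
    unfolding cnj_sum sum_product complex_cnj_mult ee[symmetric] by (simp only: mult_ac)
  also have "\<dots> = (\<Sum>k<N. \<Sum>j<N. \<Sum>l<N. (z ^ k * cnj (z ^ l)) * cis (2 * pi * real j * (real l - real k) / real N))"
    by (rule sum.swap)
  also have "\<dots> = (\<Sum>k<N. \<Sum>l<N. \<Sum>j<N. (z ^ k * cnj (z ^ l)) * cis (2 * pi * real j * (real l - real k) / real N))"
    by (intro sum.cong refl sum.swap)
  also have "\<dots> = (\<Sum>k<N. \<Sum>l<N. if l = k then (z ^ k * cnj (z ^ k)) * of_nat N else 0)"
  proof (intro sum.cong refl)
    fix k l assume "k \<in> {..<N}" "l \<in> {..<N}"
    then show "(\<Sum>j<N. (z ^ k * cnj (z ^ l)) * cis (2 * pi * real j * (real l - real k) / real N)) 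
       = (if l = k then (z ^ k * cnj (z ^ k)) * of_nat N else 0)"
      using sum_roots_of_unity_eq_0[of l N k] by (auto simp: sum_distrib_left[symmetric])
  qed
  also have "\<dots> = (\<Sum>k<N. (z ^ k * cnj (z ^ k)) * of_nat N)" by (simp add: sum.delta)
  also have "\<dots> = of_real (\<Sum>k<N. (cmod (z ^ k))\<^sup>2 * real N)"
    by (simp only: of_real_sum of_real_mult complex_norm_square of_real_of_nat_eq)
  finally have "(\<Sum>j<N. (cmod (?S j))\<^sup>2) = (\<Sum>k<N. (cmod (z ^ k))\<^sup>2 * real N)" by (simp only: of_real_eq_iff)
  also have "\<dots> \<le> (\<Sum>k<N. 1 * real N)"
    using z by (intro sum_mono mult_right_mono power_le_one) (auto simp: norm_power power_le_one)
  also have "\<dots> = (real N)\<^sup>2" by (simp add: power2_eq_square)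
  finally show ?thesis unfolding cmod_bump using N by (simp flip: sum_divide_distrib)
qed

text \<open>Within 1 / (4 N) of the centre every power below N stays within 1/4 of 1, hence so does
  the mean, and (3/4)^2 exceeds 1/2.\<close>

lemma cmod_bump_ge:
  assumes z: "cmod z \<le> 1" and N: "N > 0" and near: "cmod (z - cis (2 * pi * real j / real N)) \<le> 1 / (4 * real N)"
  shows "cmod (bump N j z) \<ge> 1/2"
proof -
  let ?w = "z * cis (- (2 * pi * real j / real N))"
  have w: "cmod ?w \<le> 1" using z by (simp add: norm_mult)
  have "?w - 1 = (z - cis (2 * pi * real j / real N)) * cis (- (2 * pi * real j / real N))"
    by (simp add: left_diff_distrib cis_mult)
  then have w1: "cmod (?w - 1) \<le> 1 / (4 * real N)" using near by (simp add: norm_mult)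
  have "dirichlet_mean N ?w - 1 = (\<Sum>k<N. ?w ^ k - 1) / of_nat N"
    using N unfolding dirichlet_mean_def by (simp add: sum_subtractf diff_divide_distrib)
  then have "cmod (dirichlet_mean N ?w - 1) = cmod (\<Sum>k<N. ?w ^ k - 1) / real N"
    by (simp add: norm_divide)
  also have "\<dots> \<le> (\<Sum>k<N. 1/4) / real N"
  proof (intro divide_right_mono sum_norm_le)
    fix k assume k: "k \<in> {..<N}"
    have "cmod (?w ^ k - 1 ^ k) \<le> real k * cmod (?w - 1)" using w by (intro norm_power_diff) auto
    also have "\<dots> \<le> real N * (1 / (4 * real N))" using k w1 by (intro mult_mono) auto
    also have "\<dots> = 1/4" using N by simp
    finally show "cmod (?w ^ k - 1) \<le> 1/4" by simp
  qed simp
  also have "\<dots> = 1/4" using N by simp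
  finally have "cmod (dirichlet_mean N ?w - 1) \<le> 1/4" .
  then have "3/4 \<le> cmod (dirichlet_mean N ?w)"
    using norm_triangle_ineq2[of 1 "dirichlet_mean N ?w"] by (simp add: norm_minus_commute)
  then have "(3/4)\<^sup>2 \<le> (cmod (dirichlet_mean N ?w))\<^sup>2" by (intro power_mono) auto
  moreover have "1/2 \<le> (3/4::real)\<^sup>2" by (simp add: power2_eq_square)
  ultimately show ?thesis unfolding bump_def norm_power by linarith
qed

lemma holomorphic_bump: "bump N j holomorphic_on A"
  unfolding bump_def[abs_def] dirichlet_mean_def by (cases "N = 0") (auto intro!: holomorphic_intros)

section \<open>Upper and lower norm estimates for bounded functions and test families\<close>

context orlicz
begin

lemma bounded_in_hardy:
  assumes g: "g holomorphic_on UNIV" and K: "\<And>z. cmod z \<le> 1 \<Longrightarrow> cmod (g z) \<le> K" "K > 0" and \<kappa>: "0 < \<kappa>" "\<Psi> \<kappa> \<le> 1"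
  shows "g \<in> hardy_orlicz \<Psi>" "hnorm \<Psi> g \<le> K / \<kappa>" "\<exists>C>0. circ_modular \<Psi> (\<lambda>t. inverse C *\<^sub>R bdry g t) \<le> 1"
proof -
  have hol: "g holomorphic_on ball 0 1" using g by (rule holomorphic_on_subset) simp
  have bd: "bdry g t = g (cis t)" for t
  proof -
    have "isCont g (of_real 1 * cis t)"
      using g by (intro field_differentiable_imp_continuous_at holomorphic_on_imp_differentiable_at[of _ UNIV]) auto
    then have "((\<lambda>r. g (of_real r * cis t)) \<longlongrightarrow> g (of_real 1 * cis t)) (at_left 1)"
      by (rule isCont_tendsto_compose) (intro tendsto_intros)
    then show ?thesis unfolding bdry_def by (intro tendsto_Lim) auto
  qed
  have pos: "K / \<kappa> > 0" using K \<kappa> by simp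
  have mod: "circ_modular \<Psi> (\<lambda>t. inverse (K / \<kappa>) *\<^sub>R circle_restr g r t) \<le> 1" if r: "0 \<le> r" "r < 1" for r
    by (rule modular_le_1_of_bounded[OF _ K(2) \<kappa>]) (use r in \<open>auto simp: circle_restr_def norm_mult intro!: K(1)\<close>)
  have mod_b: "circ_modular \<Psi> (\<lambda>t. inverse (K / \<kappa>) *\<^sub>R bdry g t) \<le> 1"
    by (rule modular_le_1_of_bounded[OF _ K(2) \<kappa>]) (auto simp: bd intro!: K(1))
  then show "hnorm \<Psi> g \<le> K / \<kappa>" unfolding hnorm_def by (rule lux_norm_le[OF pos])
  show "\<exists>C>0. circ_modular \<Psi> (\<lambda>t. inverse C *\<^sub>R bdry g t) \<le> 1" using pos mod_b by blast
  show "g \<in> hardy_orlicz \<Psi>" unfolding hardy_orlicz_def orlicz_L_def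
  proof (intro CollectI conjI exI[of _ "K / \<kappa>"] allI impI hol)
    fix r :: real assume r: "0 \<le> r \<and> r < 1"
    show "circle_restr g r \<in> borel_measurable circ"
      using r by (intro continuous_on_measurable_circ continuous_circle_restr hol) auto
    show "lux_norm \<Psi> (circle_restr g r) \<le> K / \<kappa>" using r by (intro lux_norm_le pos mod) auto
    show "circ_modular \<Psi> (\<lambda>t. inverse (K / \<kappa>) *\<^sub>R circle_restr g r t) < \<infinity>"
      using r by (intro le_less_trans[OF mod]) auto
  qed (rule pos)
qed

text \<open>Multiplying f j by the conjugate sign of L (f j) makes the sum of moduli equal to L of a
  single function bounded by 1 on the closed disc, whose norm is at most 1 / \<kappa>.\<close>

lemma weakly_1_summable:
  fixes f :: "nat \<Rightarrow> complex \<Rightarrow> complex"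
  assumes hol: "\<And>j. f j holomorphic_on UNIV" and sum: "\<And>z. cmod z \<le> 1 \<Longrightarrow> (\<Sum>j<N. cmod (f j z)) \<le> 1"
    and \<kappa>: "0 < \<kappa>" "\<Psi> \<kappa> \<le> 1" and L: "L \<in> hardy_dual_ball \<Psi>"
  shows "(\<Sum>j<N. cmod (L (f j))) \<le> 1 / \<kappa>"
proof -
  define e where "e j = cnj (sgn (L (f j)))" for j
  have e: "e j * L (f j) = of_real (cmod (L (f j)))" for j
  proof (cases "L (f j) = 0")
    case False
    have "cnj (L (f j)) * L (f j) = of_real ((cmod (L (f j)))\<^sup>2)" by (simp only: complex_norm_square mult.commute)
    then show ?thesis using False by (simp add: e_def sgn_eq field_simps power2_eq_square)
  qed (simp add: e_def)
  have e_le: "cmod (e j) \<le> 1" for j by (simp add: e_def norm_sgn)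
  define g where "g M z = (\<Sum>j<M. e j * f j z)" for M z
  have g_hol: "g M holomorphic_on UNIV" for M
    unfolding g_def[abs_def] by (intro holomorphic_intros hol)
  have g_le: "cmod (g M z) \<le> 1" if z: "cmod z \<le> 1" and M: "M \<le> N" for M z
  proof -
    have "cmod (g M z) \<le> (\<Sum>j<M. cmod (f j z))" unfolding g_def
    proof (rule sum_norm_le)
      fix j show "cmod (e j * f j z) \<le> cmod (f j z)"
        unfolding norm_mult using mult_right_mono[OF e_le[of j], of "cmod (f j z)"] by simp
    qed
    also have "\<dots> \<le> (\<Sum>j<N. cmod (f j z))" using M by (intro sum_mono2) auto
    finally show ?thesis using sum[OF z] by linarith
  qed
  have g_in: "g M \<in> hardy_orlicz \<Psi>" if "M \<le> N" for M
    using g_le that by (intro bounded_in_hardy(1)[OF g_hol _ zero_less_one \<kappa>]) auto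
  have f_in: "f j \<in> hardy_orlicz \<Psi>" if j: "j < N" for j
  proof (rule bounded_in_hardy(1)[OF hol _ zero_less_one \<kappa>])
    fix z :: complex assume z: "cmod z \<le> 1"
    have "cmod (f j z) \<le> (\<Sum>j<N. cmod (f j z))" using j by (intro member_le_sum) auto
    with sum[OF z] show "cmod (f j z) \<le> 1" by linarith
  qed
  have add: "\<And>u v. u \<in> hardy_orlicz \<Psi> \<Longrightarrow> v \<in> hardy_orlicz \<Psi> \<Longrightarrow> L (\<lambda>z. u z + v z) = L u + L v"
    and scale: "\<And>u c. u \<in> hardy_orlicz \<Psi> \<Longrightarrow> L (\<lambda>z. c * u z) = c * L u"
    and bound: "\<And>u. u \<in> hardy_orlicz \<Psi> \<Longrightarrow> cmod (L u) \<le> hnorm \<Psi> u"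
    using L unfolding hardy_dual_ball_def by blast+
  \<comment> \<open>Elements of the dual ball are additive for two summands at a time, and only
    within the space; hence the induction with membership of every partial sum.\<close>
  have Lg: "L (g M) = (\<Sum>j<M. e j * L (f j))" if "M \<le> N" for M
    using that
  proof (induction M)
    case 0
    \<comment> \<open>Homogeneity with the scalar 0 shows that L vanishes at the zero
      function.\<close>
    have "L (\<lambda>z. 0 * g 0 z) = 0 * L (g 0)" by (rule scale[OF g_in]) simp
    then show ?case by (simp add: g_def[abs_def])
  next
    case (Suc M)
    have efj: "(\<lambda>z. e M * f M z) \<in> hardy_orlicz \<Psi>"
    proof (rule bounded_in_hardy(1)[OF _ _ zero_less_one \<kappa>])
      show "(\<lambda>z. e M * f M z) holomorphic_on UNIV" by (intro holomorphic_intros hol)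
      fix z :: complex assume z: "cmod z \<le> 1"
      have "cmod (e M * f M z) \<le> 1 * cmod (f M z)" unfolding norm_mult by (intro mult_right_mono e_le) auto
      also have "\<dots> \<le> (\<Sum>j<N. cmod (f j z))" using Suc.prems member_le_sum[of M "{..<N}" "\<lambda>j. cmod (f j z)"] by simp
      finally show "cmod (e M * f M z) \<le> 1" using sum[OF z] by linarith
    qed
    have "g (Suc M) = (\<lambda>z. g M z + e M * f M z)" by (simp add: g_def fun_eq_iff)
    then have "L (g (Suc M)) = L (g M) + e M * L (f M)"
      using add[OF g_in efj] scale[OF f_in, of M "e M"] Suc.prems by simp
    then show ?case using Suc by simp
  qed
  have "of_real (\<Sum>j<N. cmod (L (f j))) = L (g N)" using Lg[of N] by (simp add: e)
  then have "\<bar>\<Sum>j<N. cmod (L (f j))\<bar> = cmod (L (g N))" by (metis norm_of_real)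
  also have "\<dots> \<le> hnorm \<Psi> (g N)" by (intro bound g_in) simp
  also have "\<dots> \<le> 1 / \<kappa>" using g_le by (intro bounded_in_hardy(2)[OF g_hol _ zero_less_one \<kappa>]) auto
  finally show ?thesis by linarith
qed

text \<open>For C below 1 / (2 X) the quotient |h| / C is at least X on [t1, t0], which pushes the
  modular above 1.\<close>

lemma lux_norm_ge:
  fixes h :: "real \<Rightarrow> complex"
  assumes ex: "\<exists>C>0. circ_modular \<Psi> (\<lambda>t. inverse C *\<^sub>R h t) \<le> 1"
    and t: "0 \<le> t1" "t1 \<le> t0" "t0 \<le> 2*pi" and h: "\<And>t. t1 \<le> t \<Longrightarrow> t \<le> t0 \<Longrightarrow> cmod (h t) \<ge> 1/2"
    and X: "X > 0" "\<Psi> X * (t0 - t1) > 2 * pi"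
  shows "lux_norm \<Psi> h \<ge> 1 / (2 * X)"
  unfolding lux_norm_def
proof (rule cInf_greatest)
  show "{C. 0 < C \<and> circ_modular \<Psi> (\<lambda>t. inverse C *\<^sub>R h t) \<le> 1} \<noteq> {}" using ex by blast
  fix C assume "C \<in> {C. 0 < C \<and> circ_modular \<Psi> (\<lambda>t. inverse C *\<^sub>R h t) \<le> 1}"
  then have C: "0 < C" "(\<integral>\<^sup>+ t. ennreal (\<Psi> (norm (inverse C *\<^sub>R h t))) \<partial>circ) \<le> ennreal (2*pi)"
    by (auto simp: circ_modular_le_1_iff simp del: norm_scaleR)
  show "1 / (2 * X) \<le> C"
  proof (rule ccontr)
    assume "\<not> 1 / (2 * X) \<le> C"
    then have CX: "X * C \<le> 1/2" using X C by (simp add: field_simps)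
    have "ennreal (\<Psi> X * (t0 - t1)) = ennreal (\<Psi> X) * emeasure circ {t1..t0}"
      using t nonneg[of X] X(1) by (simp add: circ_def emeasure_restrict_space ennreal_mult)
    also have "\<dots> = (\<integral>\<^sup>+ t. ennreal (\<Psi> X) * indicator {t1..t0} t \<partial>circ)"
      using t by (intro nn_integral_cmult_indicator[symmetric]) (auto simp: circ_def sets_restrict_space_iff)
    also have "\<dots> \<le> (\<integral>\<^sup>+ t. ennreal (\<Psi> (norm (inverse C *\<^sub>R h t))) \<partial>circ)"
    proof (rule nn_integral_mono)
      fix t
      show "ennreal (\<Psi> X) * indicator {t1..t0} t \<le> ennreal (\<Psi> (norm (inverse C *\<^sub>R h t)))"
      proof (cases "t \<in> {t1..t0}")
        case True
        then have "X * C \<le> cmod (h t)" using h[of t] CX by auto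
        then have "X \<le> norm (inverse C *\<^sub>R h t)" using C(1) by (simp add: field_simps)
        then have "\<Psi> X \<le> \<Psi> (norm (inverse C *\<^sub>R h t))" using X(1) by (intro mono) auto
        then show ?thesis using True by (simp add: ennreal_leI del: norm_scaleR)
      qed simp
    qed
    also have "\<dots> \<le> ennreal (2*pi)" by (rule C(2))
    finally have "\<Psi> X * (t0 - t1) \<le> 2 * pi" by (subst (asm) ennreal_le_iff) auto
    with X(2) show False by linarith
  qed
qed

end

lemma cmod_cis_diff_le: "cmod (cis a - cis b) \<le> \<bar>a - b\<bar>"
proof -
  have "cis a - cis b = cis b * (cis (a - b) - 1)" by (simp add: right_diff_distrib cis_mult)
  then have "cmod (cis a - cis b) = cmod (exp (\<i> * of_real (a - b)) - 1)" by (simp add: norm_mult cis_conv_exp)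
  also have "\<dots> = 2 * \<bar>sin ((a - b) / 2)\<bar>" using dist_exp_i_1[of "a - b"] by simp
  also have "\<dots> \<le> 2 * \<bar>(a - b) / 2\<bar>" using abs_sin_x_le_abs_x[of "(a-b)/2"] by linarith
  finally show ?thesis by simp
qed

section \<open>Arcs on which the symbol is close to a given point of the circle\<close>

context pole_radii
begin

text \<open>On the boundary the symbol at height \<open>y\<close> of the half plane has modulus near \<open>1\<close> and argument
  \<open>- \<theta> y\<close>, where \<open>\<theta> y - y\<close> is bounded, so every direction is hit within one period.\<close>

lemma symbol_near_boundary_point:
  "\<exists>t1 t0. 0 < t1 \<and> t1 \<le> t0 \<and> t0 < 2*pi \<and> 1 / (144 * 2 ^ m * (2 ^ m * R m)\<^sup>2) \<le> t0 - t1 \<and>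
     (\<forall>t. t1 \<le> t \<and> t \<le> t0 \<longrightarrow> cmod (symbol R (cis t) - cis \<tau>) \<le> 4 * (1/2) ^ m)"
proof -
  \<comment> \<open>From height Y on, the real part of the pole sum is at most 2 (1/2)^m.\<close>
  define Y where "Y = 2 ^ m * R m"
  have "1 * 1 \<le> Y" unfolding Y_def using R_ge_1[of m] by (intro mult_mono) auto
  then have Y: "Y \<ge> 1" by simp
  define S where "S y = pole_sum R (\<i> * of_real y)" for y :: real
  define \<theta> where "\<theta> y = y + Im (S y)" for y
  have S_le: "cmod (S y) \<le> 1" for y unfolding S_def by (rule cmod_pole_sum_le) simp
  have S_lip: "cmod (S y - S y') \<le> \<bar>y - y'\<bar>" for y y'
  proof -
    have "cmod (S y - S y') \<le> cmod (\<i> * of_real y - \<i> * of_real y')"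
      unfolding S_def by (rule pole_sum_lipschitz) auto
    also have "\<i> * of_real y - \<i> * of_real y' = \<i> * of_real (y - y')" by (simp add: algebra_simps)
    also have "cmod \<dots> = \<bar>y - y'\<bar>" by (simp only: norm_mult norm_ii norm_of_real mult_1_left)
    finally show ?thesis .
  qed
  have cont\<theta>: "continuous_on A \<theta>" for A
  proof -
    have "continuous_on A S" unfolding S_def
      by (rule continuous_on_compose2[OF continuous_pole_sum]) (auto intro!: continuous_intros)
    then show ?thesis unfolding \<theta>_def by (intro continuous_intros)
  qed
  have \<theta>_near: "\<bar>\<theta> y - y\<bar> \<le> 1" for y
    using S_le[of y] abs_Im_le_cmod[of "S y"] by (simp add: \<theta>_def)
  \<comment> \<open>i selects the representative c of -\<tau> modulo 2 pi between Y + 1 and Y + 1 +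
    2 pi, so that the phase \<theta> starts below c at height Y.\<close>
  define i where "i = \<lceil>(Y + 1 + \<tau>) / (2 * pi)\<rceil>"
  define c where "c = 2 * pi * of_int i - \<tau>"
  have "(Y + 1 + \<tau>) / (2 * pi) \<le> of_int i" "of_int i < (Y + 1 + \<tau>) / (2 * pi) + 1"
    unfolding i_def by linarith+
  then have c: "Y + 1 \<le> c" "c \<le> Y + 1 + 2 * pi" unfolding c_def by (simp_all add: field_simps)
  have cis_c: "cis (- c) = cis \<tau>"
  proof -
    have "cis (- c) = cis \<tau> * cis (2 * pi * of_int (- i))" by (simp add: cis_mult c_def)
    also have "cis (2 * pi * of_int (- i)) = 1" by (rule cis_multiple_2pi) simp
    finally show ?thesis by simp
  qed
  \<comment> \<open>The window has length 2 + 2 pi: one period plus an error of 1 at either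
    end.\<close>
  have "\<exists>y. Y \<le> y \<and> y \<le> Y + 2 + 2 * pi \<and> \<theta> y = c"
  proof (rule IVT')
    show "\<theta> Y \<le> c" using \<theta>_near[of Y] c by linarith
    show "c \<le> \<theta> (Y + 2 + 2 * pi)" using \<theta>_near[of "Y + 2 + 2 * pi"] c by linarith
  qed (use pi_gt_zero in \<open>auto intro: cont\<theta>\<close>)
  then obtain y0 where y0: "Y \<le> y0" "y0 \<le> Y + 2 + 2 * pi" "\<theta> y0 = c" by blast
  define \<eta> :: real where "\<eta> = (1/2) ^ m"
  have \<eta>: "0 < \<eta>" "\<eta> \<le> 1" by (simp_all add: \<eta>_def power_le_one)
  have y0_pos: "0 < y0" "1 \<le> y0" using y0 Y by auto
  \<comment> \<open>On the circle the height is y = cot (t/2), so heights from y0 to y0 + \<eta>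
    correspond to tan (t/2) between a and b.\<close>
  define a b where "a = 1 / (y0 + \<eta>)" and "b = 1 / y0"
  have ab: "0 < a" "a < b" "b \<le> 1" using y0_pos \<eta> by (simp_all add: a_def b_def field_simps)
  have near: "cmod (symbol R (cis t) - cis \<tau>) \<le> 4 * (1/2) ^ m" if t: "2 * arctan a \<le> t" "t \<le> 2 * arctan b" for t
  proof -
    have "0 < arctan a" using ab by simp
    then have t': "0 < t" "t < pi" using t arctan_ubound[of b] by linarith+
    define y where "y = cos (t/2) / sin (t/2)"
    have sin: "sin (t/2) > 0" using t' by (intro sin_gt_zero) auto
    have cos: "cos (t/2) > 0" using t' by (intro cos_gt_zero) auto
    have "tan (arctan a) \<le> tan (t/2)" 
      using t t' arctan_lbound[of a] by (intro tan_mono_le) auto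
    then have "a \<le> tan (t/2)" by (simp only: tan_arctan)
    moreover have "tan (t/2) \<le> tan (arctan b)" 
      using t t' arctan_ubound[of b] by (intro tan_mono_le) auto
    then have "tan (t/2) \<le> b" by (simp only: tan_arctan)
    moreover have tany: "tan (t/2) = 1 / y" using sin cos by (simp add: y_def tan_def)
    moreover have ypos: "0 < y" using sin cos by (simp add: y_def)
    ultimately have y: "y0 \<le> y" "y \<le> y0 + \<eta>" 
      using y0_pos \<eta> by (simp_all add: a_def b_def field_simps)
    have cay: "cayley (cis t) = \<i> * of_real y" unfolding y_def using t' by (intro cayley_cis) auto
    have sym: "symbol R (cis t) = of_real (exp (- Re (S y))) * cis (- \<theta> y)"
    proof -
      have "- (\<i> * of_real y + S y) = of_real (- Re (S y)) + \<i> * of_real (- \<theta> y)"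
        by (simp add: complex_eq_iff \<theta>_def)
      then have "symbol R (cis t) = exp (of_real (- Re (S y)) + \<i> * of_real (- \<theta> y))"
        unfolding symbol_def cay S_def[symmetric] by (simp only:)
      then show ?thesis by (simp only: exp_add cis_conv_exp exp_of_real)
    qed
    have ReS: "0 \<le> Re (S y)" "Re (S y) \<le> 2 * (1/2) ^ m"
    proof -
      show "Re (S y) \<le> 2 * (1/2) ^ m" unfolding S_def
        by (rule Re_pole_sum_imaginary_le) (use y y0 in \<open>simp add: Y_def\<close>)
      have "0 \<le> (\<Sum>n. Re (pole_term n (\<i> * of_real y)))"
        by (intro suminf_nonneg summable_Re_pole_term Re_pole_term_nonneg) auto
      then show "0 \<le> Re (S y)" unfolding S_def by (subst Re_pole_sum) auto
    qed
    have "cmod (symbol R (cis t) - cis (- \<theta> y)) = \<bar>exp (- Re (S y)) - 1\<bar>"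
    proof -
      have "symbol R (cis t) - cis (- \<theta> y) = of_real (exp (- Re (S y)) - 1) * cis (- \<theta> y)"
        unfolding sym by (simp add: left_diff_distrib)
      then show ?thesis by (simp only: norm_mult norm_of_real norm_cis mult_1_right)
    qed
    also have "\<dots> \<le> Re (S y)"
      using ReS(1) exp_ge_add_one_self[of "- Re (S y)"] by simp
    finally have 1: "cmod (symbol R (cis t) - cis (- \<theta> y)) \<le> 2 * (1/2) ^ m" using ReS by linarith
    have "cmod (cis (- \<theta> y) - cis \<tau>) \<le> \<bar>- \<theta> y - (- c)\<bar>"
      unfolding cis_c[symmetric] by (rule cmod_cis_diff_le)
    also have "\<dots> = \<bar>(y - y0) + Im (S y - S y0)\<bar>" using y0(3) by (simp add: \<theta>_def)
    \<comment> \<open>Both y and Im (S y) move by at most \<eta>, since the pole sum is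
      1-Lipschitz.\<close>
    also have "\<dots> \<le> 2 * \<eta>" using S_lip[of y y0] abs_Im_le_cmod[of "S y - S y0"] y by linarith
    finally have 2: "cmod (cis (- \<theta> y) - cis \<tau>) \<le> 2 * (1/2) ^ m" by (simp add: \<eta>_def)
    show ?thesis using norm_diff_triangle_le[OF 1 2] by simp
  qed
  have len: "1 / (144 * 2 ^ m * (2 ^ m * R m)\<^sup>2) \<le> 2 * arctan b - 2 * arctan a"
  proof -
    obtain x where x: "a < x" "x < b" "arctan b - arctan a = (b - a) * inverse (1 + x\<^sup>2)"
      using MVT2[OF ab(2), of arctan "\<lambda>x. inverse (1 + x\<^sup>2)"] DERIV_arctan by blast
    have "x\<^sup>2 \<le> 1" using x ab by (intro power_le_one) auto
    moreover have "0 < 1 + x\<^sup>2" using zero_le_power2[of x] by linarith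
    ultimately have "inverse 2 \<le> inverse (1 + x\<^sup>2)" by (intro le_imp_inverse_le) auto
    then have "1/2 \<le> inverse (1 + x\<^sup>2)" by simp
    then have "(b - a) * (1/2) \<le> arctan b - arctan a" unfolding x(3) using ab by (intro mult_left_mono) auto
    then have 1: "b - a \<le> 2 * arctan b - 2 * arctan a" by simp
    \<comment> \<open>By pi < 4, the excess 2 + 2 pi + \<eta> is at most 11, hence at most 11 Y; the
      square of 12 is the constant 144.\<close>
    have "y0 \<le> 12 * Y" "y0 + \<eta> \<le> 12 * Y" using y0 \<eta> Y pi_less_4 by linarith+
    then have "y0 * (y0 + \<eta>) \<le> (12 * Y) * (12 * Y)" using y0_pos \<eta> by (intro mult_mono) auto
    then have "\<eta> / ((12 * Y) * (12 * Y)) \<le> \<eta> / (y0 * (y0 + \<eta>))"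
      using \<eta> y0_pos Y by (intro divide_left_mono mult_pos_pos) auto
    also have "\<dots> = b - a" using y0_pos \<eta> by (simp add: a_def b_def field_simps)
    finally have "\<eta> / ((12 * Y) * (12 * Y)) \<le> b - a" .
    moreover have "\<eta> / ((12 * Y) * (12 * Y)) = 1 / (144 * 2 ^ m * Y\<^sup>2)"
      by (simp add: \<eta>_def power2_eq_square power_divide)
    ultimately show ?thesis using 1 by (simp add: Y_def)
  qed
  show ?thesis
  proof (rule exI[of _ "2 * arctan a"], rule exI[of _ "2 * arctan b"], intro conjI allI impI)
    show "0 < 2 * arctan a" using ab by simp
    show "2 * arctan a \<le> 2 * arctan b" using ab by (simp add: arctan_le_iff)
    show "2 * arctan b < 2 * pi" using arctan_ubound[of b] pi_gt_zero by linarith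
  qed (use len near in auto)
qed

end

section \<open>Failure of summability\<close>

context admissible_radii
begin

text \<open>The shift to n + 4 turns the accuracy 4 (1/2)^(n+4) into 1 / (4 2^n), the radius in
  \<open>cmod_bump_ge\<close>. On the resulting arc the bump is at least 1/2, and \<open>big\<close>
  lets \<Psi> X outweigh the reciprocal of the arc length.\<close>

lemma bump_composition_norms:
  assumes Rn: "\<And>n. R n = 2 ^ n * \<Psi> (q n)" and X: "X > 0"
    and big: "1000 * 32 ^ (n + 4) * (\<Psi> (q (n + 4)))\<^sup>2 \<le> \<Psi> X"
  shows "hnorm \<Psi> (bump (2 ^ n) j \<circ> symbol R) \<ge> 1 / (2 * X)"
proof -
  let ?m = "n + 4" and ?f = "bump (2 ^ n) j" and ?\<tau> = "2 * pi * real j / real (2 ^ n)"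
  have hol: "?f holomorphic_on ball 0 1" by (rule holomorphic_bump)
  obtain t1 t0 where t: "0 < t1" "t1 \<le> t0" "t0 < 2*pi" "1 / (144 * 2 ^ ?m * (2 ^ ?m * R ?m)\<^sup>2) \<le> t0 - t1"
    "\<And>t. t1 \<le> t \<Longrightarrow> t \<le> t0 \<Longrightarrow> cmod (symbol R (cis t) - cis ?\<tau>) \<le> 4 * (1/2) ^ ?m"
    using symbol_near_boundary_point[of ?m ?\<tau>] by blast
  obtain \<kappa> where \<kappa>: "0 < \<kappa>" "\<Psi> \<kappa> \<le> 1" using small_value by blast
  have le1: "cmod (?f z) \<le> 1" if z: "cmod z \<le> 1" "j < 2 ^ n" for z
  proof -
    have "cmod (?f z) \<le> (\<Sum>i<2 ^ n. cmod (bump (2 ^ n) i z))" using z by (intro member_le_sum) auto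
    then show ?thesis using sum_cmod_bump_le_1[OF z(1), of "2 ^ n"] by simp
  qed
  have bd: "bdry (?f \<circ> symbol R) t = ?f (symbol R (cis t))" if "0 < t" "t < 2*pi" for t
    using hol that by (rule bdry_composition)
  have "(?f \<circ> symbol R) \<in> hardy_orlicz \<Psi>"
  proof -
    have "compact (cball (0::complex) 1)" by simp
    then obtain K where K: "\<And>z. z \<in> cball 0 1 \<Longrightarrow> cmod (?f z) \<le> K"
      using compact_imp_bounded[OF compact_continuous_image[OF holomorphic_on_imp_continuous_on[OF holomorphic_bump[of "2^n" j "cball 0 1"]]]]
      unfolding bounded_iff by blast
    have "?f \<in> hardy_orlicz \<Psi>"
    proof (rule bounded_in_hardy(1)[OF holomorphic_bump _ _ \<kappa>])
      show "cmod (?f z) \<le> max 1 K" if "cmod z \<le> 1" for z using K[of z] that by simp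
    qed simp
    then show ?thesis by (rule composition_in_hardy)
  qed
  then have ex: "\<exists>C>0. circ_modular \<Psi> (\<lambda>t. inverse C *\<^sub>R bdry (?f \<circ> symbol R) t) \<le> 1"
    by (rule hardy_boundary_modular)
  have ge: "1/2 \<le> cmod (bdry (?f \<circ> symbol R) t)" if "t1 \<le> t" "t \<le> t0" for t
  proof -
    have t': "0 < t" "t < 2*pi" using that t by auto
    have "cmod (symbol R (cis t) - cis ?\<tau>) \<le> 4 * (1/2) ^ ?m" using t(5) that by blast
    also have "4 * (1/2) ^ ?m = 1 / (4 * real (2 ^ n))" by (simp add: power_add power_divide)
    finally have "cmod (symbol R (cis t) - cis ?\<tau>) \<le> 1 / (4 * real (2 ^ n))" .
    then show ?thesis unfolding bd[OF t'] using cmod_symbol_less_1[of "cis t"]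
      by (intro cmod_bump_ge) auto
  qed
  have "\<Psi> X * (t0 - t1) > 2 * pi"
  proof -
    have P: "\<Psi> (q ?m) > 0"
    proof -
      have "0 < 2 ^ ?m * \<Psi> (q ?m)" using R_ge_1[of ?m] Rn[of ?m] by linarith
      then show ?thesis by (simp add: zero_less_mult_iff)
    qed
    \<comment> \<open>R contributes another power of 2, so the base is 2 times 4 times 4.\<close>
    have "2 ^ ?m * (2 ^ ?m * R ?m)\<^sup>2 = 32 ^ ?m * (\<Psi> (q ?m))\<^sup>2"
    proof -
      have "(32::real) ^ ?m = (2 * (2 * 2)\<^sup>2) ^ ?m" by simp
      also have "\<dots> = 2 ^ ?m * (2 ^ ?m * 2 ^ ?m)\<^sup>2" 
        by (simp only: power2_eq_square power_mult_distrib)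
      finally show ?thesis by (simp add: Rn power_mult_distrib)
    qed
    then have len: "1 / (144 * (32 ^ ?m * (\<Psi> (q ?m))\<^sup>2)) \<le> t0 - t1" using t(4) by (simp only: mult.assoc)
    have Z: "0 < 32 ^ ?m * (\<Psi> (q ?m))\<^sup>2" using P by simp
    \<comment> \<open>This inequality is the reason for the constant 1000 in
      \<open>big\<close>.\<close>
    have "2 * pi < 1000 / 144" using pi_less_4 pi_approx(2) by simp
    also have "\<dots> = 1000 * (32 ^ ?m * (\<Psi> (q ?m))\<^sup>2) * (1 / (144 * (32 ^ ?m * (\<Psi> (q ?m))\<^sup>2)))"
      using Z P by (simp add: field_simps)
    also have "\<dots> \<le> \<Psi> X * (t0 - t1)"
      using big len Z X by (intro mult_mono nonneg) (simp_all only: mult.assoc, auto simp: less_imp_le)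
    finally show ?thesis .
  qed
  then show ?thesis unfolding hnorm_def using t(1-3) 
    by (intro lux_norm_ge[OF ex _ _ _ ge X]) auto
qed

text \<open>Two uses of Delta^2 give \<Psi>(\<alpha>^2 y) \<ge> \<Psi>(y)^4 with \<alpha>^2 y =
  2^(n/(2p)). One factor \<Psi>(y)^2 absorbs the squared value of \<Psi>, whose argument is
  eventually below y; the other absorbs 1000 32^(n+4), as \<Psi> dominates a high power of
  y.\<close>

lemma super_polynomial_growth:
  assumes p: "p > 0" and x1: "x1 \<ge> 0"
  shows "eventually (\<lambda>n. 1000 * 32 ^ (n + 4) * (\<Psi> (x1 + real (n + 4) * G (n + 9)))\<^sup>2 \<le> \<Psi> (2 powr (real n / (2 * p)))) sequentially"
proof -
  \<comment> \<open>b^(2n) is the target argument 2^(n/(2p)): one factor b^n is spent on G, the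
    other on the polynomial terms and \<alpha>^2.\<close>
  define b :: real where "b = 2 powr (1 / (4 * p))"
  have b: "b > 1" using p by (simp add: b_def)
  \<comment> \<open>k makes b^k \<ge> 2, so the bound on G^k yields G (n + 9) \<le> M b^n; the 512
    below is 2^9.\<close>
  define k where "k = nat \<lceil>4 * p\<rceil>"
  have k: "k \<ge> 1" "real k \<ge> 4 * p" using p by (auto simp: k_def) linarith+
  have bk: "b ^ k \<ge> 2"
  proof -
    have "b ^ k = 2 powr (real k / (4 * p))" using p by (simp add: b_def powr_powr flip: powr_realpow)
    also have "\<dots> \<ge> 2 powr 1" using p k by (intro powr_mono) (auto simp: field_simps)
    finally show ?thesis by simp
  qed
  obtain K where K: "K \<ge> 0" "\<And>n. G n ^ k \<le> K * 2 ^ n" using G_power[OF k(1)] by blast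
  define M where "M = max 1 (K * 512)"
  have M: "M \<ge> 1" "M \<ge> K * 512" by (auto simp: M_def)
  have G_le: "G (n + 9) \<le> M * b ^ n" for n
  proof (rule power_le_imp_le_base)
    have "G (n + 9) ^ Suc (k - 1) = G (n + 9) ^ k" using k by simp
    also have "\<dots> \<le> K * 2 ^ (n + 9)" by (rule K(2))
    also have "\<dots> = (K * 512) * 2 ^ n" by (simp add: power_add)
    also have "\<dots> \<le> M ^ k * (b ^ k) ^ n"
    proof (intro mult_mono)
      have "M ^ 1 \<le> M ^ k" using M k by (intro power_increasing) auto
      then show "K * 512 \<le> M ^ k" using M by simp
      show "2 ^ n \<le> (b ^ k) ^ n" using bk by (intro power_mono) auto
    qed (use K M in auto)
    also have "\<dots> = (M * b ^ n) ^ k" by (simp add: power_mult_distrib power_mult[symmetric] mult.commute)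
    also have "\<dots> = (M * b ^ n) ^ Suc (k - 1)" using k by simp
    finally show "G (n + 9) ^ Suc (k - 1) \<le> (M * b ^ n) ^ Suc (k - 1)" .
    show "0 \<le> M * b ^ n" using M b by simp
  qed
  from d2 obtain \<alpha> x0 where a: "\<alpha> > 1" "\<And>x. x \<ge> x0 \<Longrightarrow> (\<Psi> x)\<^sup>2 \<le> \<Psi> (\<alpha> * x)"
    by (auto simp: delta2_def)
  \<comment> \<open>As 2^j exceeds j, the power y^(2^j) outgrows 32^n.\<close>
  obtain j where j: "32 < b ^ j" using real_arch_pow[OF b, of 32] by blast
  obtain c X where cX: "c > 0" "X \<ge> 1" "\<And>x. x \<ge> X \<Longrightarrow> \<Psi> x \<ge> c * x ^ (2 ^ j)" using ge_power2[of j] by blast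
  define c' where "c' = c / (\<alpha>\<^sup>2) ^ (2 ^ j)"
  have c': "c' > 0" using cX a by (simp add: c'_def)
  define y where "y n = b ^ n * b ^ n / \<alpha>\<^sup>2" for n
  have "eventually (\<lambda>n. (x1 + (real n + 4) * M) * \<alpha>\<^sup>2 \<le> b ^ n) sequentially"
    using b by real_asymp
  moreover have "eventually (\<lambda>n. max X x0 * \<alpha>\<^sup>2 \<le> b ^ n * b ^ n) sequentially"
    using b by real_asymp
  moreover have "eventually (\<lambda>n. 1000 * 32 ^ 4 \<le> c'\<^sup>2 * 32 ^ n) sequentially"
    using c' by real_asymp
  ultimately show ?thesis
  proof eventually_elim
    case (elim n)
    have \<alpha>2: "\<alpha>\<^sup>2 > 0" using a by simp
    have bn: "b ^ n \<ge> 1" using b by simp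
    have yX: "max X x0 \<le> y n" unfolding y_def using pos_le_divide_eq[OF \<alpha>2] elim(2) by blast
    have y0: "0 \<le> y n" using cX yX by simp
    have q_nonneg: "0 \<le> x1 + real (n + 4) * G (n + 9)" using x1 G_nonneg by simp
    have "x1 + real (n + 4) * G (n + 9) \<le> x1 * b ^ n + real (n + 4) * (M * b ^ n)"
      using G_le[of n] x1 bn mult_left_mono[OF bn x1] by (intro add_mono mult_left_mono) auto
    also have "\<dots> = (x1 + (real n + 4) * M) * b ^ n" by (simp add: algebra_simps)
    also have "\<dots> \<le> y n"
    proof -
      have "(x1 + (real n + 4) * M) * \<alpha>\<^sup>2 * b ^ n \<le> b ^ n * b ^ n" using elim(1) bn by (intro mult_right_mono) auto
      then show ?thesis unfolding y_def using \<alpha>2 by (subst pos_le_divide_eq) (simp_all add: mult_ac)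
    qed
    finally have "\<Psi> (x1 + real (n + 4) * G (n + 9)) \<le> \<Psi> (y n)" by (intro mono q_nonneg)
    then have 1: "(\<Psi> (x1 + real (n + 4) * G (n + 9)))\<^sup>2 \<le> (\<Psi> (y n))\<^sup>2"
      using nonneg[OF q_nonneg] by (intro power_mono)
    have "c' * 32 ^ n \<le> \<Psi> (y n)"
    proof -
      have "j \<le> 2 ^ j" by (rule less_imp_le[OF less_exp])
      then have "b ^ j \<le> b ^ (2 ^ j)" using b by (intro power_increasing) auto
      also have "\<dots> \<le> b ^ (2 ^ j) * b ^ (2 ^ j)" using b by simp
      finally have "32 \<le> b ^ (2 ^ j) * b ^ (2 ^ j)" using j by linarith
      then have "32 ^ n \<le> (b ^ (2 ^ j) * b ^ (2 ^ j)) ^ n" by (intro power_mono) auto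
      also have "\<dots> = (b ^ n * b ^ n) ^ (2 ^ j)" by (simp add: power_mult_distrib power_mult[symmetric] mult.commute)
      finally have "c' * 32 ^ n \<le> c' * (b ^ n * b ^ n) ^ (2 ^ j)" using c' by simp
      also have "\<dots> = c * y n ^ (2 ^ j)" by (simp add: c'_def y_def power_divide)
      also have "\<dots> \<le> \<Psi> (y n)" using yX by (intro cX(3)) simp
      finally show ?thesis .
    qed
    then have "(c' * 32 ^ n)\<^sup>2 \<le> (\<Psi> (y n))\<^sup>2" using c' by (intro power_mono) auto
    moreover have "1000 * 32 ^ (n + 4) \<le> (c' * 32 ^ n)\<^sup>2"
    proof -
      have "1000 * 32 ^ 4 * 32 ^ n \<le> c'\<^sup>2 * 32 ^ n * 32 ^ n" using elim(3) by (intro mult_right_mono) auto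
      then show ?thesis by (simp add: power_add power_mult_distrib power2_eq_square mult_ac)
    qed
    ultimately have 2: "1000 * 32 ^ (n + 4) \<le> (\<Psi> (y n))\<^sup>2" by linarith
    have "1000 * 32 ^ (n + 4) * (\<Psi> (x1 + real (n + 4) * G (n + 9)))\<^sup>2 \<le> (\<Psi> (y n))\<^sup>2 * (\<Psi> (y n))\<^sup>2"
      using 1 2 by (intro mult_mono) auto
    also have "\<dots> = ((\<Psi> (y n))\<^sup>2)\<^sup>2" by (simp add: power2_eq_square)
    also have "\<dots> \<le> (\<Psi> (\<alpha> * y n))\<^sup>2" using a(2)[of "y n"] yX by (intro power_mono) auto
    also have "\<dots> \<le> \<Psi> (\<alpha> * (\<alpha> * y n))"
    proof (rule a(2))
      have "1 * y n \<le> \<alpha> * y n" using a y0 by (intro mult_right_mono) auto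
      then show "x0 \<le> \<alpha> * y n" using yX by simp
    qed
    also have "\<alpha> * (\<alpha> * y n) = 2 powr (real n / (2 * p))"
    proof -
      have "b ^ n = 2 powr (real n / (4 * p))" by (simp add: b_def powr_powr flip: powr_realpow)
      then have "b ^ n * b ^ n = 2 powr (real n / (4 * p) + real n / (4 * p))" by (simp only: powr_add)
      also have "real n / (4 * p) + real n / (4 * p) = real n / (2 * p)" using p by (simp add: field_simps)
      finally show ?thesis using a by (simp add: y_def power2_eq_square)
    qed
    finally show ?case .
  qed
qed

text \<open>A bound in weak l1 gives one in weak lp, with a constant independent of N; against it,
  the p-th powers of the 2^n image norms add up to at least 2^(n/2 - p).\<close>

lemma not_p_summing:
  assumes Rn: "\<And>n. R n = 2 ^ n * \<Psi> (x1 + real n * G (n + 5))" and x1: "x1 \<ge> 0" and p: "p \<ge> 1"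
  shows "\<not> comp_p_summing \<Psi> p (symbol R)"
proof
  assume "comp_p_summing \<Psi> p (symbol R)"
  then obtain C where C: "C \<ge> 0" and summing: "\<And>xs. set xs \<subseteq> hardy_orlicz \<Psi> \<Longrightarrow>
        (\<Sum>f\<leftarrow>xs. hnorm \<Psi> (f \<circ> symbol R) powr p)
          \<le> C powr p * Sup {(\<Sum>f\<leftarrow>xs. cmod (L f) powr p) | L. L \<in> hardy_dual_ball \<Psi>}"
    unfolding comp_p_summing_def by blast
  obtain \<kappa>' where \<kappa>': "0 < \<kappa>'" "\<Psi> \<kappa>' \<le> 1" using small_value by blast
  define \<kappa> where "\<kappa> = min \<kappa>' 1"
  have \<kappa>: "0 < \<kappa>" "\<kappa> \<le> 1" "\<Psi> \<kappa> \<le> 1"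
    using \<kappa>' mono[of \<kappa> \<kappa>'] by (auto simp: \<kappa>_def)
  let ?K = "1 / \<kappa>"
  define B where "B = C powr p * ?K powr p"
  have upper: "(\<Sum>j<N. hnorm \<Psi> (bump N j \<circ> symbol R) powr p) \<le> B" if N: "N > 0" for N
  proof -
    let ?xs = "map (bump N) [0..<N]"
    have sum1: "\<And>z. cmod z \<le> 1 \<Longrightarrow> (\<Sum>j<N. cmod (bump N j z)) \<le> 1" using sum_cmod_bump_le_1[OF _ N] .
    have sub: "set ?xs \<subseteq> hardy_orlicz \<Psi>"
    proof
      fix f assume "f \<in> set ?xs"
      then obtain j where j: "j < N" "f = bump N j" by auto
      show "f \<in> hardy_orlicz \<Psi>" unfolding j(2)
      proof (rule bounded_in_hardy(1)[OF holomorphic_bump _ zero_less_one \<kappa>(1,3)])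
        fix z :: complex assume z: "cmod z \<le> 1"
        have "cmod (bump N j z) \<le> (\<Sum>j<N. cmod (bump N j z))" using j by (intro member_le_sum) auto
        with sum1[OF z] show "cmod (bump N j z) \<le> 1" by linarith
      qed
    qed
    have listsum: "(\<Sum>f\<leftarrow>?xs. h f) = (\<Sum>j<N. h (bump N j))" for h :: "(complex \<Rightarrow> complex) \<Rightarrow> real"
      by (simp add: interv_sum_list_conv_sum_set_nat o_def atLeast0LessThan)
    \<comment> \<open>The zero functional makes the set of sums nonempty, as bounding a real
      \<open>Sup\<close> requires.\<close>
    have "(\<lambda>_. 0) \<in> hardy_dual_ball \<Psi>"
      unfolding hardy_dual_ball_def hnorm_def using lux_norm_nonneg[OF hardy_boundary_modular] by auto
    then have ne: "{(\<Sum>f\<leftarrow>?xs. cmod (L f) powr p) | L. L \<in> hardy_dual_ball \<Psi>} \<noteq> {}" by blast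
    have "Sup {(\<Sum>f\<leftarrow>?xs. cmod (L f) powr p) | L. L \<in> hardy_dual_ball \<Psi>} \<le> ?K powr p"
    proof (rule cSup_least[OF ne])
      fix s assume "s \<in> {(\<Sum>f\<leftarrow>?xs. cmod (L f) powr p) | L. L \<in> hardy_dual_ball \<Psi>}"
      then obtain L where L: "L \<in> hardy_dual_ball \<Psi>" "s = (\<Sum>f\<leftarrow>?xs. cmod (L f) powr p)" by blast
      have w: "(\<Sum>j<N. cmod (L (bump N j))) \<le> ?K"
        by (rule weakly_1_summable[OF holomorphic_bump sum1 \<kappa>(1,3) L(1)])
      have "s = (\<Sum>j<N. cmod (L (bump N j)) powr p)" unfolding L(2) by (rule listsum)
      \<comment> \<open>Each single term is at most 1 / \<kappa>, so p - 1 of the p powers can be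
        replaced by this bound.\<close>
      also have "\<dots> \<le> (\<Sum>j<N. cmod (L (bump N j)) * ?K powr (p - 1))"
      proof (rule sum_mono)
        fix j assume j: "j \<in> {..<N}"
        let ?x = "cmod (L (bump N j))"
        have "?x \<le> (\<Sum>j<N. cmod (L (bump N j)))" using j by (intro member_le_sum) auto
        then have xK: "?x \<le> ?K" using w by linarith
        show "?x powr p \<le> ?x * ?K powr (p - 1)"
        proof (cases "?x = 0")
          case False
          then have "?x powr p = ?x * ?x powr (p - 1)" using powr_add[of ?x 1 "p - 1"] by simp
          also have "\<dots> \<le> ?x * ?K powr (p - 1)" using xK p by (intro mult_left_mono powr_mono2) auto
          finally show ?thesis .
        qed simp
      qed
      also have "\<dots> = (\<Sum>j<N. cmod (L (bump N j))) * ?K powr (p - 1)" by (rule sum_distrib_right[symmetric])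
      also have "\<dots> \<le> ?K * ?K powr (p - 1)" using w by (intro mult_right_mono) auto
      also have "\<dots> = ?K powr p" using powr_add[of ?K 1 "p - 1"] \<kappa> by simp
      finally show "s \<le> ?K powr p" .
    qed
    then have "C powr p * Sup {(\<Sum>f\<leftarrow>?xs. cmod (L f) powr p) | L. L \<in> hardy_dual_ball \<Psi>} \<le> B"
      unfolding B_def by (intro mult_left_mono) auto
    with summing[OF sub] show ?thesis unfolding listsum by linarith
  qed
  have "eventually (\<lambda>n. B < 2 powr (real n / 2 - p)) sequentially" by real_asymp
  moreover have "eventually (\<lambda>n. 1000 * 32 ^ (n + 4) * (\<Psi> (x1 + real (n + 4) * G (n + 9)))\<^sup>2 \<le> \<Psi> (2 powr (real n / (2 * p)))) sequentially"
    using p x1 by (intro super_polynomial_growth) auto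
  ultimately have "eventually (\<lambda>n. B < 2 powr (real n / 2 - p) \<and> 1000 * 32 ^ (n + 4) * (\<Psi> (x1 + real (n + 4) * G (n + 9)))\<^sup>2 \<le> \<Psi> (2 powr (real n / (2 * p)))) sequentially"
    by (rule eventually_conj)
  then obtain n where n: "B < 2 powr (real n / 2 - p)" 
      "1000 * 32 ^ (n + 4) * (\<Psi> (x1 + real (n + 4) * G (n + 9)))\<^sup>2 \<le> \<Psi> (2 powr (real n / (2 * p)))"
    by (auto simp: eventually_sequentially)
  let ?X = "2 powr (real n / (2 * p))"
  have lower: "hnorm \<Psi> (bump (2 ^ n) j \<circ> symbol R) \<ge> 1 / (2 * ?X)" for j
    by (rule bump_composition_norms[where q = "\<lambda>n. x1 + real n * G (n + 5)", OF Rn]) (use n(2) in \<open>simp_all add: add.commute\<close>)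
  have "2 powr (real n / 2 - p) = 2 ^ n * (1 / (2 * ?X)) powr p"
  proof -
    have "1 / (2 * ?X) = 2 powr (- 1 - real n / (2 * p))" by (simp add: powr_diff powr_minus field_simps)
    then have "(1 / (2 * ?X)) powr p = 2 powr ((- 1 - real n / (2 * p)) * p)" by (simp only: powr_powr)
    also have "(- 1 - real n / (2 * p)) * p = - p - real n / 2" using p by (simp add: field_simps)
    finally have "2 ^ n * (1 / (2 * ?X)) powr p = 2 powr real n * 2 powr (- p - real n / 2)" by (simp add: powr_realpow)
    also have "\<dots> = 2 powr (real n + (- p - real n / 2))" by (rule powr_add[symmetric])
    also have "real n + (- p - real n / 2) = real n / 2 - p" by simp
    finally show ?thesis by simp
  qed
  also have "\<dots> = (\<Sum>j<(2::nat) ^ n. (1 / (2 * ?X)) powr p)" by simp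
  also have "\<dots> \<le> (\<Sum>j<2 ^ n. hnorm \<Psi> (bump (2 ^ n) j \<circ> symbol R) powr p)"
    using p by (intro sum_mono powr_mono2 lower) auto
  also have "\<dots> \<le> B" by (rule upper) simp
  finally show False using n(1) by simp
qed

end

theorem mainTheorem2:
  fixes \<Psi> :: "real \<Rightarrow> real"
  assumes "orlicz_function \<Psi>" and "delta2 \<Psi>"
  shows "\<exists>\<phi>::complex \<Rightarrow> complex.
           \<phi> holomorphic_on ball 0 1 \<and> \<phi> ` ball 0 1 \<subseteq> ball 0 1 \<and>
           (\<forall>f\<in>hardy_orlicz \<Psi>. f \<circ> \<phi> \<in> hardy_orlicz \<Psi>) \<and>
           order_bounded_M \<Psi> \<phi> \<and>
           comp_compact \<Psi> \<phi> \<and>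
           (\<forall>p\<ge>1. \<not> comp_p_summing \<Psi> p \<phi>)"
proof -
  interpret orlicz_delta2 \<Psi> by unfold_locales (rule assms)+
  obtain G where G: "growth_bound G" using ex_growth_bound by blast
  then have G_mono: "\<And>m n. m \<le> n \<Longrightarrow> G m \<le> G n" and G_nonneg: "\<And>n. 0 \<le> G n"
    by (auto simp: growth_bound_def mono_def)
  obtain x1 where x1: "x1 \<ge> 1" "\<And>x. x \<ge> x1 \<Longrightarrow> \<Psi> x \<ge> 1 * x" using eventually_ge_linear[of 1] by blast
  \<comment> \<open>Adding x1 makes \<Psi> (q n) at least 1, which gives R n \<ge> 2^n.\<close>
  define q where "q n = x1 + real n * G (n + 5)" for n
  have q_ge: "x1 \<le> q n" for n using G_nonneg[of "n + 5"] by (simp add: q_def)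
  have \<Psi>q: "1 \<le> \<Psi> (q n)" for n using x1(2)[OF q_ge[of n]] q_ge[of n] x1(1) by linarith
  have q_mono: "q m \<le> q n" if "m \<le> n" for m n
    unfolding q_def using that G_nonneg by (intro add_left_mono mult_mono G_mono) auto
  define R where "R n = 2 ^ n * \<Psi> (q n)" for n
  interpret admissible_radii \<Psi> R G
  proof
    show "2 ^ n \<le> R n" for n using mult_left_mono[OF \<Psi>q[of n], of "2 ^ n"] by (simp add: R_def)
    show "mono R"
    proof (rule monoI)
      fix m n :: nat assume mn: "m \<le> n"
      have "0 \<le> q m" using q_ge[of m] x1(1) by linarith
      then have "\<Psi> (q m) \<le> \<Psi> (q n)" by (intro mono q_mono mn)
      then show "R m \<le> R n" unfolding R_def using \<Psi>q[of m] mn by (intro mult_mono power_increasing) auto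
    qed
    show "growth_bound G" by (rule G)
    show "2 ^ n * \<Psi> (real n * G (n + 5)) \<le> R n" for n
      unfolding R_def q_def using G_nonneg x1(1) by (intro mult_left_mono mono) auto
  qed
  have "\<forall>p\<ge>1. \<not> comp_p_summing \<Psi> p (symbol R)"
    using x1(1) by (intro allI impI not_p_summing[of x1]) (auto simp: R_def q_def)
  then show ?thesis
    using holomorphic_symbol symbol_maps_disc composition_in_hardy order_bounded compact_composition by blast
qed

end
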